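(* Let $\Gamma$ be a connected compact metric graph. Then $$h(\Gamma)=\lambda_1(\Gamma):=\inf\{TV_\Gamma(u): u\in\Pi(\Gamma)\},\qquad \Pi(\Gamma):=\{u\in BV(\Gamma): \|u\|_{L^1(\Gamma)}=1,\ 0\in\mathrm{med}_\ell(u)\}.$$ Moreover, there exist a minimizer $u$ of the problem $\inf\{TV_\Gamma(u): u\in\Pi(\Gamma)\}$ and a $t\ge0$ such that $E_t(u)=\{x\in\Gamma: u(x)>t\}$ is a Cheeger cut of $\Gamma$.
   Context: $\Gamma$ is a connected compact metric graph: it has finitely many vertices $V(\Gamma)$ and edges $E(\Gamma)$, no loops and no multiple edges; each edge $e$ is identified with an interval $[0,\ell_e]$, $0<\ell_e<\infty$, its initial vertex $i_e$ corresponding to $0$ and its terminal vertex $f_e$ to $\ell_e$. $E_v(\Gamma)$ is the set of edges incident to the vertex $v$. A function $u$ on $\Gamma$ is a collection of functions $[u]_e$ on $(0,\ell_e)$, $e\in E(\Gamma)$; $\int_\Gamma u\,dx=\sum_e\int_0^{\ell_e}[u]_e\,dx$. $L^p(\Gamma)$, $W^{1,p}(\Gamma)$, $BV(\Gamma)$ consist of the $u$ with $[u]_e$ in $L^p(0,\ell_e)$, $W^{1,p}(0,\ell_e)$, $BV(0,\ell_e)$ for every $e$ (no continuity at vertices is required); $u'$ is the edgewise weak derivative. For $A\subset\Gamma$ measurable, $\ell(A)=\int_\Gamma \chi_A\,dx$. For $z\in W^{1,2}(\Gamma)$ and $e\in E_v(\Gamma)$ put $[z]_e(v)=[z]_e(\ell_e)$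 if $v=f_e$ and $[z]_e(v)=-[z]_e(0)$ if $v=i_e$. Let $X_K(\Gamma)=\{z\in W^{1,2}(\Gamma): \sum_{e\in E_v(\Gamma)}[z]_e(v)=0\ \forall v\in V(\Gamma)\}$. The total variation is $TV_\Gamma(u)=\sup\{|\int_\Gamma u z'\,dx| : z\in X_K(\Gamma),\ \|z\|_{L^\infty(\Gamma)}\le 1\}$ (value in $[0,+\infty]$ for $u\in L^1(\Gamma)$), and $\mathrm{Per}_\Gamma(E)=TV_\Gamma(\chi_E)$. The $\Gamma$-Cheeger constant of $\Gamma$ is $h(\Gamma)=\inf\{\mathrm{Per}_\Gamma(D)/\ell(D): D\subset\Gamma \text{ measurable},\ 0<\ell(D)\le\frac12\ell(\Gamma)\}$. A set $D$ (or the partition $(D,\Gamma\setminus D)$) is a Cheeger cut of $\Gamma$ if $0<\ell(D)\le\frac12\ell(\Gamma)$ and $h(\Gamma)=\mathrm{Per}_\Gamma(D)/\ell(D)$. $\mu\in\mathbb R$ is a median of $u:\Gamma\to\mathbb R$, written $\mu\in\mathrm{med}_\ell(u)$, if $\ell(\{u<\mu\})\le\frac12\ell(\Gamma)$ and $\ell(\{u>\mu\})\le\frac12\ell(\Gamma)$. *)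

theory Defs
  imports
    "HOL-Probability.Probability"
    "Graph_Theory.Digraph_Component"
begin

section \<open>Metric graphs\<close>

text \<open>
  The initial and terminal vertex of an edge are the tail and the head of the corresponding
  arc of the underlying digraph; the edge itself is a copy of the interval from 0 (tail) to
  its length (head).
\<close>

record ('v, 'e) metric_graph =
  skeleton :: "('v, 'e) pre_digraph"
  len :: "'e \<Rightarrow> real"

abbreviation vertices :: "('v, 'e) metric_graph \<Rightarrow> 'v set" where
  "vertices \<Gamma> \<equiv> verts (skeleton \<Gamma>)"

abbreviation edges :: "('v, 'e) metric_graph \<Rightarrow> 'e set" where
  "edges \<Gamma> \<equiv> arcs (skeleton \<Gamma>)"

abbreviation init_vertex :: "('v, 'e) metric_graph \<Rightarrow> 'e \<Rightarrow> 'v" where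
  "init_vertex \<Gamma> \<equiv> tail (skeleton \<Gamma>)"

abbreviation term_vertex :: "('v, 'e) metric_graph \<Rightarrow> 'e \<Rightarrow> 'v" where
  "term_vertex \<Gamma> \<equiv> head (skeleton \<Gamma>)"

text \<open>
  Multiple edges are excluded regardless of orientation, which is stronger than
  \<open>nomulti_digraph\<close>. A single vertex without edges is not a metric graph (it has
  length 0), hence the requirement of at least one edge.
\<close>

definition connected_compact_metric_graph :: "('v, 'e) metric_graph \<Rightarrow> bool" where
  "connected_compact_metric_graph \<Gamma> \<longleftrightarrow>
     fin_digraph (skeleton \<Gamma>) \<and> loopfree_digraph (skeleton \<Gamma>) \<and>
     (\<forall>e\<in>edges \<Gamma>. \<forall>e'\<in>edges \<Gamma>.
        {init_vertex \<Gamma> e, term_vertex \<Gamma> e} = {init_vertex \<Gamma> e', term_vertex \<Gamma> e'} \<longrightarrow> e = e') \<and>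
     Digraph_Component.connected (skeleton \<Gamma>) \<and>
     edges \<Gamma> \<noteq> {} \<and>
     (\<forall>e\<in>edges \<Gamma>. 0 < len \<Gamma> e)"

definition incident_edges :: "('v, 'e) metric_graph \<Rightarrow> 'v \<Rightarrow> 'e set" where
  "incident_edges \<Gamma> v = {e \<in> edges \<Gamma>. init_vertex \<Gamma> e = v \<or> term_vertex \<Gamma> e = v}"


section \<open>Function spaces on an interval\<close>

text \<open>
  Functions on the open interval from 0 to \<open>l\<close> are total functions of which only the
  restriction to the interval, up to Lebesgue null sets, is relevant.
\<close>

abbreviation leb :: "real \<Rightarrow> real measure" where
  "leb l \<equiv> lebesgue_on {0<..<l}"

definition Lp_interval :: "real \<Rightarrow> real \<Rightarrow> (real \<Rightarrow> real) set" where
  "Lp_interval p l =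
     {f \<in> borel_measurable (leb l). integrable (leb l) (\<lambda>x. \<bar>f x\<bar> powr p)}"

text \<open>Continuously differentiable functions with compact support in the open interval.\<close>

definition test_functions :: "real \<Rightarrow> (real \<Rightarrow> real) set" where
  "test_functions l =
     {\<phi>. \<phi> C1_differentiable_on UNIV \<and> closure {x. \<phi> x \<noteq> 0} \<subseteq> {0<..<l}}"

definition has_weak_derivative :: "real \<Rightarrow> (real \<Rightarrow> real) \<Rightarrow> (real \<Rightarrow> real) \<Rightarrow> bool" where
  "has_weak_derivative l f g \<longleftrightarrow>
     f \<in> Lp_interval 1 l \<and> g \<in> Lp_interval 1 l \<and>
     (\<forall>\<phi>\<in>test_functions l.
        (\<integral>x. f x * deriv \<phi> x \<partial>leb l) = - (\<integral>x. g x * \<phi> x \<partial>leb l))"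

definition W1p_interval :: "real \<Rightarrow> real \<Rightarrow> (real \<Rightarrow> real) set" where
  "W1p_interval p l =
     {f \<in> Lp_interval p l. \<exists>g\<in>Lp_interval p l. has_weak_derivative l f g}"

text \<open>
  Sobolev functions in one dimension are evaluated at the end points through their
  representative that is continuous on the closed interval; its values there are unique
  (for \<open>l > 0\<close>).
\<close>

definition continuous_rep :: "real \<Rightarrow> (real \<Rightarrow> real) \<Rightarrow> real \<Rightarrow> real" where
  "continuous_rep l f =
     (SOME g. continuous_on {0..l} g \<and> (AE x in leb l. f x = g x))"

definition variation_interval :: "real \<Rightarrow> (real \<Rightarrow> real) \<Rightarrow> ereal" where
  "variation_interval l f =
     (SUP \<phi>\<in>{\<phi> \<in> test_functions l. \<forall>x. \<bar>\<phi> x\<bar> \<le> 1}. ereal (\<integral>x. f x * deriv \<phi> x \<partial>leb l))"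

definition BV_interval :: "real \<Rightarrow> (real \<Rightarrow> real) set" where
  "BV_interval l = {f \<in> Lp_interval 1 l. variation_interval l f < \<infinity>}"


section \<open>Functions and measurable sets on a metric graph\<close>

text \<open>
  A function on the graph is the family \<open>u e\<close> of its restrictions to the edges. Subsets of
  the graph are sets of points \<open>(e, x)\<close> in the interior of the edges; the finitely many
  vertices form a null set and are left out.
\<close>

definition points :: "('v, 'e) metric_graph \<Rightarrow> ('e \<times> real) set" where
  "points \<Gamma> = (SIGMA e:edges \<Gamma>. {0<..<len \<Gamma> e})"

definition graph_integral :: "('v, 'e) metric_graph \<Rightarrow> ('e \<Rightarrow> real \<Rightarrow> real) \<Rightarrow> real" where
  "graph_integral \<Gamma> u = (\<Sum>e\<in>edges \<Gamma>. \<integral>x. u e x \<partial>leb (len \<Gamma> e))"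

definition L1_norm :: "('v, 'e) metric_graph \<Rightarrow> ('e \<Rightarrow> real \<Rightarrow> real) \<Rightarrow> real" where
  "L1_norm \<Gamma> u = graph_integral \<Gamma> (\<lambda>e x. \<bar>u e x\<bar>)"

definition Linf_norm :: "('v, 'e) metric_graph \<Rightarrow> ('e \<Rightarrow> real \<Rightarrow> real) \<Rightarrow> ereal" where
  "Linf_norm \<Gamma> u = (SUP e\<in>edges \<Gamma>. esssup (leb (len \<Gamma> e)) (\<lambda>x. ereal \<bar>u e x\<bar>))"

definition W1p :: "real \<Rightarrow> ('v, 'e) metric_graph \<Rightarrow> ('e \<Rightarrow> real \<Rightarrow> real) set" where
  "W1p p \<Gamma> = {u. \<forall>e\<in>edges \<Gamma>. u e \<in> W1p_interval p (len \<Gamma> e)}"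

definition BV :: "('v, 'e) metric_graph \<Rightarrow> ('e \<Rightarrow> real \<Rightarrow> real) set" where
  "BV \<Gamma> = {u. \<forall>e\<in>edges \<Gamma>. u e \<in> BV_interval (len \<Gamma> e)}"

definition graph_weak_derivative ::
    "('v, 'e) metric_graph \<Rightarrow> ('e \<Rightarrow> real \<Rightarrow> real) \<Rightarrow> ('e \<Rightarrow> real \<Rightarrow> real) \<Rightarrow> bool" where
  "graph_weak_derivative \<Gamma> u u' \<longleftrightarrow>
     (\<forall>e\<in>edges \<Gamma>. has_weak_derivative (len \<Gamma> e) (u e) (u' e))"

definition graph_measurable :: "('v, 'e) metric_graph \<Rightarrow> ('e \<times> real) set \<Rightarrow> bool" where
  "graph_measurable \<Gamma> A \<longleftrightarrow>
     A \<subseteq> points \<Gamma> \<and> (\<forall>e\<in>edges \<Gamma>. Pair e -` A \<in> sets lebesgue)"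

definition chi :: "('e \<times> real) set \<Rightarrow> 'e \<Rightarrow> real \<Rightarrow> real" where
  "chi A e x = indicator A (e, x)"

definition graph_length :: "('v, 'e) metric_graph \<Rightarrow> ('e \<times> real) set \<Rightarrow> real" where
  "graph_length \<Gamma> A = graph_integral \<Gamma> (chi A)"


section \<open>Total variation, perimeter and Cheeger cuts\<close>

definition vertex_value ::
    "('v, 'e) metric_graph \<Rightarrow> ('e \<Rightarrow> real \<Rightarrow> real) \<Rightarrow> 'e \<Rightarrow> 'v \<Rightarrow> real" where
  "vertex_value \<Gamma> z e v =
     (if v = term_vertex \<Gamma> e then continuous_rep (len \<Gamma> e) (z e) (len \<Gamma> e)
      else - continuous_rep (len \<Gamma> e) (z e) 0)"

definition X_K :: "('v, 'e) metric_graph \<Rightarrow> ('e \<Rightarrow> real \<Rightarrow> real) set" where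
  "X_K \<Gamma> = {z \<in> W1p 2 \<Gamma>. \<forall>v\<in>vertices \<Gamma>. (\<Sum>e\<in>incident_edges \<Gamma> v. vertex_value \<Gamma> z e v) = 0}"

text \<open>
  The weak derivative \<open>z'\<close> is determined by \<open>z\<close> almost everywhere, so that quantifying over
  all its versions does not change the supremum. The pairing with \<open>z'\<close> is a genuine integral
  when \<open>u\<close> is essentially bounded, in particular for BV functions and for indicators.
\<close>

definition TV :: "('v, 'e) metric_graph \<Rightarrow> ('e \<Rightarrow> real \<Rightarrow> real) \<Rightarrow> ereal" where
  "TV \<Gamma> u =
     (SUP (z, z')\<in>{(z, z'). z \<in> X_K \<Gamma> \<and> graph_weak_derivative \<Gamma> z z' \<and> Linf_norm \<Gamma> z \<le> 1}.
        ereal \<bar>graph_integral \<Gamma> (\<lambda>e x. u e x * z' e x)\<bar>)"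

definition Per :: "('v, 'e) metric_graph \<Rightarrow> ('e \<times> real) set \<Rightarrow> ereal" where
  "Per \<Gamma> D = TV \<Gamma> (chi D)"

definition cheeger_admissible :: "('v, 'e) metric_graph \<Rightarrow> ('e \<times> real) set \<Rightarrow> bool" where
  "cheeger_admissible \<Gamma> D \<longleftrightarrow>
     graph_measurable \<Gamma> D \<and> 0 < graph_length \<Gamma> D \<and>
     graph_length \<Gamma> D \<le> 1/2 * graph_length \<Gamma> (points \<Gamma>)"

definition cheeger_constant :: "('v, 'e) metric_graph \<Rightarrow> ereal" where
  "cheeger_constant \<Gamma> =
     (INF D\<in>{D. cheeger_admissible \<Gamma> D}. Per \<Gamma> D / ereal (graph_length \<Gamma> D))"

definition cheeger_cut :: "('v, 'e) metric_graph \<Rightarrow> ('e \<times> real) set \<Rightarrow> bool" where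
  "cheeger_cut \<Gamma> D \<longleftrightarrow>
     cheeger_admissible \<Gamma> D \<and> cheeger_constant \<Gamma> = Per \<Gamma> D / ereal (graph_length \<Gamma> D)"

definition medians :: "('v, 'e) metric_graph \<Rightarrow> ('e \<Rightarrow> real \<Rightarrow> real) \<Rightarrow> real set" where
  "medians \<Gamma> u =
     {\<mu>. graph_length \<Gamma> {(e, x) \<in> points \<Gamma>. u e x < \<mu>} \<le> 1/2 * graph_length \<Gamma> (points \<Gamma>) \<and>
         graph_length \<Gamma> {(e, x) \<in> points \<Gamma>. u e x > \<mu>} \<le> 1/2 * graph_length \<Gamma> (points \<Gamma>)}"

definition Pi_set :: "('v, 'e) metric_graph \<Rightarrow> ('e \<Rightarrow> real \<Rightarrow> real) set" where
  "Pi_set \<Gamma> = {u \<in> BV \<Gamma>. L1_norm \<Gamma> u = 1 \<and> 0 \<in> medians \<Gamma> u}"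

definition lambda1 :: "('v, 'e) metric_graph \<Rightarrow> ereal" where
  "lambda1 \<Gamma> = (INF u\<in>Pi_set \<Gamma>. TV \<Gamma> u)"

definition superlevel ::
    "('v, 'e) metric_graph \<Rightarrow> ('e \<Rightarrow> real \<Rightarrow> real) \<Rightarrow> real \<Rightarrow> ('e \<times> real) set" where
  "superlevel \<Gamma> u t = {(e, x) \<in> points \<Gamma>. u e x > t}"

end

theory Submission
  imports Defs
begin

text \<open>
  The total variation of a function constant on the cells of a uniform grid with \<open>N\<close> cells per edge
  is a sum over the nodes of the grid, and one test field is optimal for all superlevel sets at once:
  at every node sort the incident cell ends by the value of the function and give the upper half flux
  \<open>1\<close> and the lower half flux \<open>-1\<close>. By the layer-cake formula such functions satisfy the Cheeger
  inequality with the constant \<open>h\<^sub>N\<close> of the unions of cells.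

  For general \<open>u\<close>, replacing \<open>u\<close> by its cell averages \<open>Pu\<close> only replaces the test field by its piecewise
  linear interpolation, so it does not increase the total variation, and testing with the primitive of
  \<open>\<phi> - P\<phi>\<close>, where \<open>\<phi> = sgn (u - Pu)\<close>, gives \<open>\<parallel>u - Pu\<parallel> \<le> (2L/N) TV u\<close> in \<open>L\<^sup>1\<close>, where \<open>L\<close> is the
  total length. Hence \<open>h\<^sub>N (\<parallel>u\<parallel> - (2L/N) TV u) \<le> TV u\<close> whenever \<open>0\<close> is a median of \<open>u\<close>.

  The discrete minimizers \<open>D\<^sub>N\<close> have integer cuts \<open>\<ge> 1\<close>, so their lengths stay away from \<open>0\<close>, and the
  \<open>L\<^sup>1\<close> estimate makes them totally bounded. A limit \<open>D\<close> satisfies \<open>Per D / \<ell>(D) \<le> TV u\<close> for all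
  \<open>u \<in> \<Pi>(\<Gamma>)\<close>; therefore \<open>D\<close> is a Cheeger cut and its normalized indicator is a minimizer.
\<close>

section \<open>Cuts and calibrations\<close>

text \<open>The obstacle is the vertex condition. Test fields need not vanish at a vertex, only
  their fluxes must cancel there, so TV is not a sum of edgewise variations and a vertex charges a
  set by the smaller of the numbers of incident ends inside and outside it. A coarea formula for
  this functional on all of BV would call for traces and jump sets; on grid functions it is finite
  combinatorics, since superlevel sets are nested and one ordering of the ends at each node serves
  all of them. The price is the mesh error: the 2 in 2L/N bounds \<phi> - P\<phi>, and L/N bounds
  the cell lengths. Averaging may also destroy the median 0, so the discrete inequality uses some
  median m of Pu; 0 returns because it minimizes the distance from u to constants. Convergence of
  the discrete constants is never proved separately: the limit inequality for D settles h and the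
  minimization over \<Pi>(\<Gamma>) at once, because normalized indicators of finite perimeter lie
  in \<Pi>(\<Gamma>). Compactness alone would allow the minimizers to vanish in the limit;
  connectedness, through cuts of at least 1, excludes that.\<close>

lemma calibration_at_node:
  fixes w :: "'h \<Rightarrow> real"
  assumes "finite S"
  shows "\<exists>V :: 'h \<Rightarrow> real. (\<forall>h\<in>S. \<bar>V h\<bar> \<le> 1) \<and> sum V S = 0 \<and>
    (\<forall>U\<subseteq>S. (\<forall>x\<in>U. \<forall>y\<in>S. w x \<le> w y \<longrightarrow> y \<in> U) \<longrightarrow>
       sum V U = real (min (card U) (card (S - U))))"
  using assms
proof (induction S rule: finite_psubset_induct)
  case (psubset S)
  show ?case
  proof (cases "card S \<le> 1")
    case True
    then have "x = y" if "x \<in> S" "y \<in> S" for x y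
      using that psubset.hyps by (auto simp: card_le_Suc0_iff_eq)
    then have "U = {} \<or> U = S" if "U \<subseteq> S" for U
      using that by blast
    then show ?thesis
      by (intro exI[of _ "\<lambda>_. 0"]) fastforce
  next
    case False
    then have "S \<noteq> {}" by auto
    then have "Max (w ` S) \<in> w ` S" using psubset.hyps by (intro Max_in) auto
    then obtain a where "a \<in> S" "w a = Max (w ` S)" by auto
    then have a: "a \<in> S" "\<And>x. x \<in> S \<Longrightarrow> w x \<le> w a"
      using psubset.hyps by auto
    have "card (S - {a}) \<noteq> 0" using False a by simp
    then have "S - {a} \<noteq> {}" by (metis card.empty)
    then have "Min (w ` (S - {a})) \<in> w ` (S - {a})" using psubset.hyps by (intro Min_in) auto
    then obtain b where b: "b \<in> S - {a}" "Min (w ` (S - {a})) = w b" by (rule imageE)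
    have b_min: "w b \<le> w x" if "x \<in> S" for x
    proof (cases "x = a")
      case True
      then show ?thesis using a b(1) by simp
    next
      case False
      then have "Min (w ` (S - {a})) \<le> w x" using psubset.hyps that by (intro Min_le) auto
      then show ?thesis unfolding b(2) .
    qed
    have b: "b \<in> S" "b \<noteq> a" using b(1) by auto
    \<comment> \<open>A largest and a smallest element are peeled off with weights 1 and -1; a last
      single element gets 0. An upper set containing \<open>b\<close> is all of \<open>S\<close>,
      one missing \<open>a\<close> is empty, and any other gains \<open>a\<close> inside and
      \<open>b\<close> outside, so its sum and the minimum both grow by 1. Ties do no harm, since
      upper sets are unions of level classes of \<open>w\<close>.\<close>
    define S' where "S' = S - {a, b}"
    have "S' \<subset> S" using a by (auto simp: S'_def)
    from psubset.IH[OF this] obtain V' :: "'h \<Rightarrow> real" where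
      "(\<forall>h\<in>S'. \<bar>V' h\<bar> \<le> 1) \<and> sum V' S' = 0 \<and>
        (\<forall>U\<subseteq>S'. (\<forall>x\<in>U. \<forall>y\<in>S'. w x \<le> w y \<longrightarrow> y \<in> U) \<longrightarrow>
           sum V' U = real (min (card U) (card (S' - U))))" ..
    then have V': "\<forall>h\<in>S'. \<bar>V' h\<bar> \<le> 1" "sum V' S' = 0"
      "\<And>U. U \<subseteq> S' \<Longrightarrow> \<forall>x\<in>U. \<forall>y\<in>S'. w x \<le> w y \<longrightarrow> y \<in> U \<Longrightarrow>
         sum V' U = real (min (card U) (card (S' - U)))"
      by simp_all
    define V where "V = V'(a := 1, b := - 1)"
    have fin: "finite S'" using psubset.hyps by (simp add: S'_def)
    have S: "S = insert a (insert b S')" "a \<notin> S'" "b \<notin> S'" using a b by (auto simp: S'_def)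
    have VS': "sum V U = sum V' U" if "U \<subseteq> S'" for U
      by (rule sum.cong) (use that S in \<open>auto simp: V_def\<close>)
    have sumV: "sum V S = 0"
      using VS'[of S'] V'(2) S fin b(2) by (simp add: V_def)
    show ?thesis
    proof (intro exI[of _ V] conjI ballI allI impI sumV)
      show "\<bar>V h\<bar> \<le> 1" if "h \<in> S" for h
        using that V'(1) S by (auto simp: V_def)
    next
      fix U assume U: "U \<subseteq> S" "\<forall>x\<in>U. \<forall>y\<in>S. w x \<le> w y \<longrightarrow> y \<in> U"
      consider "b \<in> U" | "b \<notin> U" "a \<in> U" | "a \<notin> U" by blast
      then show "sum V U = real (min (card U) (card (S - U)))"
      proof cases
        case 1
        then have "U = S" using U b_min by blast
        then show ?thesis by (simp add: sumV)
      next
        case 2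
        define U' where "U' = U - {a}"
        have U': "U' \<subseteq> S'" "U = insert a U'" "a \<notin> U'" using 2 U S by (auto simp: U'_def)
        then have finU': "finite U'" using fin finite_subset by blast
        have "sum V' U' = real (min (card U') (card (S' - U')))"
          by (rule V'(3)) (use U U' S in auto)
        moreover have "sum V U = 1 + sum V' U'"
          using U' finU' VS'[OF U'(1)] b(2) by (simp add: V_def)
        moreover have "S - U = insert b (S' - U')" using U' S 2 by auto
        ultimately show ?thesis
          using U' finU' fin S by simp
      next
        case 3
        then have "U = {}" using U a by blast
        then show ?thesis by simp
      qed
    qed
  qed
qed

text \<open>With weights in [-1, 1] that cancel at a node, the weight of \<open>U\<close> there is
  minus that of its complement, hence bounded by either cardinality; the minimum is the sharp bound.
  It is the perimeter that the Kirchhoff condition produces: at a vertex with three edges, having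
  one or two of them in the set costs 1.\<close>

definition cut :: "('h \<Rightarrow> 'n) \<Rightarrow> 'h set \<Rightarrow> 'h set \<Rightarrow> real" where
  "cut node H U = (\<Sum>n\<in>node ` H. real (min (card {h \<in> H. node h = n \<and> h \<in> U})
     (card {h \<in> H. node h = n \<and> h \<notin> U})))"

lemma cut_compl: "cut node H (H - U) = cut node H U"
proof -
  have "{h \<in> H. node h = n \<and> h \<in> H - U} = {h \<in> H. node h = n \<and> h \<notin> U}"
    "{h \<in> H. node h = n \<and> h \<notin> H - U} = {h \<in> H. node h = n \<and> h \<in> U}" for n
    by auto
  then show ?thesis unfolding cut_def by (simp only: min.commute)
qed

lemma cut_nonneg: "0 \<le> cut node H U"
  unfolding cut_def by (intro sum_nonneg) auto

lemma cut_empty [simp]: "cut node H {} = 0"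
  unfolding cut_def by simp

text \<open>A node that sees both \<open>U\<close> and its complement contributes a positive
  integer. This gap later keeps minimizers from shrinking to length 0.\<close>

lemma cut_ge_1:
  assumes "finite H" "h \<in> H" "h' \<in> H" "node h = node h'" "h \<in> U" "h' \<notin> U"
  shows "1 \<le> cut node H U"
proof -
  let ?f = "\<lambda>n. real (min (card {h \<in> H. node h = n \<and> h \<in> U}) (card {h \<in> H. node h = n \<and> h \<notin> U}))"
  have "card {g \<in> H. node g = node h \<and> g \<in> U} \<noteq> 0" "card {g \<in> H. node g = node h \<and> g \<notin> U} \<noteq> 0"
    using assms by auto
  then have "1 \<le> ?f (node h)" by linarith
  also have "\<dots> \<le> cut node H U"
    unfolding cut_def by (rule member_le_sum) (use assms in auto)
  finally show ?thesis .
qed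

lemma sum_fibres:
  assumes "finite H" "U \<subseteq> H"
  shows "sum V U = (\<Sum>n\<in>node ` H. sum V {h \<in> H. node h = n \<and> h \<in> U})"
proof -
  have "sum V U = (\<Sum>n\<in>node ` H. sum V {h \<in> U. node h = n})"
    using assms by (intro sum.group[symmetric]) (auto intro: finite_subset)
  moreover have "{h \<in> U. node h = n} = {h \<in> H. node h = n \<and> h \<in> U}" for n
    using assms by auto
  ultimately show ?thesis by simp
qed

text \<open>The fibres of \<open>node\<close> are disjoint, so weights found at single nodes combine
  freely. The same \<open>w\<close> orders the ends at every node; hence one \<open>V\<close>
  attains the bound of \<open>sum_le_cut\<close> for all superlevel sets of \<open>w\<close>
  simultaneously.\<close>

lemma calibration:
  fixes w :: "'h \<Rightarrow> real" and node :: "'h \<Rightarrow> 'n"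
  assumes "finite H"
  obtains V :: "'h \<Rightarrow> real" where
    "\<And>h. h \<in> H \<Longrightarrow> \<bar>V h\<bar> \<le> 1"
    "\<And>n. sum V {h \<in> H. node h = n} = 0"
    "\<And>U. U \<subseteq> H \<Longrightarrow> (\<And>x y. x \<in> U \<Longrightarrow> y \<in> H \<Longrightarrow> w x \<le> w y \<Longrightarrow> y \<in> U) \<Longrightarrow> sum V U = cut node H U"
proof -
  let ?S = "\<lambda>n. {h \<in> H. node h = n}"
  have "\<forall>n. \<exists>V :: 'h \<Rightarrow> real. (\<forall>h\<in>?S n. \<bar>V h\<bar> \<le> 1) \<and> sum V (?S n) = 0 \<and>
    (\<forall>U\<subseteq>?S n. (\<forall>x\<in>U. \<forall>y\<in>?S n. w x \<le> w y \<longrightarrow> y \<in> U) \<longrightarrow>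
       sum V U = real (min (card U) (card (?S n - U))))"
    using assms by (intro allI calibration_at_node) simp
  then obtain W :: "'n \<Rightarrow> 'h \<Rightarrow> real" where "\<forall>n. (\<forall>h\<in>?S n. \<bar>W n h\<bar> \<le> 1) \<and> sum (W n) (?S n) = 0 \<and>
    (\<forall>U\<subseteq>?S n. (\<forall>x\<in>U. \<forall>y\<in>?S n. w x \<le> w y \<longrightarrow> y \<in> U) \<longrightarrow>
       sum (W n) U = real (min (card U) (card (?S n - U))))"
    unfolding choice_iff ..
  then have W:
    "\<And>n h. h \<in> ?S n \<Longrightarrow> \<bar>W n h\<bar> \<le> 1" "\<And>n. sum (W n) (?S n) = 0"
    "\<And>n U. U \<subseteq> ?S n \<Longrightarrow> (\<forall>x\<in>U. \<forall>y\<in>?S n. w x \<le> w y \<longrightarrow> y \<in> U) \<Longrightarrow>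
       sum (W n) U = real (min (card U) (card (?S n - U)))"
    by blast+
  define V where "V h = W (node h) h" for h
  have VW: "sum V U = sum (W n) U" if "U \<subseteq> ?S n" for U n
    by (rule sum.cong) (use that in \<open>auto simp: V_def\<close>)
  show ?thesis
  proof
    show "\<bar>V h\<bar> \<le> 1" if "h \<in> H" for h using W(1)[of h "node h"] that by (simp add: V_def)
    show "sum V (?S n) = 0" for n using VW[of "?S n" n] W(2) by simp
    fix U assume U: "U \<subseteq> H" "\<And>x y. x \<in> U \<Longrightarrow> y \<in> H \<Longrightarrow> w x \<le> w y \<Longrightarrow> y \<in> U"
    have "sum V {h \<in> H. node h = n \<and> h \<in> U} =
        real (min (card {h \<in> H. node h = n \<and> h \<in> U}) (card {h \<in> H. node h = n \<and> h \<notin> U}))" for n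
    proof -
      let ?U = "{h \<in> H. node h = n \<and> h \<in> U}"
      have "sum V ?U = sum (W n) ?U" by (rule VW) auto
      also have "\<dots> = real (min (card ?U) (card (?S n - ?U)))"
        by (rule W(3)) (use U in blast)+
      also have "?S n - ?U = {h \<in> H. node h = n \<and> h \<notin> U}" by auto
      finally show ?thesis .
    qed
    then show "sum V U = cut node H U"
      using sum_fibres[OF assms U(1), of V node] by (simp add: cut_def)
  qed
qed

text \<open>Weak duality between fluxes and cuts; \<open>calibration\<close> is the strong
  half.\<close>

lemma sum_le_cut:
  fixes V :: "'h \<Rightarrow> real"
  assumes "finite H" "U \<subseteq> H" and V: "\<And>h. h \<in> H \<Longrightarrow> \<bar>V h\<bar> \<le> 1"
    and K: "\<And>n. n \<in> node ` H \<Longrightarrow> sum V {h \<in> H. node h = n} = 0"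
  shows "\<bar>sum V U\<bar> \<le> cut node H U"
proof -
  have "\<bar>sum V {h \<in> H. node h = n \<and> h \<in> U}\<bar> \<le>
      real (min (card {h \<in> H. node h = n \<and> h \<in> U}) (card {h \<in> H. node h = n \<and> h \<notin> U}))"
    if n: "n \<in> node ` H" for n
  proof -
    let ?A = "{h \<in> H. node h = n \<and> h \<in> U}" and ?B = "{h \<in> H. node h = n \<and> h \<notin> U}"
    have "{h \<in> H. node h = n} = ?A \<union> ?B" by auto
    then have "sum V ?A + sum V ?B = 0"
      using K[OF n] assms(1) by (subst sum.union_disjoint[symmetric]) auto
    moreover have "\<bar>sum V X\<bar> \<le> real (card X)" if "X \<subseteq> H" for X
    proof -
      have "\<bar>sum V X\<bar> \<le> (\<Sum>h\<in>X. \<bar>V h\<bar>)" by (rule sum_abs)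
      also have "\<dots> \<le> (\<Sum>h\<in>X. 1)" by (rule sum_mono) (use V that in blast)
      finally show ?thesis by simp
    qed
    from this[of ?A] this[of ?B] have "\<bar>sum V ?A\<bar> \<le> card ?A" "\<bar>sum V ?B\<bar> \<le> card ?B" by auto
    ultimately show ?thesis by linarith
  qed
  then have "(\<Sum>n\<in>node ` H. \<bar>sum V {h \<in> H. node h = n \<and> h \<in> U}\<bar>) \<le> cut node H U"
    unfolding cut_def by (rule sum_mono)
  then show ?thesis
    unfolding sum_fibres[OF assms(1,2), of V node] by (rule order.trans[OF sum_abs])
qed

text \<open>The claimed sum is the integral over t of the sums in the hypothesis. As
  \<open>w\<close> takes finitely many values, it is peeled slab by slab: lowering \<open>w\<close>
  by its smallest positive value \<open>m\<close> removes \<open>m\<close> times the sum over the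
  positive set and leaves fewer positive values.\<close>

lemma layer_cake_nonneg:
  fixes w \<gamma> :: "'c \<Rightarrow> real"
  assumes "finite C" and "\<And>t. 0 \<le> t \<Longrightarrow> 0 \<le> sum \<gamma> {c \<in> C. t < w c}"
  shows "0 \<le> (\<Sum>c\<in>C. max 0 (w c) * \<gamma> c)"
  using assms
proof (induction "card {c \<in> C. 0 < w c}" arbitrary: w rule: less_induct)
  case less
  let ?P = "{c \<in> C. 0 < w c}"
  show ?case
  proof (cases "?P = {}")
    case True
    then show ?thesis by (intro sum_nonneg) (auto simp: max_def)
  next
    case False
    define m where "m = Min (w ` ?P)"
    have m: "m \<in> w ` ?P" "\<And>c. c \<in> ?P \<Longrightarrow> m \<le> w c"
      using False less.prems(1) by (auto simp: m_def intro: Min_in)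
    then have "m > 0" by auto
    have "0 \<le> (\<Sum>c\<in>C. max 0 (w c - m) * \<gamma> c)"
    proof (rule less.hyps)
      show "card {c \<in> C. 0 < w c - m} < card ?P"
        by (rule psubset_card_mono) (use m \<open>m > 0\<close> less.prems(1) in auto)
      show "0 \<le> sum \<gamma> {c \<in> C. t < w c - m}" if "0 \<le> t" for t
        using less.prems(2)[of "t + m"] that \<open>m > 0\<close> by (simp add: less_diff_eq)
    qed (use less.prems in auto)
    also have "(\<Sum>c\<in>C. max 0 (w c - m) * \<gamma> c) + m * sum \<gamma> ?P = (\<Sum>c\<in>C. max 0 (w c) * \<gamma> c)"
    proof -
      have "m * sum \<gamma> ?P = (\<Sum>c\<in>C. if 0 < w c then m * \<gamma> c else 0)"
        using less.prems(1) by (simp add: sum.If_cases sum_distrib_left Int_def)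
      moreover have "max 0 (w c - m) * \<gamma> c + (if 0 < w c then m * \<gamma> c else 0) = max 0 (w c) * \<gamma> c"
        if "c \<in> C" for c
        using m(2)[of c] that \<open>m > 0\<close> by (auto simp: max_def algebra_simps)
      ultimately show ?thesis by (simp add: sum.distrib[symmetric])
    qed
    moreover have "0 \<le> m * sum \<gamma> ?P" using less.prems(2)[of 0] \<open>m > 0\<close> by simp
    ultimately show ?thesis by linarith
  qed
qed

lemma weighted_median_exists:
  fixes a w :: "'c \<Rightarrow> real"
  assumes "finite C" "C \<noteq> {}" "\<And>c. c \<in> C \<Longrightarrow> 0 \<le> a c"
  obtains m where "sum a {c \<in> C. m < w c} \<le> sum a C / 2" "sum a {c \<in> C. w c < m} \<le> sum a C / 2"
proof -
  have "0 \<le> sum a C" using assms(3) by (rule sum_nonneg)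
  define M where "M = {m \<in> w ` C. sum a {c \<in> C. m < w c} \<le> sum a C / 2}"
  have "Max (w ` C) \<in> M"
  proof -
    have "{c \<in> C. Max (w ` C) < w c} = {}"
      using assms by (auto simp: not_less)
    then have "sum a {c \<in> C. Max (w ` C) < w c} = 0" by (simp only: sum.empty)
    then show ?thesis
      using assms \<open>0 \<le> sum a C\<close> by (simp add: M_def)
  qed
  moreover have "finite M" using assms by (simp add: M_def)
  ultimately have m: "Min M \<in> M" "\<And>x. x \<in> M \<Longrightarrow> Min M \<le> x" by (auto intro: Min_in)
  show ?thesis
  proof
    show "sum a {c \<in> C. Min M < w c} \<le> sum a C / 2" using m(1) by (simp add: M_def)
    let ?Q = "{c \<in> C. w c < Min M}"
    show "sum a ?Q \<le> sum a C / 2"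
    proof (cases "?Q = {}")
      case True
      then show ?thesis using \<open>0 \<le> sum a C\<close> by (simp only: sum.empty)
    next
      case False
      \<comment> \<open>\<open>q\<close> is the next value below the candidate. Being too small for
        \<open>M\<close>, it has more than half of the weight strictly above it, and what lies above
        \<open>q\<close> is exactly the complement of \<open>?Q\<close>.\<close>
      define q where "q = Max (w ` ?Q)"
      have q: "q \<in> w ` ?Q" "\<And>c. c \<in> ?Q \<Longrightarrow> w c \<le> q"
        using False assms(1) by (auto simp: q_def intro: Max_in)
      then have "q \<notin> M" "q \<in> w ` C" using m(2) by fastforce+
      then have "sum a C / 2 < sum a {c \<in> C. q < w c}" by (simp add: M_def)
      moreover have "sum a {c \<in> C. q < w c} = sum a (C - ?Q)"
      proof -
        have "q < w c \<longleftrightarrow> \<not> w c < Min M" if "c \<in> C" for c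
          using q(1) q(2)[of c] that by auto
        then show ?thesis by (intro arg_cong[where f = "sum a"]) blast
      qed
      moreover have "sum a ?Q + sum a (C - ?Q) = sum a C"
        using assms(1) by (subst sum.subset_diff[of ?Q C a]) auto
      ultimately show ?thesis by linarith
    qed
  qed
qed

section \<open>Primitives on an interval\<close>

lemma leb_integral: "(\<integral>x. f x \<partial>leb l) = (\<integral>x. indicator {0<..<l} x * f x \<partial>lebesgue)" for f :: "real \<Rightarrow> real"
  by (simp add: integral_restrict_space)

lemma leb_integrable: "integrable (leb l) f \<longleftrightarrow> integrable lebesgue (\<lambda>x. indicator {0<..<l} x * f x)" for f :: "real \<Rightarrow> real"
  by (simp add: integrable_restrict_space)

lemma AE_leb: "(AE x in leb l. P x) \<longleftrightarrow> (AE x in lebesgue. x \<in> {0<..<l} \<longrightarrow> P x)"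
  by (simp add: AE_restrict_space_iff)

lemma space_leb [simp]: "space (leb l) = {0<..<l}"
  by simp

lemma measure_leb: "A \<subseteq> {0<..<l} \<Longrightarrow> measure (leb l) A = measure lebesgue A"
  by (simp add: measure_restrict_space)

lemma borel_measurable_leb [measurable (raw)]: "f \<in> borel_measurable borel \<Longrightarrow> f \<in> borel_measurable (leb l)" for f :: "real \<Rightarrow> real"
  by (intro measurable_restrict_space1 measurable_completion) simp

lemma indicator_leb_measurable: "A \<in> sets lebesgue \<Longrightarrow> indicator A \<in> borel_measurable (leb l)" for A :: "real set"
  by (intro measurable_restrict_space1) simp

lemma finite_measure_leb: "finite_measure (leb l)"
  by (rule finite_measureI) (simp add: emeasure_restrict_space emeasure_lborel_box_eq flip: box_real(1))

lemma integrable_leb_bounded: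
  fixes f :: "real \<Rightarrow> real"
  assumes "f \<in> borel_measurable (leb l)" "\<And>x. x \<in> {0<..<l} \<Longrightarrow> \<bar>f x\<bar> \<le> B"
  shows "integrable (leb l) f"
  using assms
  by (intro finite_measure.integrable_const_bound[OF finite_measure_leb, where B=B]) auto

lemma integrable_leb_mult_bounded:
  fixes f g :: "real \<Rightarrow> real"
  assumes f: "integrable (leb l) f" and g: "g \<in> borel_measurable (leb l)"
    and B: "\<And>x. x \<in> {0<..<l} \<Longrightarrow> \<bar>g x\<bar> \<le> B"
  shows "integrable (leb l) (\<lambda>x. g x * f x)"
proof (rule Bochner_Integration.integrable_bound)
  show "integrable (leb l) (\<lambda>x. B * f x)" using f by simp
  show "(\<lambda>x. g x * f x) \<in> borel_measurable (leb l)" using f g by measurable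
  show "AE x in leb l. norm (g x * f x) \<le> norm (B * f x)"
    using B by (intro AE_I2) (fastforce simp: abs_mult intro: mult_right_mono)
qed

lemma integrable_leb_indicator:
  fixes f :: "real \<Rightarrow> real"
  assumes "integrable (leb l) f" "A \<in> sets lebesgue"
  shows "integrable (leb l) (\<lambda>x. indicator A x * f x)"
  using assms by (intro integrable_leb_mult_bounded[where B=1] indicator_leb_measurable) (auto split: split_indicator)

text \<open>The primitive is extended to the whole line by constants, so that continuity and Borel
  measurability hold without restriction to an interval. The open half-line makes its increments
  integrals over half-open intervals, the shape of the grid cells.\<close>

definition primitive :: "real \<Rightarrow> (real \<Rightarrow> real) \<Rightarrow> real \<Rightarrow> real" where
  "primitive l g x = (\<integral>y. indicator {..<x} y * g y \<partial>leb l)"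

lemma primitive_0 [simp]: "primitive l g 0 = 0"
proof -
  have "primitive l g 0 = (\<integral>y. 0 \<partial>leb l)"
    unfolding primitive_def by (rule Bochner_Integration.integral_cong) auto
  then show ?thesis by simp
qed

lemma primitive_diff:
  assumes "integrable (leb l) g" "x \<le> y"
  shows "primitive l g y - primitive l g x = (\<integral>s. indicator {x..<y} s * g s \<partial>leb l)"
proof -
  have "primitive l g y - primitive l g x =
      (\<integral>s. indicator {..<y} s * g s - indicator {..<x} s * g s \<partial>leb l)"
    unfolding primitive_def
    by (rule Bochner_Integration.integral_diff[symmetric]) (use assms in \<open>auto intro: integrable_leb_indicator\<close>)
  also have "\<dots> = (\<integral>s. indicator {x..<y} s * g s \<partial>leb l)"
    by (rule Bochner_Integration.integral_cong) (use assms in \<open>auto split: split_indicator\<close>)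
  finally show ?thesis .
qed

lemma primitive_add:
  assumes "integrable (leb l) f" "integrable (leb l) g"
  shows "primitive l (\<lambda>x. f x + g x) x = primitive l f x + primitive l g x"
  unfolding primitive_def distrib_left
  by (rule Bochner_Integration.integral_add) (use assms in \<open>auto intro: integrable_leb_indicator\<close>)

lemma primitive_minus: "primitive l (\<lambda>x. - g x) x = - primitive l g x"
  by (simp add: primitive_def)

lemma primitive_mult: "primitive l (\<lambda>x. c * g x) x = c * primitive l g x"
  unfolding primitive_def by (simp add: mult.left_commute[of _ c])

lemma AE_leb_neq: "AE y in leb l. y \<noteq> x"
  unfolding AE_leb by (rule AE_mp[OF AE_completion[OF AE_lborel_singleton[of x]]]) auto

lemma primitive_closed: 
  assumes "integrable (leb l) g"
  shows "primitive l g x = (\<integral>y. indicator {..x} y * g y \<partial>leb l)"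
  unfolding primitive_def
  by (rule integral_cong_AE)
    (use assms AE_leb_neq[of x l] in \<open>auto intro!: borel_measurable_integrable integrable_leb_indicator elim!: AE_mp split: split_indicator\<close>)

lemma integral_leb_Icc:
  assumes "integrable (leb l) g" "x \<le> y"
  shows "(\<integral>s. indicator {x..y} s * g s \<partial>leb l) = primitive l g y - primitive l g x"
  unfolding primitive_diff[OF assms]
  by (rule integral_cong_AE)
    (use assms AE_leb_neq[of y l] in \<open>auto intro!: borel_measurable_integrable integrable_leb_indicator elim!: AE_mp split: split_indicator\<close>)

lemma measure_leb_interval:
  assumes "0 \<le> x" "x \<le> y" "y \<le> l"
  shows "(\<integral>s. indicator {x..<y} s \<partial>leb l) = y - x"
proof -
  have "(\<integral>s. indicator {x..<y} s \<partial>leb l) = measure lebesgue ({x..<y} \<inter> {0<..<l})"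
    by (simp add: measure_leb)
  also have "\<dots> = measure lebesgue {x..<y}"
  proof (rule measure_eq_AE)
    show "AE s in lebesgue. (s \<in> {x..<y} \<inter> {0<..<l}) = (s \<in> {x..<y})"
      by (rule AE_mp[OF AE_completion[OF AE_lborel_singleton[of 0]]]) (use assms in auto)
  qed auto
  also have "\<dots> = y - x" using assms by simp
  finally show ?thesis .
qed

lemma primitive_Lipschitz:
  assumes g: "g \<in> borel_measurable (leb l)" "\<And>x. x \<in> {0<..<l} \<Longrightarrow> \<bar>g x\<bar> \<le> B"
    and xy: "0 \<le> x" "x \<le> y" "y \<le> l"
  shows "\<bar>primitive l g y - primitive l g x\<bar> \<le> B * (y - x)"
proof -
  have int: "integrable (leb l) g" using g by (rule integrable_leb_bounded)
  have "\<bar>primitive l g y - primitive l g x\<bar> \<le> (\<integral>s. \<bar>indicator {x..<y} s * g s\<bar> \<partial>leb l)"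
    unfolding primitive_diff[OF int xy(2)] by (rule integral_abs_bound)
  also have "\<dots> \<le> (\<integral>s. B * indicator {x..<y} s \<partial>leb l)"
  proof (rule integral_mono)
    show "integrable (leb l) (\<lambda>s. \<bar>indicator {x..<y} s * g s\<bar>)"
      using int by (intro integrable_abs integrable_leb_indicator) auto
    show "integrable (leb l) (\<lambda>s. B * indicator {x..<y} s)"
      by (intro integrable_mult_right integrable_leb_bounded[where B=1] indicator_leb_measurable)
        (auto split: split_indicator)
  qed (use g(2) in \<open>auto split: split_indicator\<close>)
  also have "\<dots> = B * (y - x)" using measure_leb_interval[OF xy] by simp
  finally show ?thesis .
qed

lemma continuous_on_primitive:
  assumes "integrable (leb l) g"
  shows "continuous_on S (primitive l g)"
proof (rule continuous_on_sequentiallyI)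
  fix u :: "nat \<Rightarrow> real" and a assume u: "u \<longlonglongrightarrow> a"
  show "(\<lambda>n. primitive l g (u n)) \<longlonglongrightarrow> primitive l g a"
    unfolding primitive_def
  proof (rule integral_dominated_convergence[where w="\<lambda>y. \<bar>g y\<bar>"])
    show "AE y in leb l. (\<lambda>i. indicator {..<u i} y * g y) \<longlonglongrightarrow> indicator {..<a} y * g y"
    proof (rule AE_mp[OF AE_leb_neq[of a]], intro AE_I2 impI)
      fix y assume "y \<noteq> a"
      then have "\<forall>\<^sub>F i in sequentially. indicator {..<u i} y = (indicator {..<a} y :: real)"
        using order_tendstoD[OF u, of y] by (cases "y < a") (auto elim: eventually_mono split: split_indicator)
      then have "\<forall>\<^sub>F i in sequentially. indicator {..<u i} y * g y = indicator {..<a} y * g y"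
        by (rule eventually_mono) simp
      then show "(\<lambda>i. indicator {..<u i} y * g y) \<longlonglongrightarrow> indicator {..<a} y * g y"
        by (rule tendsto_eventually)
    qed
    show "AE x in leb l. norm (indicator {..<u i} x * g x) \<le> \<bar>g x\<bar>" for i
      by (auto split: split_indicator)
  qed (use assms in \<open>auto intro!: borel_measurable_integrable[OF integrable_leb_indicator]\<close>)
qed

text \<open>Integrals over all intervals vanish, so the averages over [x, x + h], which tend to the
  value at almost every x by Lebesgue differentiation, are all 0.\<close>

lemma AE_zero_if_primitive_zero:
  assumes f: "integrable (leb l) f" and 0: "\<And>x. x \<in> {0..l} \<Longrightarrow> primitive l f x = 0"
  shows "AE x in leb l. f x = 0"
proof (cases "0 \<le> l")
  case True
  define f1 where "f1 x = indicator {0<..<l} x * f x" for x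
  have f1: "integrable lebesgue f1" using f by (simp add: leb_integrable f1_def[abs_def])
  have zero: "primitive l f x = 0" for x
  proof -
    have "primitive l f x = primitive l f (max 0 (min l x))"
      unfolding primitive_def
      by (rule Bochner_Integration.integral_cong) (auto split: split_indicator)
    then show ?thesis using 0[of "max 0 (min l x)"] True by auto
  qed
  have f1_on: "integrable (lebesgue_on {a..b}) f1" for a b
    using f1 by (simp add: integrable_restrict_space integrable_mult_indicator[where 'b=real, simplified])
  have int0: "integral {a..b} f1 = 0" for a b
  proof (cases "a \<le> b")
    case True
    have "integral {a..b} f1 = (\<integral>x. f1 x \<partial>lebesgue_on {a..b})"
      by (rule lebesgue_integral_eq_integral[symmetric]) (use f1_on in auto)
    also have "\<dots> = (\<integral>x. indicator {a..b} x * f x \<partial>leb l)"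
      by (simp add: integral_restrict_space f1_def leb_integral mult.left_commute)
    also have "\<dots> = 0" using integral_leb_Icc[OF f True] zero by simp
    finally show ?thesis .
  qed simp
  have "f1 integrable_on cbox a b" for a b
    using integrable_on_lebesgue_on[OF f1_on[of a b]] by simp
  from integrable_ccontinuous_explicit[OF this] obtain N where N: "negligible N"
    "\<And>x e. \<lbrakk>x \<notin> N; 0 < e\<rbrakk> \<Longrightarrow> \<exists>d>0. \<forall>h. 0 < h \<and> h < d \<longrightarrow>
       norm (integral (cbox x (x + h *\<^sub>R One)) f1 /\<^sub>R h ^ DIM(real) - f1 x) < e"
    by blast
  have "f1 x = 0" if xN: "x \<notin> N" for x
  proof (rule ccontr)
    assume "f1 x \<noteq> 0"
    then obtain d where d: "d > 0" "\<And>h. 0 < h \<and> h < d \<Longrightarrow>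
       norm (integral (cbox x (x + h *\<^sub>R One)) f1 /\<^sub>R h ^ DIM(real) - f1 x) < \<bar>f1 x\<bar>"
      using N(2)[OF xN, of "\<bar>f1 x\<bar>"] by auto
    from d(1) d(2)[of "d / 2"] show False by (simp add: int0)
  qed
  then have "x \<notin> N \<Longrightarrow> x \<in> {0<..<l} \<Longrightarrow> f x = 0" for x
    unfolding f1_def by (metis indicator_simps(1) mult_1)
  moreover have "AE x in lebesgue. x \<notin> N"
    using N(1) by (simp add: negligible_iff_null_sets AE_not_in)
  ultimately show ?thesis
    unfolding AE_leb by (auto elim: eventually_mono)
qed (simp add: AE_leb)

section \<open>Test functions and integration by parts\<close>

lemma test_function_deriv:
  assumes "\<phi> \<in> test_functions l"
  shows "(\<phi> has_real_derivative deriv \<phi> x) (at x)" "continuous_on S (deriv \<phi>)"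
proof -
  from assms obtain D where D: "\<And>x. (\<phi> has_vector_derivative D x) (at x)" "continuous_on UNIV D"
    by (auto simp: test_functions_def C1_differentiable_on_def)
  then have d: "(\<phi> has_real_derivative D x) (at x)" for x
    by (simp add: has_real_derivative_iff_has_vector_derivative)
  then have "deriv \<phi> = D" by (auto intro!: DERIV_imp_deriv)
  then show "(\<phi> has_real_derivative deriv \<phi> x) (at x)" "continuous_on S (deriv \<phi>)"
    using d D(2) by (auto intro: continuous_on_subset)
qed

lemma test_function_support:
  assumes "\<phi> \<in> test_functions l" "x \<notin> {0<..<l}"
  shows "\<phi> x = 0" "deriv \<phi> x = 0"
proof -
  let ?S = "- closure {x. \<phi> x \<noteq> 0}"
  have S: "open ?S" "x \<in> ?S" "\<And>y. y \<in> ?S \<Longrightarrow> \<phi> y = 0"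
    using assms closure_subset[of "{x. \<phi> x \<noteq> 0}"] by (auto simp: test_functions_def)
  then show "\<phi> x = 0" by blast
  have "(\<phi> has_field_derivative 0) (at x)"
    by (rule has_field_derivative_transform_within_open[OF DERIV_const S(1,2)]) (rule S(3)[symmetric])
  then show "deriv \<phi> x = 0" by (rule DERIV_imp_deriv)
qed

lemma test_function_continuous: "\<phi> \<in> test_functions l \<Longrightarrow> continuous_on S \<phi>"
  using test_function_deriv(1) by (meson DERIV_isCont continuous_at_imp_continuous_on)

lemma vanishing_outside_bounded:
  fixes f :: "real \<Rightarrow> real"
  assumes "continuous_on UNIV f" "\<And>x. x \<notin> {0<..<l} \<Longrightarrow> f x = 0"
  obtains B where "0 \<le> B" "\<And>x. \<bar>f x\<bar> \<le> B"
proof -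
  have "compact (f ` {0..l})"
    using assms(1) by (intro compact_continuous_image) (auto intro: continuous_on_subset)
  then obtain B where B: "\<And>y. y \<in> f ` {0..l} \<Longrightarrow> norm y \<le> B"
    by (meson bounded_iff compact_imp_bounded)
  have "\<bar>f x\<bar> \<le> max 0 B" for x
    using B[of "f x"] assms(2)[of x] by (cases "x \<in> {0<..<l}") auto
  then show ?thesis using that[of "max 0 B"] by auto
qed

lemma integrable_lborel_vanishing_outside:
  fixes f :: "real \<Rightarrow> real"
  assumes "continuous_on UNIV f" "\<And>x. x \<notin> {0<..<l} \<Longrightarrow> f x = 0"
  shows "integrable lborel f"
proof -
  have "integrable lborel (\<lambda>x. indicator {0..l} x *\<^sub>R f x)"
    using assms(1) by (intro borel_integrable_compact) (auto intro: continuous_on_subset)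
  moreover have "(\<lambda>x. indicator {0..l} x *\<^sub>R f x) = f"
    using assms(2) by (fastforce split: split_indicator)
  ultimately show ?thesis by simp
qed

lemma test_function_integral_Ici:
  assumes "\<phi> \<in> test_functions l"
  shows "(\<integral>x. indicator {y..} x * deriv \<phi> x \<partial>lborel) = - \<phi> y"
proof -
  have "(\<integral>x. indicator {y..} x * deriv \<phi> x \<partial>lborel) =
      (\<integral>x. deriv \<phi> x * indicator {y..max l y} x \<partial>lborel)"
    by (rule Bochner_Integration.integral_cong)
      (use test_function_support(2)[OF assms] in \<open>auto simp: max_def split: split_indicator\<close>)
  also have "\<dots> = \<phi> (max l y) - \<phi> y"
    using test_function_deriv(1)[OF assms] test_function_deriv(2)[OF assms, of UNIV]
    by (intro integral_FTC_Icc_real) (simp_all add: continuous_on_eq_continuous_at)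
  also have "\<phi> (max l y) = 0" by (rule test_function_support[OF assms]) auto
  finally show ?thesis by simp
qed

text \<open>Fubini for the kernel \<phi>'(x) g(y) on y \<le> x: integrating in y first gives the
  primitive, in x first gives -\<phi>(y). Since \<open>g\<close> is only Lebesgue measurable, the
  product argument runs with a Borel version \<open>g0\<close> of its extension by 0.\<close>

lemma primitive_integration_by_parts:
  assumes g: "integrable (leb l) g" and \<phi>: "\<phi> \<in> test_functions l"
  shows "(\<integral>x. primitive l g x * deriv \<phi> x \<partial>leb l) = - (\<integral>x. g x * \<phi> x \<partial>leb l)"
proof -
  let ?I = "indicator {0<..<l} :: real \<Rightarrow> real"
  have "(\<lambda>x. ?I x * g x) \<in> borel_measurable (completion lborel)"
    using g unfolding leb_integrable by (rule borel_measurable_integrable)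
  from completion_ex_borel_measurable_real[OF this] obtain g0 where
    g0 [measurable]: "g0 \<in> borel_measurable borel" and "AE x in lborel. ?I x * g x = g0 x"
    by auto
  then have AE: "AE x in lebesgue. ?I x * g x = g0 x" by (intro AE_completion)
  have "integrable lebesgue g0"
    using g unfolding leb_integrable
    by (rule Bochner_Integration.integrable_cong_AE_imp) (use AE in \<open>auto simp: measurable_completion\<close>)
  then have g0_int: "integrable lborel g0" by (simp add: integrable_completion)
  have \<phi>'_0: "deriv \<phi> x = 0" if "x \<notin> {0<..<l}" for x
    using test_function_support[OF \<phi> that] by auto
  have \<phi>'_cont: "continuous_on UNIV (deriv \<phi>)" using test_function_deriv[OF \<phi>] by auto
  have [measurable]: "deriv \<phi> \<in> borel_measurable borel" "\<phi> \<in> borel_measurable borel"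
    using \<phi>'_cont test_function_continuous[OF \<phi>] by (auto intro: borel_measurable_continuous_onI)
  have \<phi>'_int: "integrable lborel (deriv \<phi>)"
    by (rule integrable_lborel_vanishing_outside[OF \<phi>'_cont \<phi>'_0])
  have [measurable]: "primitive l g \<in> borel_measurable borel"
    by (intro borel_measurable_continuous_onI continuous_on_primitive g)
  have prim: "primitive l g x = (\<integral>y. indicator {..x} y * g0 y \<partial>lborel)" for x
  proof -
    have "primitive l g x = (\<integral>y. indicator {..x} y * g0 y \<partial>lebesgue)"
      unfolding primitive_closed[OF g] leb_integral
    proof (rule integral_cong_AE)
      show "AE y in lebesgue. ?I y * (indicator {..x} y * g y) = indicator {..x} y * g0 y"
        using AE by (rule AE_mp) (auto split: split_indicator)
      show "(\<lambda>y. ?I y * (indicator {..x} y * g y)) \<in> borel_measurable lebesgue"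
        using integrable_leb_indicator[OF g, of "{..x}"] unfolding leb_integrable
        by (intro borel_measurable_integrable) auto
    qed (simp add: measurable_completion)
    also have "\<dots> = (\<integral>y. indicator {..x} y * g0 y \<partial>lborel)"
      by (rule integral_completion) measurable
    finally show ?thesis .
  qed
  define K where "K x y = deriv \<phi> x * (if y \<le> x then g0 y else 0)" for x y
  have K_meas [measurable]: "(\<lambda>(x, y). K x y) \<in> borel_measurable (lborel \<Otimes>\<^sub>M lborel)"
    unfolding K_def by measurable
  have "integrable (lborel \<Otimes>\<^sub>M lborel) (\<lambda>z. deriv \<phi> (fst z) * g0 (snd z))"
  proof (rule lborel_pair.Fubini_integrable)
    show "AE x in lborel. integrable lborel (\<lambda>y. deriv \<phi> (fst (x, y)) * g0 (snd (x, y)))"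
      using g0_int by simp
    show "integrable lborel (\<lambda>x. \<integral>y. norm (deriv \<phi> (fst (x, y)) * g0 (snd (x, y))) \<partial>lborel)"
      using \<phi>'_int by (simp add: abs_mult)
  qed measurable
  then have K_int: "integrable (lborel \<Otimes>\<^sub>M lborel) (\<lambda>(x, y). K x y)"
    by (rule Bochner_Integration.integrable_bound) (auto simp: K_def abs_mult)
  have "(\<integral>x. primitive l g x * deriv \<phi> x \<partial>leb l) = (\<integral>x. primitive l g x * deriv \<phi> x \<partial>lebesgue)"
    unfolding leb_integral
    by (rule Bochner_Integration.integral_cong) (use \<phi>'_0 in \<open>auto split: split_indicator\<close>)
  also have "\<dots> = (\<integral>x. primitive l g x * deriv \<phi> x \<partial>lborel)"
    by (rule integral_completion) measurable
  also have "\<dots> = (\<integral>x. (\<integral>y. K x y \<partial>lborel) \<partial>lborel)"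
  proof (rule Bochner_Integration.integral_cong[OF refl])
    fix x
    have "K x y = (indicator {..x} y * g0 y) * deriv \<phi> x" for y by (auto simp: K_def)
    then show "primitive l g x * deriv \<phi> x = (\<integral>y. K x y \<partial>lborel)" by (simp add: prim)
  qed
  also have "\<dots> = (\<integral>y. (\<integral>x. K x y \<partial>lborel) \<partial>lborel)"
    by (rule lborel_pair.Fubini_integral[OF K_int, symmetric])
  also have "\<dots> = (\<integral>y. - (g0 y * \<phi> y) \<partial>lborel)"
  proof (rule Bochner_Integration.integral_cong[OF refl])
    fix y
    have "K x y = g0 y * (indicator {y..} x * deriv \<phi> x)" for x by (auto simp: K_def)
    then show "(\<integral>x. K x y \<partial>lborel) = - (g0 y * \<phi> y)"
      using test_function_integral_Ici[OF \<phi>, of y] by simp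
  qed
  also have "\<dots> = (\<integral>y. - (g0 y * \<phi> y) \<partial>lebesgue)"
    by (rule integral_completion[symmetric]) measurable
  also have "\<dots> = (\<integral>y. ?I y * (- (g y * \<phi> y)) \<partial>lebesgue)"
  proof (rule integral_cong_AE)
    show "(\<lambda>y. - (g0 y * \<phi> y)) \<in> borel_measurable lebesgue" by (intro measurable_completion) measurable
    show "(\<lambda>y. ?I y * (- (g y * \<phi> y))) \<in> borel_measurable lebesgue"
    proof -
      have "(\<lambda>y. ?I y * g y) \<in> borel_measurable lebesgue"
        using g unfolding leb_integrable by (rule borel_measurable_integrable)
      then have "(\<lambda>y. (?I y * g y) * (- \<phi> y)) \<in> borel_measurable lebesgue"
        by (rule borel_measurable_times) (simp add: measurable_completion)
      then show ?thesis by (simp add: mult.assoc)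
    qed
    show "AE y in lebesgue. - (g0 y * \<phi> y) = ?I y * (- (g y * \<phi> y))"
      using AE by (rule AE_mp) (use test_function_support(1)[OF \<phi>] in \<open>auto split: split_indicator\<close>)
  qed
  also have "\<dots> = - (\<integral>x. g x * \<phi> x \<partial>leb l)"
    by (simp add: leb_integral)
  finally show ?thesis .
qed

section \<open>Weak derivatives on an interval\<close>

lemma Lp_interval_1_iff: "f \<in> Lp_interval 1 l \<longleftrightarrow> integrable (leb l) f"
proof -
  have "(\<lambda>x. \<bar>f x\<bar> powr 1) = (\<lambda>x. \<bar>f x\<bar>)" by simp
  then show ?thesis
    unfolding Lp_interval_def by (auto simp: integrable_abs_iff intro: borel_measurable_integrable)
qed

lemma Lp_interval_bounded:
  assumes "f \<in> borel_measurable (leb l)" "\<And>x. x \<in> {0<..<l} \<Longrightarrow> \<bar>f x\<bar> \<le> B" "0 \<le> p"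
  shows "f \<in> Lp_interval p l"
proof -
  have "integrable (leb l) (\<lambda>x. \<bar>f x\<bar> powr p)"
  proof (rule integrable_leb_bounded)
    show "(\<lambda>x. \<bar>f x\<bar> powr p) \<in> borel_measurable (leb l)" using assms(1) by measurable
    show "\<bar>\<bar>f x\<bar> powr p\<bar> \<le> B powr p" if "x \<in> {0<..<l}" for x
      using assms(2)[OF that] assms(3) by (simp add: powr_mono2)
  qed
  then show ?thesis using assms(1) by (simp add: Lp_interval_def)
qed

text \<open>Inside the interval the bound can fail only on an open null set, which is empty; the end
  points follow by closure. This turns essential bounds on test fields into pointwise ones.\<close>

lemma AE_le_imp_le_Icc:
  fixes h :: "real \<Rightarrow> real"
  assumes "0 < l" and h: "continuous_on {0..l} h" and AE: "AE x in leb l. h x \<le> c" and x: "x \<in> {0..l}"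
  shows "h x \<le> c"
proof -
  have cl: "closure {0<..<l} = {0..l}" using \<open>0 < l\<close> by simp
  have "h y \<le> c" if y: "y \<in> {0<..<l}" for y
  proof (rule ccontr)
    assume "\<not> h y \<le> c"
    let ?U = "{0<..<l} \<inter> h -` {c<..}"
    have "open ?U"
      using h by (intro continuous_open_preimage) (auto intro: continuous_on_subset)
    moreover have "?U \<noteq> {}" using y \<open>\<not> h y \<le> c\<close> by auto
    ultimately have "\<not> negligible ?U" by (rule open_not_negligible)
    moreover have "AE x in lebesgue. x \<notin> ?U"
      using AE unfolding AE_leb by (rule eventually_mono) auto
    moreover have "?U \<in> sets lebesgue" using \<open>open ?U\<close> by auto
    ultimately show False by (simp add: negligible_iff_null_sets AE_iff_null_sets)
  qed
  then show ?thesis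
    using continuous_le_on_closure[of "{0<..<l}" h x c] h x cl by auto
qed

lemma AE_eq_imp_eq_Icc:
  fixes f g :: "real \<Rightarrow> real"
  assumes "0 < l" "continuous_on {0..l} f" "continuous_on {0..l} g"
    and AE: "AE x in leb l. f x = g x" and x: "x \<in> {0..l}"
  shows "f x = g x"
proof -
  have "\<bar>f x - g x\<bar> \<le> 0"
    by (rule AE_le_imp_le_Icc[OF assms(1) _ _ x])
      (use assms in \<open>auto intro!: continuous_intros elim: eventually_mono\<close>)
  then show ?thesis by simp
qed

text \<open>Two continuous representatives agree almost everywhere and hence on the closed interval,
  so any of them reveals what the choice operator selects there.\<close>

lemma continuous_rep_eq:
  assumes l: "0 < l" and Z: "continuous_on {0..l} Z" "AE x in leb l. f x = Z x" and x: "x \<in> {0..l}"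
  shows "continuous_rep l f x = Z x"
proof -
  define g where "g = continuous_rep l f"
  have g: "continuous_on {0..l} g \<and> (AE x in leb l. f x = g x)"
    unfolding g_def continuous_rep_def by (rule someI[of _ Z]) (use Z in simp)
  then have "AE x in leb l. g x = Z x" using Z(2) by (auto elim: eventually_elim2)
  then show ?thesis using AE_eq_imp_eq_Icc[OF l _ Z(1) _ x] g unfolding g_def by blast
qed

section \<open>The lemma of du Bois-Reymond and primitives as Sobolev functions\<close>

lemma test_function_with_derivative:
  assumes \<psi>: "continuous_on UNIV \<psi>" and ab: "0 < a" "b < l"
    and 0: "\<And>x. x \<notin> {a<..<b} \<Longrightarrow> \<psi> x = 0" and int: "(\<integral>x. \<psi> x \<partial>lborel) = 0"
  obtains \<phi> where "\<phi> \<in> test_functions l" "deriv \<phi> = \<psi>"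
proof -
  have "\<exists>F. \<forall>x::real. - \<infinity> < ereal x \<longrightarrow> ereal x < \<infinity> \<longrightarrow> (F has_vector_derivative \<psi> x) (at x)"
    using \<psi> by (intro einterval_antiderivative) (auto simp: continuous_on_eq_continuous_at)
  then obtain F where F: "\<And>x. (F has_real_derivative \<psi> x) (at x)"
    by (auto simp: has_real_derivative_iff_has_vector_derivative)
  define \<phi> where "\<phi> x = F x - F a" for x
  have d: "(\<phi> has_real_derivative \<psi> x) (at x)" for x
    unfolding \<phi>_def by (auto intro!: derivative_eq_intros F)
  have FTC: "(\<integral>s. \<psi> s * indicator {x..y} s \<partial>lborel) = F y - F x" if "x \<le> y" for x y
    using \<psi> that by (intro integral_FTC_Icc_real F) (auto simp: continuous_on_eq_continuous_at)
  have "\<phi> x = 0" if x: "x \<notin> {a<..<b}" for x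
  proof -
    consider "x \<le> a" | "a \<le> x" "b \<le> x" using x by fastforce
    then show ?thesis
    proof cases
      case 1
      have "(\<integral>s. \<psi> s * indicator {x..a} s \<partial>lborel) = (\<integral>s. 0 \<partial>(lborel :: real measure))"
        by (rule Bochner_Integration.integral_cong) (use 1 0 in \<open>auto split: split_indicator\<close>)
      then show ?thesis using FTC[OF 1] by (simp add: \<phi>_def)
    next
      \<comment> \<open>To the right of \<open>b\<close> the antiderivative has accumulated the
        whole integral of \<open>\<psi>\<close>; the zero mean is what makes it vanish there
        too.\<close>
      case 2
      have "(\<integral>s. \<psi> s * indicator {a..x} s \<partial>lborel) = (\<integral>s. \<psi> s \<partial>lborel)"
        by (rule Bochner_Integration.integral_cong) (use 2 0 in \<open>auto split: split_indicator\<close>)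
      then show ?thesis using FTC[OF 2(1)] int by (simp add: \<phi>_def)
    qed
  qed
  then have "x \<in> {a..b}" if "\<phi> x \<noteq> 0" for x
    using that by (cases "x \<in> {a<..<b}") auto
  then have "{x. \<phi> x \<noteq> 0} \<subseteq> {a..b}" by blast
  then have "closure {x. \<phi> x \<noteq> 0} \<subseteq> {a..b}" by (rule closure_minimal) auto
  moreover have "\<phi> C1_differentiable_on UNIV"
    unfolding C1_differentiable_on_def
    using d \<psi> by (auto simp: has_real_derivative_iff_has_vector_derivative)
  ultimately have "\<phi> \<in> test_functions l" using ab by (auto simp: test_functions_def)
  moreover have "deriv \<phi> = \<psi>" using d by (auto intro!: DERIV_imp_deriv)
  ultimately show ?thesis by (rule that)
qed

text \<open>A trapezoid with slopes n + 1 and -(n + 1), zero outside [1/(n+1), x - 1/(n+1)], that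
  tends to the indicator of (0, x). Continuity is all it needs, because bumps are used as
  derivatives of test functions.\<close>

definition bump :: "real \<Rightarrow> nat \<Rightarrow> real \<Rightarrow> real" where
  "bump x n y = max 0 (min 1 (min (real (Suc n) * y - 1) (real (Suc n) * (x - y) - 1)))"

lemma bump_bounded: "\<bar>bump x n y\<bar> \<le> 1"
  by (auto simp: bump_def)

lemma continuous_on_bump: "continuous_on S (bump x n)"
  unfolding bump_def by (intro continuous_intros)

lemma bump_measurable [measurable]: "bump x n \<in> borel_measurable borel"
  by (intro borel_measurable_continuous_onI continuous_on_bump)

lemma bump_support:
  assumes "x \<le> l" "y \<notin> {1 / real (Suc n)<..<l - 1 / real (Suc n)}"
  shows "bump x n y = 0"
proof -
  have "real (Suc n) * y \<le> 1 \<or> real (Suc n) * (l - y) \<le> 1"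
    using assms(2) by (auto simp: field_simps not_less)
  moreover have "real (Suc n) * (x - y) \<le> real (Suc n) * (l - y)"
    using assms(1) by (intro mult_left_mono) auto
  ultimately have "min (real (Suc n) * y - 1) (real (Suc n) * (x - y) - 1) \<le> 0"
    by linarith
  then show ?thesis unfolding bump_def by linarith
qed

lemma bump_tendsto:
  assumes "0 < y"
  shows "(\<lambda>n. bump x n y) \<longlonglongrightarrow> indicator {..<x} y"
proof (cases "y < x")
  case True
  have large: "\<forall>\<^sub>F n in sequentially. 2 \<le> real (Suc n) * c" if "0 < c" for c
  proof -
    have "\<forall>\<^sub>F n in sequentially. 2 / c \<le> real (Suc n)"
      using eventually_ge_at_top[of "nat \<lceil>2 / c\<rceil>"] by (rule eventually_mono) linarith
    then show ?thesis using that by (auto simp: field_simps elim: eventually_mono)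
  qed
  have "\<forall>\<^sub>F n in sequentially. bump x n y = 1"
    using large[OF assms] large[of "x - y", OF diff_gt_0_iff_gt[THEN iffD2, OF True]]
    by (rule eventually_elim2) (unfold bump_def, linarith)
  then show ?thesis using True by (simp add: tendsto_eventually)
next
  case False
  then have "real (Suc n) * (x - y) \<le> 0" for n by (simp add: mult_nonneg_nonpos)
  then have "bump x n y = 0" for n unfolding bump_def by (smt (verit, best))
  then show ?thesis using False by simp
qed

lemma integral_bump_tendsto:
  assumes "integrable (leb l) F"
  shows "(\<lambda>n. \<integral>y. F y * bump x n y \<partial>leb l) \<longlonglongrightarrow> primitive l F x"
  unfolding primitive_def
proof (rule integral_dominated_convergence[where w="\<lambda>y. \<bar>F y\<bar>"])
  have "indicator {..<x} \<in> borel_measurable (leb l)" by (rule indicator_leb_measurable) auto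
  then show "(\<lambda>y. indicator {..<x} y * F y) \<in> borel_measurable (leb l)" using assms by measurable
  have "bump x n \<in> borel_measurable (leb l)" for n by measurable
  then show "(\<lambda>y. F y * bump x n y) \<in> borel_measurable (leb l)" for n using assms by measurable
  show "integrable (leb l) (\<lambda>y. \<bar>F y\<bar>)" using assms by simp
  show "AE y in leb l. (\<lambda>n. F y * bump x n y) \<longlonglongrightarrow> indicator {..<x} y * F y"
    using bump_tendsto by (intro AE_I2) (subst mult.commute, auto intro!: tendsto_mult)
  show "AE y in leb l. norm (F y * bump x n y) \<le> \<bar>F y\<bar>" for n
    using bump_bounded by (auto simp: abs_mult intro!: mult_left_le)
qed

lemma integral_leb_eq_lborel:
  fixes f :: "real \<Rightarrow> real"
  assumes [measurable]: "f \<in> borel_measurable borel" and "\<And>x. x \<notin> {0<..<l} \<Longrightarrow> f x = 0"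
  shows "(\<integral>x. f x \<partial>leb l) = (\<integral>x. f x \<partial>lborel)"
proof -
  have "(\<integral>x. f x \<partial>leb l) = (\<integral>x. f x \<partial>lebesgue)"
    unfolding leb_integral
    by (rule Bochner_Integration.integral_cong) (use assms(2) in \<open>auto split: split_indicator\<close>)
  also have "\<dots> = (\<integral>x. f x \<partial>lborel)" by (rule integral_completion) measurable
  finally show ?thesis .
qed

lemma primitive_1: "0 \<le> x \<Longrightarrow> x \<le> l \<Longrightarrow> primitive l (\<lambda>_. 1) x = x"
  using primitive_diff[of l "\<lambda>_. 1" 0 x] measure_leb_interval[of 0 x l]
  by (simp add: integrable_leb_bounded[where B=1])

text \<open>Two bumps, each weighted by the mass of the other, differ by a function of mean 0, which
  is the derivative of a test function. In the limit, orthogonality says that the primitive of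
  \<open>F\<close> is linear, so subtracting the mean of \<open>F\<close> leaves a function with
  zero primitive.\<close>

theorem du_Bois_Reymond:
  assumes l: "0 < l" and F: "integrable (leb l) F"
    and ortho: "\<And>\<phi>. \<phi> \<in> test_functions l \<Longrightarrow> (\<integral>x. F x * deriv \<phi> x \<partial>leb l) = 0"
  obtains c where "AE x in leb l. F x = c"
proof -
  have one: "integrable (leb l) (\<lambda>_. 1 :: real)" by (rule integrable_leb_bounded[where B=1]) auto
  define B where "B x n = (\<integral>y. 1 * bump x n y \<partial>leb l)" for x n
  have int: "integrable (leb l) (\<lambda>y. F y * bump x n y)" for x n
    using integrable_leb_mult_bounded[OF F, of "bump x n" 1] bump_bounded by (simp add: mult.commute)
  have int1: "integrable (leb l) (bump x n)" for x n
    by (rule integrable_leb_bounded[where B=1]) (use bump_bounded in auto)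
  have eq: "B l n * (\<integral>y. F y * bump x n y \<partial>leb l) = B x n * (\<integral>y. F y * bump l n y \<partial>leb l)"
    if "x \<le> l" for x n
  proof -
    define \<psi> where "\<psi> y = B l n * bump x n y - B x n * bump l n y" for y
    have supp: "\<psi> y = 0" if "y \<notin> {1 / real (Suc n)<..<l - 1 / real (Suc n)}" for y
      using bump_support[OF \<open>x \<le> l\<close> that] bump_support[OF order.refl that] by (simp add: \<psi>_def)
    have n: "0 < 1 / real (Suc n)" by simp
    have cont: "continuous_on UNIV \<psi>"
      unfolding \<psi>_def by (intro continuous_intros continuous_on_bump)
    have "\<psi> y = 0" if "y \<notin> {0<..<l}" for y
      by (rule supp) (use that n in \<open>unfold greaterThanLessThan_iff, linarith\<close>)
    then have "(\<integral>y. \<psi> y \<partial>lborel) = (\<integral>y. \<psi> y \<partial>leb l)"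
      using cont by (intro integral_leb_eq_lborel[symmetric] borel_measurable_continuous_onI)
    also have "\<dots> = 0"
      unfolding \<psi>_def using int1 by (simp add: B_def)
    finally have zero: "(\<integral>y. \<psi> y \<partial>lborel) = 0" .
    have "l - 1 / real (Suc n) < l" using n by linarith
    from test_function_with_derivative[OF cont n this supp zero]
    obtain \<phi> where "\<phi> \<in> test_functions l" "deriv \<phi> = \<psi>" by blast
    with ortho have "(\<integral>y. F y * \<psi> y \<partial>leb l) = 0" by metis
    moreover have "F y * \<psi> y = B l n * (F y * bump x n y) - B x n * (F y * bump l n y)" for y
      by (simp add: \<psi>_def algebra_simps)
    ultimately show ?thesis using int by simp
  qed
  have lim: "l * primitive l F x = x * primitive l F l" if x: "0 \<le> x" "x \<le> l" for x
  proof (rule LIMSEQ_unique)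
    have B_lim: "B x \<longlonglongrightarrow> x" if "0 \<le> x" "x \<le> l" for x
      using integral_bump_tendsto[OF one, of x] primitive_1[OF that] by (simp add: B_def[abs_def])
    show "(\<lambda>n. B l n * (\<integral>y. F y * bump x n y \<partial>leb l)) \<longlonglongrightarrow> l * primitive l F x"
      using l by (intro tendsto_mult B_lim integral_bump_tendsto F) auto
    show "(\<lambda>n. B l n * (\<integral>y. F y * bump x n y \<partial>leb l)) \<longlonglongrightarrow> x * primitive l F l"
      unfolding eq[OF x(2)] by (intro tendsto_mult B_lim integral_bump_tendsto F x)
  qed
  define c where "c = primitive l F l / l"
  have const: "integrable (leb l) (\<lambda>_. c * - 1)"
    by (rule integrable_leb_bounded[where B="\<bar>c\<bar>"]) auto
  have "AE x in leb l. F x + c * - 1 = 0"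
  proof (rule AE_zero_if_primitive_zero)
    show "integrable (leb l) (\<lambda>x. F x + c * - 1)"
      by (rule Bochner_Integration.integrable_add[OF F const])
    fix x assume "x \<in> {0..l}"
    then have x: "0 \<le> x" "x \<le> l" by auto
    have "primitive l (\<lambda>x. F x + c * - 1) x = primitive l F x + c * - primitive l (\<lambda>_. 1) x"
      unfolding primitive_add[OF F const] primitive_mult primitive_minus ..
    also have "\<dots> = primitive l F x - c * x" using primitive_1[OF x] by simp
    also have "\<dots> = 0" using lim[OF x] l by (simp add: c_def field_simps)
    finally show "primitive l (\<lambda>x. F x + c * - 1) x = 0" .
  qed
  then have "AE x in leb l. F x = c" by simp
  then show ?thesis by (rule that)
qed

text \<open>By integration by parts, \<open>z\<close> minus the primitive of \<open>z'\<close> is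
  orthogonal to all derivatives of test functions, hence constant. This makes the vertex values of a
  test field explicit.\<close>

lemma primitive_of_weak_derivative:
  assumes l: "0 < l" and z: "has_weak_derivative l z z'"
  obtains c where "integrable (leb l) z'" "AE x in leb l. z x = c + primitive l z' x"
    "\<And>x. x \<in> {0..l} \<Longrightarrow> continuous_rep l z x = c + primitive l z' x"
proof -
  from z have z_int: "integrable (leb l) z" and z'_int: "integrable (leb l) z'"
    and weak: "\<And>\<phi>. \<phi> \<in> test_functions l \<Longrightarrow>
       (\<integral>x. z x * deriv \<phi> x \<partial>leb l) = - (\<integral>x. z' x * \<phi> x \<partial>leb l)"
    by (auto simp: has_weak_derivative_def Lp_interval_1_iff)
  have prim: "continuous_on S (primitive l z')" for S
    using z'_int by (rule continuous_on_primitive)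
  have "compact (primitive l z' ` {0..l})"
    by (intro compact_continuous_image prim) auto
  then obtain B where B: "\<And>x. x \<in> {0..l} \<Longrightarrow> \<bar>primitive l z' x\<bar> \<le> B"
    using compact_imp_bounded[of "primitive l z' ` {0..l}"] unfolding bounded_iff by fastforce
  have prim_int: "integrable (leb l) (primitive l z')"
    by (rule integrable_leb_bounded[where B=B])
      (use B in \<open>auto intro!: borel_measurable_leb borel_measurable_continuous_onI prim\<close>)
  have mult_int: "integrable (leb l) (\<lambda>x. f x * deriv \<phi> x)"
    if f: "integrable (leb l) f" and \<phi>: "\<phi> \<in> test_functions l" for f \<phi>
  proof -
    obtain C where C: "\<And>x. \<bar>deriv \<phi> x\<bar> \<le> C"
      using vanishing_outside_bounded[OF test_function_deriv(2)[OF \<phi>] test_function_support(2)[OF \<phi>]]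
      by blast
    have "deriv \<phi> \<in> borel_measurable (leb l)"
      using test_function_deriv(2)[OF \<phi>] by (intro borel_measurable_leb borel_measurable_continuous_onI)
    from integrable_leb_mult_bounded[OF f this C] show ?thesis by (simp add: mult.commute)
  qed
  obtain c where c: "AE x in leb l. z x - primitive l z' x = c"
  proof (rule du_Bois_Reymond[OF l])
    show "integrable (leb l) (\<lambda>x. z x - primitive l z' x)" using z_int prim_int by simp
    fix \<phi> assume \<phi>: "\<phi> \<in> test_functions l"
    have "(\<integral>x. (z x - primitive l z' x) * deriv \<phi> x \<partial>leb l) =
        (\<integral>x. z x * deriv \<phi> x \<partial>leb l) - (\<integral>x. primitive l z' x * deriv \<phi> x \<partial>leb l)"
      using mult_int[OF z_int \<phi>] mult_int[OF prim_int \<phi>] by (simp add: left_diff_distrib)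
    then show "(\<integral>x. (z x - primitive l z' x) * deriv \<phi> x \<partial>leb l) = 0"
      using weak[OF \<phi>] primitive_integration_by_parts[OF z'_int \<phi>] by simp
  qed
  then have AE: "AE x in leb l. z x = c + primitive l z' x"
    by (auto elim: eventually_mono)
  moreover have "continuous_rep l z x = c + primitive l z' x" if "x \<in> {0..l}" for x
    by (rule continuous_rep_eq[OF l _ AE that]) (intro continuous_intros prim)
  ultimately show ?thesis using z'_int that by blast
qed

lemma primitive_bounded:
  assumes "g \<in> borel_measurable (leb l)" "\<And>x. x \<in> {0<..<l} \<Longrightarrow> \<bar>g x\<bar> \<le> B" "x \<in> {0..l}"
  shows "\<bar>primitive l g x\<bar> \<le> \<bar>B\<bar> * l"
proof -
  have "\<bar>primitive l g x - primitive l g 0\<bar> \<le> B * (x - 0)"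
    by (rule primitive_Lipschitz) (use assms in auto)
  also have "\<dots> \<le> \<bar>B\<bar> * l" using assms(3) by (intro mult_mono) auto
  finally show ?thesis by simp
qed

text \<open>A bounded derivative puts the function and its derivative into L^2, as test fields
  require. All fields constructed explicitly later have bounded derivatives.\<close>

lemma primitive_has_weak_derivative:
  assumes l: "0 < l" and g: "g \<in> borel_measurable (leb l)" "\<And>x. x \<in> {0<..<l} \<Longrightarrow> \<bar>g x\<bar> \<le> B"
  shows "has_weak_derivative l (\<lambda>x. c + primitive l g x) g"
    and "(\<lambda>x. c + primitive l g x) \<in> W1p_interval 2 l"
    and "x \<in> {0..l} \<Longrightarrow> continuous_rep l (\<lambda>x. c + primitive l g x) x = c + primitive l g x"
proof -
  have int: "integrable (leb l) g" using g by (rule integrable_leb_bounded)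
  have cont: "continuous_on S (\<lambda>x. c + primitive l g x)" for S
    by (intro continuous_intros continuous_on_primitive int)
  have Lp: "g \<in> Lp_interval p l" "(\<lambda>x. c + primitive l g x) \<in> Lp_interval p l" if "0 \<le> p" for p
  proof -
    show "g \<in> Lp_interval p l" using g that by (rule Lp_interval_bounded)
    show "(\<lambda>x. c + primitive l g x) \<in> Lp_interval p l"
    proof (rule Lp_interval_bounded)
      show "(\<lambda>x. c + primitive l g x) \<in> borel_measurable (leb l)"
        by (intro borel_measurable_leb borel_measurable_continuous_onI cont)
      show "\<bar>c + primitive l g x\<bar> \<le> \<bar>c\<bar> + \<bar>B\<bar> * l" if "x \<in> {0<..<l}" for x
        using primitive_bounded[OF g, of x] that by auto
    qed (rule that)
  qed
  show weak: "has_weak_derivative l (\<lambda>x. c + primitive l g x) g"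
    unfolding has_weak_derivative_def
  proof (intro conjI ballI Lp)
    fix \<phi> assume \<phi>: "\<phi> \<in> test_functions l"
    obtain C where C: "\<And>x. \<bar>deriv \<phi> x\<bar> \<le> C"
      using vanishing_outside_bounded[OF test_function_deriv(2)[OF \<phi>] test_function_support(2)[OF \<phi>]]
      by blast
    have meas: "deriv \<phi> \<in> borel_measurable borel"
      using test_function_deriv(2)[OF \<phi>] by (intro borel_measurable_continuous_onI)
    have \<phi>'_int: "integrable (leb l) (deriv \<phi>)"
      using meas C by (intro integrable_leb_bounded borel_measurable_leb)
    have "integrable (leb l) (primitive l g)"
      by (rule integrable_leb_bounded[where B="\<bar>B\<bar> * l"])
        (use primitive_bounded[OF g] int in \<open>auto intro!: borel_measurable_leb borel_measurable_continuous_onI continuous_on_primitive\<close>)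
    from integrable_leb_mult_bounded[OF this borel_measurable_leb[OF meas] C]
    have prim_\<phi>'_int: "integrable (leb l) (\<lambda>x. primitive l g x * deriv \<phi> x)"
      by (simp add: mult.commute)
    have "(\<integral>x. deriv \<phi> x \<partial>leb l) = (\<integral>x. deriv \<phi> x \<partial>lborel)"
      by (rule integral_leb_eq_lborel[OF meas test_function_support(2)[OF \<phi>]])
    also have "\<dots> = (\<integral>x. indicator {0..} x * deriv \<phi> x \<partial>lborel)"
      by (rule Bochner_Integration.integral_cong)
        (use test_function_support(2)[OF \<phi>] in \<open>auto split: split_indicator\<close>)
    also have "\<dots> = 0"
      using test_function_integral_Ici[OF \<phi>, of 0] test_function_support(1)[OF \<phi>, of 0] by simp
    finally show "(\<integral>x. (c + primitive l g x) * deriv \<phi> x \<partial>leb l) = - (\<integral>x. g x * \<phi> x \<partial>leb l)"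
      using \<phi>'_int prim_\<phi>'_int primitive_integration_by_parts[OF int \<phi>] by (simp add: distrib_right)
  qed auto
  then show "(\<lambda>x. c + primitive l g x) \<in> W1p_interval 2 l"
    using Lp[of 2] by (auto simp: W1p_interval_def)
  show "continuous_rep l (\<lambda>x. c + primitive l g x) x = c + primitive l g x" if "x \<in> {0..l}"
    by (rule continuous_rep_eq[OF l cont _ that]) simp
qed

section \<open>Uniform grids on an interval\<close>

definition cell :: "nat \<Rightarrow> real \<Rightarrow> nat \<Rightarrow> real set" where
  "cell N l i = {real i * l / real N ..< real (Suc i) * l / real N}"

definition cell_index :: "nat \<Rightarrow> real \<Rightarrow> real \<Rightarrow> nat" where
  "cell_index N l x = nat \<lfloor>x * real N / l\<rfloor>"

definition cell_average :: "nat \<Rightarrow> real \<Rightarrow> (real \<Rightarrow> real) \<Rightarrow> nat \<Rightarrow> real" where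
  "cell_average N l f i = real N / l * (\<integral>x. indicator (cell N l i) x * f x \<partial>leb l)"

lemma mem_cell_iff:
  assumes "0 < l" "0 < N" "0 \<le> x"
  shows "x \<in> cell N l i \<longleftrightarrow> cell_index N l x = i"
proof -
  have "x \<in> cell N l i \<longleftrightarrow> real i \<le> x * real N / l \<and> x * real N / l < real i + 1"
    using assms by (auto simp: cell_def field_simps)
  also have "\<dots> \<longleftrightarrow> \<lfloor>x * real N / l\<rfloor> = int i" by linarith
  also have "\<dots> \<longleftrightarrow> cell_index N l x = i"
    using assms by (auto simp: cell_index_def)
  finally show ?thesis .
qed

lemma cell_index_less:
  assumes "0 < l" "0 < N" "0 \<le> x" "x < l"
  shows "cell_index N l x < N"
proof -
  have "x * real N / l < real N" using assms by (simp add: field_simps)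
  then show ?thesis using assms by (simp add: cell_index_def nat_less_iff floor_less_iff)
qed

lemma cell_measurable [measurable, simp]: "cell N l i \<in> sets lebesgue"
  by (simp add: cell_def)

lemma integral_cell:
  assumes "0 < l" "0 < N" "integrable (leb l) f"
  shows "(\<integral>x. indicator (cell N l i) x * f x \<partial>leb l) =
     primitive l f (real (Suc i) * l / real N) - primitive l f (real i * l / real N)"
  unfolding cell_def
  by (rule primitive_diff[symmetric]) (use assms in \<open>auto simp: field_simps\<close>)

lemma integral_cell_const:
  assumes "0 < l" "i < N"
  shows "(\<integral>x. indicator (cell N l i) x \<partial>leb l) = l / real N"
proof -
  have "(\<integral>x. indicator (cell N l i) x \<partial>leb l) = real (Suc i) * l / real N - real i * l / real N"
    unfolding cell_def
  proof (rule measure_leb_interval)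
    have "real (Suc i) * l \<le> real N * l" using assms by (intro mult_right_mono) auto
    then show "real (Suc i) * l / real N \<le> l" using assms by (simp add: field_simps)
  qed (use assms in \<open>auto simp: field_simps\<close>)
  then show ?thesis using assms by (simp add: field_simps)
qed

lemma node_Suc: "real (Suc i) * l / real N = real i * l / real N + l / real N"
  by (simp add: distrib_right add_divide_distrib)

lemma sum_over_cells:
  fixes w :: "nat \<Rightarrow> real"
  assumes "0 < l" "0 < N" "x \<in> {0<..<l}"
  shows "w (cell_index N l x) = (\<Sum>i<N. w i * indicator (cell N l i) x)"
proof -
  have "(\<Sum>i<N. w i * indicator (cell N l i) x) = (\<Sum>i<N. if i = cell_index N l x then w i else 0)"
    using assms by (intro sum.cong) (auto simp: mem_cell_iff indicator_def)
  also have "\<dots> = w (cell_index N l x)"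
    using cell_index_less[of l N x] assms by simp
  finally show ?thesis ..
qed

lemma step_function_measurable:
  assumes "0 < l" "0 < N"
  shows "(\<lambda>x. w (cell_index N l x) :: real) \<in> borel_measurable (leb l)"
proof -
  have "(\<lambda>x. \<Sum>i<N. w i * indicator (cell N l i) x) \<in> borel_measurable (leb l)"
    by (intro borel_measurable_sum borel_measurable_times borel_measurable_const indicator_leb_measurable) simp
  moreover have "w (cell_index N l x) = (\<Sum>i<N. w i * indicator (cell N l i) x)" if "x \<in> space (leb l)" for x
    using sum_over_cells[OF assms, of x w] that by simp
  ultimately show ?thesis by (subst measurable_cong) auto
qed

lemma step_function_bounded:
  fixes w :: "nat \<Rightarrow> real"
  assumes "0 < l" "0 < N" "x \<in> {0<..<l}"
  shows "\<bar>w (cell_index N l x)\<bar> \<le> (\<Sum>i<N. \<bar>w i\<bar>)"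
  using cell_index_less[of l N x] assms by (intro member_le_sum) auto

lemma integrable_step_function:
  fixes w :: "nat \<Rightarrow> real"
  assumes "0 < l" "0 < N"
  shows "integrable (leb l) (\<lambda>x. w (cell_index N l x))"
  using step_function_measurable[OF assms] step_function_bounded[OF assms] by (rule integrable_leb_bounded)

lemma integrable_step_mult:
  fixes w :: "nat \<Rightarrow> real"
  assumes "0 < l" "0 < N" "integrable (leb l) f"
  shows "integrable (leb l) (\<lambda>x. w (cell_index N l x) * f x)"
  by (rule integrable_leb_mult_bounded[OF assms(3) step_function_measurable[OF assms(1,2)] step_function_bounded[OF assms(1,2)]])

lemma integral_step_mult:
  fixes w :: "nat \<Rightarrow> real"
  assumes "0 < l" "0 < N" "integrable (leb l) f"
  shows "(\<integral>x. w (cell_index N l x) * f x \<partial>leb l) =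
    (\<Sum>i<N. w i * (\<integral>x. indicator (cell N l i) x * f x \<partial>leb l))"
proof -
  have "(\<integral>x. w (cell_index N l x) * f x \<partial>leb l) =
      (\<integral>x. (\<Sum>i<N. w i * (indicator (cell N l i) x * f x)) \<partial>leb l)"
    by (rule Bochner_Integration.integral_cong[OF refl])
      (use sum_over_cells[OF assms(1,2), of _ w] in \<open>simp only: sum_distrib_right mult.assoc space_leb\<close>)
  also have "\<dots> = (\<Sum>i<N. w i * (\<integral>x. indicator (cell N l i) x * f x \<partial>leb l))"
    using integrable_leb_indicator[OF assms(3)] by (subst Bochner_Integration.integral_sum) auto
  finally show ?thesis .
qed

lemma integral_step:
  fixes w :: "nat \<Rightarrow> real"
  assumes "0 < l" "0 < N"
  shows "(\<integral>x. w (cell_index N l x) \<partial>leb l) = (\<Sum>i<N. w i * (l / real N))"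
  using integral_step_mult[OF assms, of "\<lambda>_. 1" w] integral_cell_const[OF assms(1)]
  by (simp add: integrable_leb_bounded[where B=1])

text \<open>Both sides equal N/l times the sum over the cells of the product of the two cell
  integrals.\<close>

lemma cell_average_self_adjoint:
  assumes "0 < l" "0 < N" "integrable (leb l) f" "integrable (leb l) g"
  shows "(\<integral>x. cell_average N l f (cell_index N l x) * g x \<partial>leb l) =
    (\<integral>x. cell_average N l g (cell_index N l x) * f x \<partial>leb l)"
  using assms by (simp add: integral_step_mult) (simp add: cell_average_def mult_ac)

lemma cell_average_bounds:
  assumes l: "0 < l" "i < N" and f: "integrable (leb l) f" "\<And>x. x \<in> {0<..<l} \<Longrightarrow> f x \<in> {a..b}"
  shows "cell_average N l f i \<in> {a..b}"
proof -
  let ?I = "indicator (cell N l i) :: real \<Rightarrow> real"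
  have "0 < N" using l by simp
  have I: "integrable (leb l) (\<lambda>x. ?I x * c)" for c
    by (rule integrable_leb_indicator) (auto intro: integrable_leb_bounded)
  have mono: "(\<integral>x. ?I x * a \<partial>leb l) \<le> (\<integral>x. ?I x * f x \<partial>leb l)"
    "(\<integral>x. ?I x * f x \<partial>leb l) \<le> (\<integral>x. ?I x * b \<partial>leb l)"
    by (rule integral_mono[OF I integrable_leb_indicator[OF f(1)]], simp,
        use f(2) in \<open>fastforce intro: mult_left_mono\<close>)
      (rule integral_mono[OF integrable_leb_indicator[OF f(1)] I], simp,
        use f(2) in \<open>fastforce intro: mult_left_mono\<close>)
  have "(\<integral>x. ?I x * c \<partial>leb l) = l / real N * c" for c
    using integral_cell_const[OF l] by simp
  with mono have "l / real N * a \<le> (\<integral>x. ?I x * f x \<partial>leb l)" "(\<integral>x. ?I x * f x \<partial>leb l) \<le> l / real N * b"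
    by simp_all
  then show ?thesis
    using l \<open>0 < N\<close> by (auto simp: cell_average_def field_simps)
qed

lemma primitive_within_cell:
  assumes l: "0 < l" "0 < N" and x: "x \<in> {0..<l}"
    and g: "g \<in> borel_measurable (leb l)" "\<And>x. x \<in> {0<..<l} \<Longrightarrow> \<bar>g x\<bar> \<le> B"
  defines "i \<equiv> cell_index N l x"
  shows "\<bar>primitive l g x - primitive l g (real i * l / real N)\<bar> \<le> B * (l / real N)"
proof -
  have "x \<in> cell N l i" using mem_cell_iff[of l N x i] l x by (simp add: i_def)
  then have xi: "real i * l / real N \<le> x" "x - real i * l / real N \<le> l / real N"
    unfolding cell_def node_Suc by auto
  have "0 \<le> B" using g(2)[of "l/2"] l by auto
  have "\<bar>primitive l g x - primitive l g (real i * l / real N)\<bar> \<le> B * (x - real i * l / real N)"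
    by (rule primitive_Lipschitz[OF g]) (use l xi x in auto)
  also have "\<dots> \<le> B * (l / real N)" using xi \<open>0 \<le> B\<close> by (rule_tac mult_left_mono)
  finally show ?thesis .
qed

text \<open>The primitive of the scaled increments is the piecewise linear interpolation of the node
  values \<open>y\<close>. The form as a convex combination of neighbouring values lets bounds at
  the nodes pass to the whole edge.\<close>

lemma primitive_step_function:
  fixes d y :: "nat \<Rightarrow> real"
  assumes l: "0 < l" "0 < N" and d: "\<And>i. i < N \<Longrightarrow> d i = y (Suc i) - y i"
  defines "g \<equiv> \<lambda>x. real N / l * d (cell_index N l x)"
  shows "i \<le> N \<Longrightarrow> y 0 + primitive l g (real i * l / real N) = y i"
    and "x \<in> {0..l} \<Longrightarrow> \<exists>i<N. \<exists>t\<in>{0..1}. y 0 + primitive l g x = (1 - t) * y i + t * y (Suc i)"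
proof -
  have g_step: "g = (\<lambda>x. (\<lambda>i. real N / l * d i) (cell_index N l x))" by (simp add: g_def)
  have g_int: "integrable (leb l) g"
    unfolding g_step using l by (rule integrable_step_function)
  have g_meas: "g \<in> borel_measurable (leb l)" using g_int by simp
  have cell_int: "primitive l g x - primitive l g (real i * l / real N) = (x - real i * l / real N) * (real N / l * d i)"
    if x: "real i * l / real N \<le> x" "x \<le> real (Suc i) * l / real N" and i: "i < N" for i x
  proof -
    have "real (Suc i) * l \<le> real N * l" using i l by (intro mult_right_mono) auto
    then have "real (Suc i) * l / real N \<le> l" using l by (simp add: field_simps)
    then have xl: "x \<le> l" using x by simp
    have "0 \<le> real i * l / real N" using l by simp
    have "primitive l g x - primitive l g (real i * l / real N) =
        (\<integral>s. indicator {real i * l / real N..<x} s * g s \<partial>leb l)"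
      by (rule primitive_diff[OF g_int x(1)])
    also have "\<dots> = (\<integral>s. indicator {real i * l / real N..<x} s * (real N / l * d i) \<partial>leb l)"
    proof (rule Bochner_Integration.integral_cong[OF refl])
      fix s assume "s \<in> space (leb l)"
      then have s: "0 \<le> s" by simp
      show "indicator {real i * l / real N..<x} s * g s =
          indicator {real i * l / real N..<x} s * (real N / l * d i)"
      proof (cases "s \<in> {real i * l / real N..<x}")
        case True
        then have "s \<in> cell N l i" using x by (auto simp: cell_def)
        then have "cell_index N l s = i" using mem_cell_iff[OF l s] by simp
        then show ?thesis by (simp add: g_def)
      qed simp
    qed
    also have "\<dots> = (x - real i * l / real N) * (real N / l * d i)"
      using measure_leb_interval[OF \<open>0 \<le> real i * l / real N\<close> x(1) xl] by simp
    finally show ?thesis .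
  qed
  show nodes: "y 0 + primitive l g (real i * l / real N) = y i" if "i \<le> N" for i
    using that
  proof (induction i)
    case (Suc i)
    have "primitive l g (real (Suc i) * l / real N) - primitive l g (real i * l / real N) =
       (real (Suc i) * l / real N - real i * l / real N) * (real N / l * d i)"
      by (rule cell_int) (use Suc.prems l in \<open>auto simp: field_simps\<close>)
    also have "\<dots> = d i" using l by (simp add: field_simps)
    finally show ?case using Suc d[of i] by simp
  qed simp
  show "\<exists>i<N. \<exists>t\<in>{0..1}. y 0 + primitive l g x = (1 - t) * y i + t * y (Suc i)" if x: "x \<in> {0..l}"
  proof -
    \<comment> \<open>At the right end point \<open>cell_index\<close> returns \<open>N\<close>; the
      minimum assigns that point to the last cell.\<close>
    define i where "i = min (cell_index N l x) (N - 1)"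
    have i: "i < N" using l by (simp add: i_def)
    have xi: "real i * l / real N \<le> x" "x \<le> real (Suc i) * l / real N"
    proof -
      have "real i * l / real N \<le> x \<and> x \<le> real (Suc i) * l / real N"
      proof (cases "x < l")
        case True
        then have "cell_index N l x = i" using cell_index_less[OF l, of x] x by (simp add: i_def)
        then have "x \<in> cell N l i" using mem_cell_iff[OF l, of x i] x by simp
        then show ?thesis by (simp add: cell_def)
      next
        case False
        then have "x = l" using x by simp
        moreover have "cell_index N l l = N" using l by (simp add: cell_index_def)
        ultimately have "i = N - 1" "x = l" by (simp_all add: i_def)
        then show ?thesis using l by (auto simp: field_simps of_nat_diff)
      qed
      then show "real i * l / real N \<le> x" "x \<le> real (Suc i) * l / real N" by auto
    qed
    define t where "t = (x - real i * l / real N) * real N / l"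
    have "0 \<le> x - real i * l / real N" "x - real i * l / real N \<le> l / real N"
      using xi unfolding node_Suc by auto
    then have "0 \<le> (x - real i * l / real N) * real N" "(x - real i * l / real N) * real N \<le> l"
      using pos_le_divide_eq[of "real N" "x - real i * l / real N" l] l by auto
    then have t: "t \<in> {0..1}" using l by (simp add: t_def)
    have "y 0 + primitive l g x = y i + t * d i"
      using cell_int[OF xi i] nodes[of i] i by (simp add: t_def)
    also have "\<dots> = (1 - t) * y i + t * y (Suc i)" unfolding d[OF i] by (simp add: algebra_simps)
    finally show ?thesis using i t by blast
  qed
qed

section \<open>Total variation through primitives of test fields\<close>

text \<open>
  A test field of the total variation, encoded on each edge by its value \<open>c e\<close> at the initial vertex
  and its derivative \<open>g e\<close>.
\<close>

definition kirchhoff_field :: "('v, 'e) metric_graph \<Rightarrow> ('e \<Rightarrow> real) \<Rightarrow> ('e \<Rightarrow> real \<Rightarrow> real) \<Rightarrow> bool" where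
  "kirchhoff_field \<Gamma> c g \<longleftrightarrow>
     (\<forall>e\<in>edges \<Gamma>. integrable (leb (len \<Gamma> e)) (g e) \<and>
        (\<forall>x\<in>{0..len \<Gamma> e}. \<bar>c e + primitive (len \<Gamma> e) (g e) x\<bar> \<le> 1)) \<and>
     (\<forall>v\<in>vertices \<Gamma>. (\<Sum>e\<in>incident_edges \<Gamma> v.
        if v = term_vertex \<Gamma> e then c e + primitive (len \<Gamma> e) (g e) (len \<Gamma> e) else - c e) = 0)"

locale connected_metric_graph =
  fixes \<Gamma> :: "('v, 'e) metric_graph"
  assumes ccmg: "connected_compact_metric_graph \<Gamma>"
begin

abbreviation "E \<equiv> edges \<Gamma>"
abbreviation "\<l> \<equiv> len \<Gamma>"

definition total_length :: real where
  "total_length = (\<Sum>e\<in>E. \<l> e)"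

lemma finite_E [simp]: "finite E" and E_nonempty: "E \<noteq> {}"
  and len_pos: "e \<in> E \<Longrightarrow> 0 < \<l> e"
  and init_in: "e \<in> E \<Longrightarrow> init_vertex \<Gamma> e \<in> vertices \<Gamma>"
  and term_in: "e \<in> E \<Longrightarrow> term_vertex \<Gamma> e \<in> vertices \<Gamma>"
  and no_loop: "e \<in> E \<Longrightarrow> init_vertex \<Gamma> e \<noteq> term_vertex \<Gamma> e"
  using ccmg unfolding connected_compact_metric_graph_def
  by (auto simp: fin_digraph.finite_arcs fin_digraph_def wf_digraph.tail_in_verts
      wf_digraph.head_in_verts loopfree_digraph.no_loops)

lemma len_le_total: "e \<in> E \<Longrightarrow> \<l> e \<le> total_length"
  unfolding total_length_def using len_pos by (intro member_le_sum) (auto intro: less_imp_le)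

lemma total_length_pos: "0 < total_length"
  unfolding total_length_def using len_pos E_nonempty by (intro sum_pos) auto

text \<open>Each admissible pair is such a field: \<open>primitive_of_weak_derivative\<close>
  represents it, and continuity makes its essential bound pointwise. \<open>kirchhoff_field\<close>
  asks only for an integrable derivative, not a square integrable one, so it may admit more fields;
  this direction tolerates that, while \<open>TV_ge\<close> asks for a bounded derivative.\<close>

lemma TV_leI:
  assumes "\<And>c g. kirchhoff_field \<Gamma> c g \<Longrightarrow> ereal \<bar>graph_integral \<Gamma> (\<lambda>e x. u e x * g e x)\<bar> \<le> K"
  shows "TV \<Gamma> u \<le> K"
  unfolding TV_def
proof (rule SUP_least)
  fix p assume "p \<in> {(z, z'). z \<in> X_K \<Gamma> \<and> graph_weak_derivative \<Gamma> z z' \<and> Linf_norm \<Gamma> z \<le> 1}"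
  then have "case p of (z, z') \<Rightarrow> z \<in> X_K \<Gamma> \<and> graph_weak_derivative \<Gamma> z z' \<and> Linf_norm \<Gamma> z \<le> 1"
    by (rule CollectD)
  moreover obtain z z' where p: "p = (z, z')" by (cases p)
  ultimately have X: "z \<in> X_K \<Gamma>" and Linf: "Linf_norm \<Gamma> z \<le> 1"
    and weak: "\<And>e. e \<in> E \<Longrightarrow> has_weak_derivative (\<l> e) (z e) (z' e)"
    by (simp_all add: graph_weak_derivative_def)
  have "\<forall>e\<in>E. \<exists>c. integrable (leb (\<l> e)) (z' e) \<and> (AE x in leb (\<l> e). z e x = c + primitive (\<l> e) (z' e) x) \<and>
    (\<forall>x\<in>{0..\<l> e}. continuous_rep (\<l> e) (z e) x = c + primitive (\<l> e) (z' e) x)"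
  proof
    fix e assume e: "e \<in> E"
    show "\<exists>c. integrable (leb (\<l> e)) (z' e) \<and> (AE x in leb (\<l> e). z e x = c + primitive (\<l> e) (z' e) x) \<and>
      (\<forall>x\<in>{0..\<l> e}. continuous_rep (\<l> e) (z e) x = c + primitive (\<l> e) (z' e) x)"
      by (rule primitive_of_weak_derivative[OF len_pos[OF e] weak[OF e]]) blast
  qed
  then obtain c where c: "\<forall>e\<in>E. integrable (leb (\<l> e)) (z' e) \<and> (AE x in leb (\<l> e). z e x = c e + primitive (\<l> e) (z' e) x) \<and>
    (\<forall>x\<in>{0..\<l> e}. continuous_rep (\<l> e) (z e) x = c e + primitive (\<l> e) (z' e) x)"
    unfolding bchoice_iff ..
  then have int: "\<And>e. e \<in> E \<Longrightarrow> integrable (leb (\<l> e)) (z' e)"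
    and ae: "\<And>e. e \<in> E \<Longrightarrow> AE x in leb (\<l> e). z e x = c e + primitive (\<l> e) (z' e) x"
    and rep: "\<And>e x. e \<in> E \<Longrightarrow> x \<in> {0..\<l> e} \<Longrightarrow> continuous_rep (\<l> e) (z e) x = c e + primitive (\<l> e) (z' e) x"
    by blast+
  have "kirchhoff_field \<Gamma> c z'"
    unfolding kirchhoff_field_def
  proof (intro conjI ballI int)
    fix e x assume e: "e \<in> E" and x: "x \<in> {0..\<l> e}"
    have "esssup (leb (\<l> e)) (\<lambda>x. ereal \<bar>z e x\<bar>) \<le> Linf_norm \<Gamma> z"
      unfolding Linf_norm_def by (rule SUP_upper[OF e])
    also note Linf
    finally have "esssup (leb (\<l> e)) (\<lambda>x. ereal \<bar>z e x\<bar>) \<le> 1" .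
    then have "AE x in leb (\<l> e). ereal \<bar>z e x\<bar> \<le> 1"
      by (intro eventually_mono[OF esssup_AE[of "\<lambda>x. ereal \<bar>z e x\<bar>" "leb (\<l> e)"]]) (erule order.trans)
    then have "AE x in leb (\<l> e). \<bar>c e + primitive (\<l> e) (z' e) x\<bar> \<le> 1"
      using ae[OF e] by eventually_elim (simp add: one_ereal_def)
    moreover have "continuous_on {0..\<l> e} (\<lambda>x. \<bar>c e + primitive (\<l> e) (z' e) x\<bar>)"
      by (intro continuous_intros continuous_on_primitive int e)
    ultimately show "\<bar>c e + primitive (\<l> e) (z' e) x\<bar> \<le> 1"
      using AE_le_imp_le_Icc[OF len_pos[OF e] _ _ x] by blast
  next
    fix v assume v: "v \<in> vertices \<Gamma>"
    have "(\<Sum>e\<in>incident_edges \<Gamma> v. if v = term_vertex \<Gamma> e then c e + primitive (\<l> e) (z' e) (\<l> e) else - c e) =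
        (\<Sum>e\<in>incident_edges \<Gamma> v. vertex_value \<Gamma> z e v)"
    proof (rule sum.cong[OF refl])
      fix e assume "e \<in> incident_edges \<Gamma> v"
      then have e: "e \<in> E" by (simp add: incident_edges_def)
      show "(if v = term_vertex \<Gamma> e then c e + primitive (\<l> e) (z' e) (\<l> e) else - c e) = vertex_value \<Gamma> z e v"
        using rep[OF e, of 0] rep[OF e, of "\<l> e"] len_pos[OF e] by (simp add: vertex_value_def)
    qed
    also have "\<dots> = 0" using X v by (simp add: X_K_def)
    finally show "(\<Sum>e\<in>incident_edges \<Gamma> v. if v = term_vertex \<Gamma> e then c e + primitive (\<l> e) (z' e) (\<l> e) else - c e) = 0" .
  qed
  from assms[OF this] show "(case p of (z, z') \<Rightarrow> ereal \<bar>graph_integral \<Gamma> (\<lambda>e x. u e x * z' e x)\<bar>) \<le> K"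
    by (simp add: p)
qed

lemma TV_ge:
  assumes field: "kirchhoff_field \<Gamma> c g"
    and B: "\<And>e x. e \<in> E \<Longrightarrow> x \<in> {0<..<\<l> e} \<Longrightarrow> \<bar>g e x\<bar> \<le> B"
  shows "ereal \<bar>graph_integral \<Gamma> (\<lambda>e x. u e x * g e x)\<bar> \<le> TV \<Gamma> u"
proof -
  define z where "z e x = c e + primitive (\<l> e) (g e) x" for e x
  have z_eq: "z e = (\<lambda>x. c e + primitive (\<l> e) (g e) x)" for e
    by (simp add: z_def fun_eq_iff)
  have meas: "g e \<in> borel_measurable (leb (\<l> e))" if "e \<in> E" for e
    using field that by (auto simp: kirchhoff_field_def)
  have weak: "has_weak_derivative (\<l> e) (z e) (g e)" and W: "z e \<in> W1p_interval 2 (\<l> e)"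
    and rep: "x \<in> {0..\<l> e} \<Longrightarrow> continuous_rep (\<l> e) (z e) x = z e x" if "e \<in> E" for e x
    using primitive_has_weak_derivative[OF len_pos[OF that] meas[OF that] B[OF that], where c = "c e"]
    unfolding z_eq by auto
  have "z \<in> X_K \<Gamma>"
    unfolding X_K_def W1p_def
  proof (intro CollectI conjI ballI W)
    fix v assume v: "v \<in> vertices \<Gamma>"
    have "(\<Sum>e\<in>incident_edges \<Gamma> v. vertex_value \<Gamma> z e v) =
       (\<Sum>e\<in>incident_edges \<Gamma> v. if v = term_vertex \<Gamma> e then c e + primitive (\<l> e) (g e) (\<l> e) else - c e)"
    proof (rule sum.cong[OF refl])
      fix e assume "e \<in> incident_edges \<Gamma> v"
      then have e: "e \<in> E" by (simp add: incident_edges_def)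
      show "vertex_value \<Gamma> z e v = (if v = term_vertex \<Gamma> e then c e + primitive (\<l> e) (g e) (\<l> e) else - c e)"
        using rep[OF e, of 0] rep[OF e, of "\<l> e"] len_pos[OF e] by (simp add: vertex_value_def z_def)
    qed
    also have "\<dots> = 0" using field v by (simp add: kirchhoff_field_def)
    finally show "(\<Sum>e\<in>incident_edges \<Gamma> v. vertex_value \<Gamma> z e v) = 0" .
  qed
  moreover have "graph_weak_derivative \<Gamma> z g" using weak by (simp add: graph_weak_derivative_def)
  moreover have "Linf_norm \<Gamma> z \<le> 1"
    unfolding Linf_norm_def
  proof (rule SUP_least, rule esssup_I)
    fix e assume e: "e \<in> E"
    have "z e \<in> borel_measurable (leb (\<l> e))"
      using W[OF e] by (simp add: W1p_interval_def Lp_interval_def)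
    then show "(\<lambda>x. ereal \<bar>z e x\<bar>) \<in> borel_measurable (leb (\<l> e))" by measurable
    show "AE x in leb (\<l> e). ereal \<bar>z e x\<bar> \<le> 1"
      using field e by (intro AE_I2) (auto simp: kirchhoff_field_def z_def one_ereal_def)
  qed
  ultimately have "(z, g) \<in> {(z, z'). z \<in> X_K \<Gamma> \<and> graph_weak_derivative \<Gamma> z z' \<and> Linf_norm \<Gamma> z \<le> 1}" by simp
  then have "(case (z, g) of (z, z') \<Rightarrow> ereal \<bar>graph_integral \<Gamma> (\<lambda>e x. u e x * z' e x)\<bar>) \<le> TV \<Gamma> u"
    unfolding TV_def by (rule SUP_upper)
  then show ?thesis by simp
qed

text \<open>The derivative \<open>q\<close> has mean 0 on every cell, so its primitive vanishes at
  all grid nodes, both ends of each edge included, and the Kirchhoff condition is trivial. Since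
  averaging is self-adjoint, pairing \<open>u\<close> with \<open>q\<close> amounts to pairing its
  sign \<open>\<phi>\<close> with \<open>u\<close> minus its averages, which is the L^1
  distance.\<close>

lemma L1_dist_step_le:
  assumes N: "0 < N" and u: "\<And>e. e \<in> E \<Longrightarrow> integrable (leb (\<l> e)) (u e)" and TV: "TV \<Gamma> u \<le> ereal K"
  shows "L1_norm \<Gamma> (\<lambda>e x. u e x - cell_average N (\<l> e) (u e) (cell_index N (\<l> e) x)) \<le> 2 * total_length / N * K"
proof -
  define w where "w e x = cell_average N (\<l> e) (u e) (cell_index N (\<l> e) x)" for e x
  define \<phi> where "\<phi> e x = sgn (u e x - w e x)" for e x
  define p where "p e x = cell_average N (\<l> e) (\<phi> e) (cell_index N (\<l> e) x)" for e x
  define q where "q e x = \<phi> e x - p e x" for e x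
  \<comment> \<open>As \<open>q\<close> is bounded by 2 and its primitive vanishes at the left end
    of each cell, the primitive is at most 2 \<open>total_length\<close> / N; \<open>r\<close>
    scales this bound to 1. The total length stands in for all edge lengths to have one
    constant.\<close>
  define r where "r = real N / (2 * total_length)"
  have r: "0 < r" using N total_length_pos by (simp add: r_def)
  have w_int: "integrable (leb (\<l> e)) (w e)" and p_int: "integrable (leb (\<l> e)) (p e)" if "e \<in> E" for e
    unfolding w_def[abs_def] p_def[abs_def] using len_pos[OF that] N by (auto intro: integrable_step_function)
  have \<phi>_bound: "\<bar>\<phi> e x\<bar> \<le> 1" for e x by (simp add: \<phi>_def sgn_if)
  have \<phi>_int: "integrable (leb (\<l> e)) (\<phi> e)" if e: "e \<in> E" for e
  proof (rule integrable_leb_bounded)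
    have "(\<lambda>x. u e x - w e x) \<in> borel_measurable (leb (\<l> e))" using u[OF e] w_int[OF e] by simp
    then show "\<phi> e \<in> borel_measurable (leb (\<l> e))" unfolding \<phi>_def[abs_def] by measurable
  qed (rule \<phi>_bound)
  have p_bound: "\<bar>p e x\<bar> \<le> 1" if "e \<in> E" "x \<in> {0<..<\<l> e}" for e x
  proof -
    have "cell_index N (\<l> e) x < N" by (rule cell_index_less) (use that len_pos N in auto)
    then have "p e x \<in> {-1..1}"
      unfolding p_def using \<phi>_bound
      by (intro cell_average_bounds \<phi>_int that len_pos) (auto simp: abs_le_iff minus_le_iff)
    then show ?thesis by auto
  qed
  have q_int: "integrable (leb (\<l> e)) (q e)" if "e \<in> E" for e
    unfolding q_def[abs_def] using \<phi>_int[OF that] p_int[OF that] by simp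
  have q_meas: "q e \<in> borel_measurable (leb (\<l> e))" if "e \<in> E" for e
    using q_int[OF that] by simp
  have q_bound: "\<bar>q e x\<bar> \<le> 2" if "e \<in> E" "x \<in> {0<..<\<l> e}" for e x
    using p_bound[OF that] \<phi>_bound[of e x] by (simp add: q_def)
  have q_nodes: "primitive (\<l> e) (q e) (real i * \<l> e / real N) = 0" if e: "e \<in> E" and "i \<le> N" for e i
    using \<open>i \<le> N\<close>
  proof (induction i)
    case (Suc i)
    have "primitive (\<l> e) (q e) (real (Suc i) * \<l> e / real N) - primitive (\<l> e) (q e) (real i * \<l> e / real N) =
        (\<integral>x. indicator (cell N (\<l> e) i) x * q e x \<partial>leb (\<l> e))"
      by (rule integral_cell[OF len_pos[OF e] N q_int[OF e], symmetric])
    also have "\<dots> = (\<integral>x. indicator (cell N (\<l> e) i) x * \<phi> e x -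
        cell_average N (\<l> e) (\<phi> e) i * indicator (cell N (\<l> e) i) x \<partial>leb (\<l> e))"
      by (rule Bochner_Integration.integral_cong[OF refl])
        (use mem_cell_iff[OF len_pos[OF e] N] in \<open>auto simp: q_def p_def split: split_indicator\<close>)
    also have "\<dots> = (\<integral>x. indicator (cell N (\<l> e) i) x * \<phi> e x \<partial>leb (\<l> e)) -
        (\<integral>x. cell_average N (\<l> e) (\<phi> e) i * indicator (cell N (\<l> e) i) x \<partial>leb (\<l> e))"
    proof (rule Bochner_Integration.integral_diff)
      show "integrable (leb (\<l> e)) (\<lambda>x. cell_average N (\<l> e) (\<phi> e) i * indicator (cell N (\<l> e) i) x)"
        by (intro integrable_mult_right integrable_leb_bounded[where B=1] indicator_leb_measurable)
          (auto split: split_indicator)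
    qed (intro integrable_leb_indicator \<phi>_int[OF e], simp)
    also have "\<dots> = (\<integral>x. indicator (cell N (\<l> e) i) x * \<phi> e x \<partial>leb (\<l> e)) - cell_average N (\<l> e) (\<phi> e) i * (\<l> e / real N)"
      using integral_cell_const[OF len_pos[OF e], of i N] Suc.prems by simp
    also have "\<dots> = 0"
      using len_pos[OF e] N by (simp add: cell_average_def)
    finally show ?case using Suc by simp
  qed simp
  have prim_bound: "\<bar>primitive (\<l> e) (q e) x\<bar> \<le> 2 * total_length / N" if e: "e \<in> E" and x: "x \<in> {0..\<l> e}" for e x
  proof (cases "x < \<l> e")
    case True
    then have x': "x \<in> {0..<\<l> e}" using x by simp
    let ?i = "cell_index N (\<l> e) x"
    have "?i < N" by (rule cell_index_less) (use x' len_pos[OF e] N in auto)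
    then have "\<bar>primitive (\<l> e) (q e) x\<bar> \<le> 2 * (\<l> e / real N)"
      using primitive_within_cell[OF len_pos[OF e] N x' q_meas[OF e] q_bound[OF e]] q_nodes[OF e, of ?i] by simp
    also have "\<dots> \<le> 2 * (total_length / real N)"
      using len_le_total[OF e] N by (intro mult_left_mono divide_right_mono) auto
    finally show ?thesis by simp
  next
    case False
    then have "primitive (\<l> e) (q e) x = 0" using q_nodes[OF e, of N] N x by simp
    then show ?thesis using total_length_pos by simp
  qed
  have field: "kirchhoff_field \<Gamma> (\<lambda>_. 0) (\<lambda>e x. r * q e x)"
    unfolding kirchhoff_field_def primitive_mult
  proof (intro conjI ballI)
    show "integrable (leb (\<l> e)) (\<lambda>x. r * q e x)" if "e \<in> E" for e using q_int[OF that] by simp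
    show "\<bar>0 + r * primitive (\<l> e) (q e) x\<bar> \<le> 1" if "e \<in> E" "x \<in> {0..\<l> e}" for e x
    proof -
      have "\<bar>0 + r * primitive (\<l> e) (q e) x\<bar> = r * \<bar>primitive (\<l> e) (q e) x\<bar>" using r by (simp add: abs_mult)
      also have "\<dots> \<le> r * (2 * total_length / N)" using prim_bound[OF that] r by (intro mult_left_mono) auto
      also have "\<dots> = 1" using N total_length_pos by (simp add: r_def)
      finally show ?thesis .
    qed
    show "(\<Sum>e\<in>incident_edges \<Gamma> v. if v = term_vertex \<Gamma> e then 0 + r * primitive (\<l> e) (q e) (\<l> e) else - 0) = 0" for v
      by (rule sum.neutral) (use q_nodes[of _ N] N in \<open>auto simp: incident_edges_def\<close>)
  qed
  have bound: "\<bar>r * q e x\<bar> \<le> r * 2" if "e \<in> E" "x \<in> {0<..<\<l> e}" for e x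
    using q_bound[OF that] r by (simp add: abs_mult)
  have "ereal \<bar>graph_integral \<Gamma> (\<lambda>e x. u e x * (r * q e x))\<bar> \<le> ereal K"
    using TV_ge[OF field bound] TV by (rule order.trans)
  then have le: "\<bar>graph_integral \<Gamma> (\<lambda>e x. u e x * (r * q e x))\<bar> \<le> K" by simp
  have "graph_integral \<Gamma> (\<lambda>e x. u e x * (r * q e x)) = r * L1_norm \<Gamma> (\<lambda>e x. u e x - w e x)"
    unfolding L1_norm_def graph_integral_def sum_distrib_left
  proof (rule sum.cong[OF refl])
    fix e assume e: "e \<in> E"
    have mult: "integrable (leb (\<l> e)) (\<lambda>x. \<phi> e x * f x)" if "integrable (leb (\<l> e)) f" for f
      by (rule integrable_leb_mult_bounded[OF that _ \<phi>_bound]) (use \<phi>_int[OF e] in simp)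
    have int1: "integrable (leb (\<l> e)) (\<lambda>x. \<phi> e x * u e x)" "integrable (leb (\<l> e)) (\<lambda>x. \<phi> e x * w e x)"
      using mult u[OF e] w_int[OF e] by auto
    have int2: "integrable (leb (\<l> e)) (\<lambda>x. p e x * u e x)"
      unfolding p_def by (rule integrable_step_mult[OF len_pos[OF e] N u[OF e]])
    have self: "(\<integral>x. p e x * u e x \<partial>leb (\<l> e)) = (\<integral>x. \<phi> e x * w e x \<partial>leb (\<l> e))"
      using cell_average_self_adjoint[OF len_pos[OF e] N \<phi>_int[OF e] u[OF e]]
      by (simp add: p_def w_def mult.commute)
    have "(\<integral>x. u e x * (r * q e x) \<partial>leb (\<l> e)) = (\<integral>x. r * (\<phi> e x * u e x - p e x * u e x) \<partial>leb (\<l> e))"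
      by (rule Bochner_Integration.integral_cong) (auto simp: q_def algebra_simps)
    also have "\<dots> = r * ((\<integral>x. \<phi> e x * u e x \<partial>leb (\<l> e)) - (\<integral>x. \<phi> e x * w e x \<partial>leb (\<l> e)))"
      using int1 int2 self by simp
    also have "(\<integral>x. \<phi> e x * u e x \<partial>leb (\<l> e)) - (\<integral>x. \<phi> e x * w e x \<partial>leb (\<l> e)) =
        (\<integral>x. \<phi> e x * u e x - \<phi> e x * w e x \<partial>leb (\<l> e))"
      using int1 by simp
    also have "\<dots> = (\<integral>x. \<bar>u e x - w e x\<bar> \<partial>leb (\<l> e))"
      by (rule Bochner_Integration.integral_cong) (auto simp: \<phi>_def sgn_if abs_if)
    finally show "(\<integral>x. u e x * (r * q e x) \<partial>leb (\<l> e)) = r * (\<integral>x. \<bar>u e x - w e x\<bar> \<partial>leb (\<l> e))" .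
  qed
  with le have "r * L1_norm \<Gamma> (\<lambda>e x. u e x - w e x) \<le> K" by linarith
  then have "L1_norm \<Gamma> (\<lambda>e x. u e x - w e x) \<le> K / r"
    using r by (simp add: pos_le_divide_eq mult.commute)
  also have "K / r = 2 * total_length / N * K" by (simp add: r_def)
  finally show ?thesis by (simp add: w_def)
qed

section \<open>Grids on a metric graph\<close>

abbreviation cells :: "nat \<Rightarrow> ('e \<times> nat) set" where
  "cells N \<equiv> E \<times> {..<N}"

abbreviation half_cells :: "nat \<Rightarrow> (('e \<times> nat) \<times> bool) set" where
  "half_cells N \<equiv> cells N \<times> UNIV"

text \<open>The half \<open>(c, False)\<close> of a cell \<open>c\<close> is attached to its left end, \<open>(c, True)\<close> to its right end.\<close>

fun end_node :: "nat \<Rightarrow> ('e \<times> nat) \<times> bool \<Rightarrow> 'v + 'e \<times> nat" where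
  "end_node N ((e, i), False) = (if i = 0 then Inl (init_vertex \<Gamma> e) else Inr (e, i))"
| "end_node N ((e, i), True) = (if Suc i = N then Inl (term_vertex \<Gamma> e) else Inr (e, Suc i))"

text \<open>The perimeter of the union of the cells in \<open>U\<close>. An inner grid node between
  a cell of \<open>U\<close> and one outside costs 1; a vertex costs the minimum of the numbers of
  cell ends inside and outside.\<close>

definition cell_cut :: "nat \<Rightarrow> ('e \<times> nat) set \<Rightarrow> real" where
  "cell_cut N U = cut (end_node N) (half_cells N) (U \<times> UNIV)"

definition cells_length :: "nat \<Rightarrow> ('e \<times> nat) set \<Rightarrow> real" where
  "cells_length N U = (\<Sum>(e, i)\<in>U. \<l> e / N)"

definition cells_char :: "nat \<Rightarrow> ('e \<times> nat) set \<Rightarrow> 'e \<Rightarrow> real \<Rightarrow> real" where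
  "cells_char N U e x = indicator U (e, cell_index N (\<l> e) x)"

lemma finite_half_cells: "finite (half_cells N)"
  by simp

text \<open>Without loops, an edge at \<open>v\<close> has exactly one of its two extreme halves
  attached to \<open>v\<close>. Half cells at \<open>v\<close> thus correspond to incident edges,
  and cancellation of \<open>V\<close> at \<open>v\<close> is the Kirchhoff condition.\<close>

lemma half_cells_at_vertex:
  assumes "0 < N"
  shows "sum V {h \<in> half_cells N. end_node N h = Inl v} =
    (\<Sum>e\<in>incident_edges \<Gamma> v. if v = term_vertex \<Gamma> e then V ((e, N - 1), True) else V ((e, 0), False))"
proof -
  let ?f = "\<lambda>e. if v = term_vertex \<Gamma> e then ((e, N - 1), True) else ((e, 0), False)"
  have "{h \<in> half_cells N. end_node N h = Inl v} = ?f ` incident_edges \<Gamma> v"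
  proof (intro equalityI subsetI)
    fix h assume h: "h \<in> {h \<in> half_cells N. end_node N h = Inl v}"
    obtain e i b where heib: "h = ((e, i), b)" by (metis surj_pair)
    show "h \<in> ?f ` incident_edges \<Gamma> v"
    proof (cases b)
      case True
      then have "Suc i = N" "term_vertex \<Gamma> e = v" "e \<in> E" using h heib by (auto split: if_splits)
      then show ?thesis using heib True by (intro image_eqI[of _ _ e]) (auto simp: incident_edges_def)
    next
      case False
      then have "i = 0" "init_vertex \<Gamma> e = v" "e \<in> E" using h heib by (auto split: if_splits)
      then show ?thesis using heib False no_loop[of e]
        by (intro image_eqI[of _ _ e]) (auto simp: incident_edges_def)
    qed
  next
    fix h assume "h \<in> ?f ` incident_edges \<Gamma> v"
    then obtain e where "e \<in> incident_edges \<Gamma> v" "h = ?f e" by blast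
    then show "h \<in> {h \<in> half_cells N. end_node N h = Inl v}"
      using assms by (auto simp: incident_edges_def)
  qed
  moreover have "inj_on ?f (incident_edges \<Gamma> v)" by (auto simp: inj_on_def split: if_splits)
  then have "sum V (?f ` incident_edges \<Gamma> v) = (\<Sum>e\<in>incident_edges \<Gamma> v. V (?f e))"
    by (simp only: sum.reindex o_def)
  ultimately have "sum V {h \<in> half_cells N. end_node N h = Inl v} = (\<Sum>e\<in>incident_edges \<Gamma> v. V (?f e))"
    by (simp only:)
  also have "\<dots> = (\<Sum>e\<in>incident_edges \<Gamma> v. if v = term_vertex \<Gamma> e then V ((e, N - 1), True) else V ((e, 0), False))"
    by (rule sum.cong) auto
  finally show ?thesis .
qed

lemma half_cells_at_inner_node:
  assumes "e \<in> E" "Suc i < N"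
  shows "{h \<in> half_cells N. end_node N h = Inr (e, Suc i)} = {((e, i), True), ((e, Suc i), False)}"
proof (intro equalityI subsetI)
  fix h assume h: "h \<in> {h \<in> half_cells N. end_node N h = Inr (e, Suc i)}"
  obtain e' i' b where "h = ((e', i'), b)" by (metis surj_pair)
  with h show "h \<in> {((e, i), True), ((e, Suc i), False)}"
    by (cases b) (auto split: if_splits)
next
  fix h assume "h \<in> {((e, i), True), ((e, Suc i), False)}"
  then show "h \<in> {h \<in> half_cells N. end_node N h = Inr (e, Suc i)}" using assms by auto
qed

lemma end_node_cases:
  assumes "n \<in> end_node N ` half_cells N"
  obtains v where "v \<in> vertices \<Gamma>" "n = Inl v" | e i where "e \<in> E" "Suc i < N" "n = Inr (e, Suc i)"
proof -
  obtain e i b where h: "e \<in> E" "i < N" "n = end_node N ((e, i), b)" using assms by auto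
  show thesis
  proof (cases b)
    case True
    then show ?thesis using h that(1)[of "term_vertex \<Gamma> e"] that(2)[of e i] term_in[of e]
      by (cases "Suc i = N") auto
  next
    case False
    then show ?thesis using h that(1)[of "init_vertex \<Gamma> e"] that(2)[of e "i - 1"] init_in[of e]
      by (cases i) auto
  qed
qed

lemma sum_half_cells: "sum V (U \<times> UNIV) = (\<Sum>c\<in>U. V (c, False) + V (c, True))"
proof -
  have "sum V (U \<times> UNIV) = (\<Sum>c\<in>U. \<Sum>b\<in>UNIV. V (c, b))"
    using sum.cartesian_product[of "\<lambda>c b. V (c, b)" "UNIV :: bool set" U] by simp
  then show ?thesis by (simp add: UNIV_bool add.commute)
qed

lemma sum_cells: "(\<Sum>(e, i)\<in>cells N. f e i) = (\<Sum>e\<in>E. \<Sum>i<N. f e i)"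
  by (rule sum.cartesian_product[symmetric])

text \<open>On a union of cells only the node values of the field matter: each cell contributes the
  difference of its two end values. Regrouping these values by nodes instead of cells brings the
  pairing into the scope of \<open>sum_le_cut\<close>.\<close>

lemma cells_char_pairing_le:
  assumes N: "0 < N" and U: "U \<subseteq> cells N" and field: "kirchhoff_field \<Gamma> c g"
  shows "\<bar>graph_integral \<Gamma> (\<lambda>e x. cells_char N U e x * g e x)\<bar> \<le> cell_cut N U"
proof -
  from field have int: "\<And>e. e \<in> E \<Longrightarrow> integrable (leb (\<l> e)) (g e)"
    and bound: "\<And>e x. e \<in> E \<Longrightarrow> x \<in> {0..\<l> e} \<Longrightarrow> \<bar>c e + primitive (\<l> e) (g e) x\<bar> \<le> 1"
    and K: "\<And>v. v \<in> vertices \<Gamma> \<Longrightarrow> (\<Sum>e\<in>incident_edges \<Gamma> v.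
        if v = term_vertex \<Gamma> e then c e + primitive (\<l> e) (g e) (\<l> e) else - c e) = 0"
    by (auto simp: kirchhoff_field_def)
  define Z where "Z e i = c e + primitive (\<l> e) (g e) (real i * \<l> e / real N)" for e i
  \<comment> \<open>Outward flux of a cell through each of its ends. The two halves at an inner node
    carry the same value with opposite signs, so they cancel.\<close>
  define V where "V h = (case h of ((e, i), b) \<Rightarrow> if b then Z e (Suc i) else - Z e i)" for h
  have Z_bound: "\<bar>Z e i\<bar> \<le> 1" if "e \<in> E" "i \<le> N" for e i
  proof -
    have "real i * \<l> e \<le> real N * \<l> e" using that len_pos[of e] by (intro mult_right_mono) auto
    then have "real i * \<l> e / real N \<in> {0..\<l> e}" using N len_pos[of e] that by (simp add: field_simps)
    then show ?thesis using bound that by (simp add: Z_def)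
  qed
  have "graph_integral \<Gamma> (\<lambda>e x. cells_char N U e x * g e x) =
      (\<Sum>e\<in>E. \<Sum>i<N. indicator U (e, i) * (Z e (Suc i) - Z e i))"
    unfolding graph_integral_def
  proof (rule sum.cong[OF refl])
    fix e assume e: "e \<in> E"
    show "(\<integral>x. cells_char N U e x * g e x \<partial>leb (\<l> e)) = (\<Sum>i<N. indicator U (e, i) * (Z e (Suc i) - Z e i))"
      unfolding cells_char_def
      using integral_step_mult[OF len_pos[OF e] N int[OF e], of "\<lambda>i. indicator U (e, i)"]
        integral_cell[OF len_pos[OF e] N int[OF e]]
      by (simp add: Z_def del: of_nat_Suc)
  qed
  also have "\<dots> = (\<Sum>(e, i)\<in>cells N. indicator U (e, i) * (Z e (Suc i) - Z e i))"
    by (rule sum_cells[symmetric])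
  also have "\<dots> = (\<Sum>h\<in>cells N. if h \<in> U then V (h, False) + V (h, True) else 0)"
    by (rule sum.cong) (auto simp: V_def)
  also have "\<dots> = sum V (U \<times> UNIV)"
    unfolding sum_half_cells using U by (simp add: sum.If_cases Int_absorb1)
  finally have eq: "graph_integral \<Gamma> (\<lambda>e x. cells_char N U e x * g e x) = sum V (U \<times> UNIV)" .
  have "\<bar>sum V (U \<times> UNIV)\<bar> \<le> cell_cut N U"
    unfolding cell_cut_def
  proof (rule sum_le_cut[OF finite_half_cells])
    show "U \<times> UNIV \<subseteq> half_cells N" using U by auto
    show "\<bar>V h\<bar> \<le> 1" if "h \<in> half_cells N" for h
      using that by (auto simp: V_def intro!: Z_bound)
    fix n assume "n \<in> end_node N ` half_cells N"
    then show "sum V {h \<in> half_cells N. end_node N h = n} = 0"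
    proof (cases rule: end_node_cases)
      case (1 v)
      have "sum V {h \<in> half_cells N. end_node N h = n} =
          (\<Sum>e\<in>incident_edges \<Gamma> v. if v = term_vertex \<Gamma> e then V ((e, N - 1), True) else V ((e, 0), False))"
        unfolding 1(2) by (rule half_cells_at_vertex[OF N])
      also have "\<dots> = (\<Sum>e\<in>incident_edges \<Gamma> v.
          if v = term_vertex \<Gamma> e then c e + primitive (\<l> e) (g e) (\<l> e) else - c e)"
        using N by (intro sum.cong refl) (simp add: V_def Z_def)
      finally show ?thesis using K[OF 1(1)] by simp
    next
      case (2 e i)
      then show ?thesis
        unfolding 2(3) half_cells_at_inner_node[OF 2(1,2)] by (simp add: V_def)
    qed
  qed
  then show ?thesis by (simp add: eq)
qed

lemma TV_cells_char_le:
  assumes "0 < N" "U \<subseteq> cells N"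
  shows "TV \<Gamma> (cells_char N U) \<le> ereal (cell_cut N U)"
  using cells_char_pairing_le[OF assms] by (intro TV_leI) simp

text \<open>The discrete flux \<open>V\<close> is realized by an interpolated field. Its derivative
  is constant on cells, so the pairing with any \<open>u\<close> sees only the cell averages of
  \<open>u\<close>; this is how passing to averages costs nothing.\<close>

lemma calibrating_field:
  fixes w :: "'e \<times> nat \<Rightarrow> real"
  assumes N: "0 < N"
  obtains c g B and \<delta> :: "'e \<times> nat \<Rightarrow> real" where "kirchhoff_field \<Gamma> c g"
    "\<And>e x. e \<in> E \<Longrightarrow> x \<in> {0<..<\<l> e} \<Longrightarrow> \<bar>g e x\<bar> \<le> B"
    "\<And>u. (\<And>e. e \<in> E \<Longrightarrow> integrable (leb (\<l> e)) (u e)) \<Longrightarrow> graph_integral \<Gamma> (\<lambda>e x. u e x * g e x) =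
       (\<Sum>(e, i)\<in>cells N. cell_average N (\<l> e) (u e) i * \<delta> (e, i))"
    "\<And>U. U \<subseteq> cells N \<Longrightarrow> (\<And>x y. x \<in> U \<Longrightarrow> y \<in> cells N \<Longrightarrow> w x \<le> w y \<Longrightarrow> y \<in> U) \<Longrightarrow> sum \<delta> U = cell_cut N U"
proof -
  obtain V :: "('e \<times> nat) \<times> bool \<Rightarrow> real" where V_bound: "\<And>h. h \<in> half_cells N \<Longrightarrow> \<bar>V h\<bar> \<le> 1"
    and V_node: "\<And>n. sum V {h \<in> half_cells N. end_node N h = n} = 0"
    and V_cut: "\<And>U. U \<subseteq> half_cells N \<Longrightarrow>
      (\<And>x y. x \<in> U \<Longrightarrow> y \<in> half_cells N \<Longrightarrow> w (fst x) \<le> w (fst y) \<Longrightarrow> y \<in> U) \<Longrightarrow>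
      sum V U = cut (end_node N) (half_cells N) U"
    using calibration[OF finite_half_cells, where w = "\<lambda>h. w (fst h)" and node = "end_node N"] by blast
  \<comment> \<open>Net outward flux of the cell \<open>c\<close>.\<close>
  define \<delta> where "\<delta> c = V (c, False) + V (c, True)" for c
  \<comment> \<open>The value at node \<open>i\<close> is read off from the cell to its right. Node
    \<open>N\<close> has no such cell and takes the outward flux of the last one; at inner nodes
    both readings agree, since \<open>V\<close> cancels there.\<close>
  define y where "y e i = (if i < N then - V ((e, i), False) else V ((e, N - 1), True))" for e i
  define g where "g e x = real N / \<l> e * \<delta> (e, cell_index N (\<l> e) x)" for e x
  have \<delta>_y: "\<delta> (e, i) = y e (Suc i) - y e i" if e: "e \<in> E" and i: "i < N" for e i
  proof (cases "Suc i < N")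
    case True
    have "V ((e, i), True) + V ((e, Suc i), False) = 0"
      using V_node[of "Inr (e, Suc i)"] unfolding half_cells_at_inner_node[OF e True] by simp
    then show ?thesis using True i by (simp add: \<delta>_def y_def)
  next
    case False
    then have "Suc i = N" using i by simp
    then show ?thesis by (auto simp: \<delta>_def y_def)
  qed
  have y_bound: "\<bar>y e i\<bar> \<le> 1" if "e \<in> E" for e i
    using that N V_bound[of "((e, i), False)"] V_bound[of "((e, N - 1), True)"] by (auto simp: y_def)
  have g_step: "g e = (\<lambda>x. (\<lambda>i. real N / \<l> e * \<delta> (e, i)) (cell_index N (\<l> e) x))" for e
    by (simp add: g_def fun_eq_iff)
  have nodes: "y e 0 + primitive (\<l> e) (g e) (real i * \<l> e / real N) = y e i" if "e \<in> E" "i \<le> N" for e i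
    unfolding g_step
    by (rule primitive_step_function(1)[OF len_pos[OF that(1)] N _ that(2)]) (rule \<delta>_y[OF that(1)])
  have field: "kirchhoff_field \<Gamma> (\<lambda>e. y e 0) g"
    unfolding kirchhoff_field_def
  proof (intro conjI ballI)
    fix e assume e: "e \<in> E"
    show "integrable (leb (\<l> e)) (g e)"
      unfolding g_step using len_pos[OF e] N by (rule integrable_step_function)
    fix x assume x: "x \<in> {0..\<l> e}"
    obtain i t where "t \<in> {0..1}" and eq: "y e 0 + primitive (\<l> e) (g e) x = (1 - t) * y e i + t * y e (Suc i)"
      unfolding g_step
      using primitive_step_function(2)[where d = "\<lambda>i. \<delta> (e, i)" and y = "y e", OF len_pos[OF e] N \<delta>_y[OF e] x] by blast
    have "\<bar>(1 - t) * y e i + t * y e (Suc i)\<bar> \<le> (1 - t) * \<bar>y e i\<bar> + t * \<bar>y e (Suc i)\<bar>"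
      using \<open>t \<in> {0..1}\<close> by (intro order.trans[OF abs_triangle_ineq]) (simp add: abs_mult)
    also have "\<dots> \<le> (1 - t) * 1 + t * 1"
      using \<open>t \<in> {0..1}\<close> y_bound[OF e] by (intro add_mono mult_left_mono) auto
    finally show "\<bar>y e 0 + primitive (\<l> e) (g e) x\<bar> \<le> 1" unfolding eq by simp
  next
    fix v assume "v \<in> vertices \<Gamma>"
    have "(\<Sum>e\<in>incident_edges \<Gamma> v. if v = term_vertex \<Gamma> e then y e 0 + primitive (\<l> e) (g e) (\<l> e) else - y e 0) =
        (\<Sum>e\<in>incident_edges \<Gamma> v. if v = term_vertex \<Gamma> e then V ((e, N - 1), True) else V ((e, 0), False))"
      using N nodes[of _ N] by (intro sum.cong refl) (auto simp: y_def incident_edges_def)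
    also have "\<dots> = sum V {h \<in> half_cells N. end_node N h = Inl v}"
      by (rule half_cells_at_vertex[OF N, symmetric])
    also have "\<dots> = 0" by (rule V_node)
    finally show "(\<Sum>e\<in>incident_edges \<Gamma> v. if v = term_vertex \<Gamma> e then y e 0 + primitive (\<l> e) (g e) (\<l> e) else - y e 0) = 0" .
  qed
  define B where "B = (\<Sum>e\<in>E. \<Sum>i<N. \<bar>real N / \<l> e * \<delta> (e, i)\<bar>)"
  have g_bound: "\<bar>g e x\<bar> \<le> B" if e: "e \<in> E" and x: "x \<in> {0<..<\<l> e}" for e x
  proof -
    have "\<bar>g e x\<bar> \<le> (\<Sum>i<N. \<bar>real N / \<l> e * \<delta> (e, i)\<bar>)"
      unfolding g_step by (rule step_function_bounded[OF len_pos[OF e] N x])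
    also have "\<dots> \<le> B" unfolding B_def using e by (intro member_le_sum sum_nonneg) auto
    finally show ?thesis .
  qed
  have pairing: "graph_integral \<Gamma> (\<lambda>e x. u e x * g e x) =
       (\<Sum>(e, i)\<in>cells N. cell_average N (\<l> e) (u e) i * \<delta> (e, i))"
    if u: "\<And>e. e \<in> E \<Longrightarrow> integrable (leb (\<l> e)) (u e)" for u
    unfolding sum_cells graph_integral_def
  proof (rule sum.cong[OF refl])
    fix e assume e: "e \<in> E"
    have "(\<integral>x. u e x * g e x \<partial>leb (\<l> e)) = (\<integral>x. (\<lambda>i. real N / \<l> e * \<delta> (e, i)) (cell_index N (\<l> e) x) * u e x \<partial>leb (\<l> e))"
      by (simp add: g_def mult.commute)
    also have "\<dots> = (\<Sum>i<N. real N / \<l> e * \<delta> (e, i) * (\<integral>x. indicator (cell N (\<l> e) i) x * u e x \<partial>leb (\<l> e)))"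
      by (rule integral_step_mult[OF len_pos[OF e] N u[OF e]])
    also have "\<dots> = (\<Sum>i<N. cell_average N (\<l> e) (u e) i * \<delta> (e, i))"
      by (rule sum.cong) (auto simp: cell_average_def)
    finally show "(\<integral>x. u e x * g e x \<partial>leb (\<l> e)) = (\<Sum>i<N. cell_average N (\<l> e) (u e) i * \<delta> (e, i))" .
  qed
  have \<delta>_cut: "sum \<delta> U = cell_cut N U"
    if "U \<subseteq> cells N" "\<And>x y. x \<in> U \<Longrightarrow> y \<in> cells N \<Longrightarrow> w x \<le> w y \<Longrightarrow> y \<in> U" for U
  proof -
    have "sum V (U \<times> UNIV) = cell_cut N U"
      unfolding cell_cut_def by (rule V_cut) (use that in auto)
    then show ?thesis by (simp add: sum_half_cells \<delta>_def)
  qed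
  show ?thesis by (rule that[OF field g_bound pairing \<delta>_cut]) auto
qed

section \<open>The discrete Cheeger inequality\<close>

lemma cell_cut_compl: "U \<subseteq> cells N \<Longrightarrow> cell_cut N (cells N - U) = cell_cut N U"
proof -
  have "(cells N - U) \<times> UNIV = half_cells N - U \<times> (UNIV :: bool set)" by auto
  then show ?thesis unfolding cell_cut_def by (simp only: cut_compl)
qed

lemma cell_cut_all: "cell_cut N (cells N) = 0"
  using cell_cut_compl[of "{}" N] by (simp add: cell_cut_def)

lemma cells_length_all: "0 < N \<Longrightarrow> cells_length N (cells N) = total_length"
  unfolding cells_length_def sum_cells total_length_def by simp

lemma cells_length_mono: "U \<subseteq> U' \<Longrightarrow> U' \<subseteq> cells N \<Longrightarrow> cells_length N U \<le> cells_length N U'"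
  unfolding cells_length_def
  by (rule sum_mono2) (use len_pos in \<open>force intro: finite_subset[of _ "cells N"] divide_nonneg_nonneg less_imp_le\<close>)+

text \<open>The field is calibrated for the averages \<open>w\<close> of \<open>u\<close>, and
  \<open>w\<close> is split at a weighted median \<open>m\<close>. The level sets above and below
  \<open>m\<close> have at most half the length, so \<open>h\<close> applies to each of them, and
  the layer-cake argument sums the results. The value \<open>m\<close> is left open because the
  averages need not have median 0.\<close>

lemma discrete_Cheeger_inequality:
  assumes N: "0 < N" and u: "\<And>e. e \<in> E \<Longrightarrow> integrable (leb (\<l> e)) (u e)" and TV: "TV \<Gamma> u \<le> ereal K"
    and h: "\<And>U. U \<subseteq> cells N \<Longrightarrow> cells_length N U \<le> total_length / 2 \<Longrightarrow> h * cells_length N U \<le> cell_cut N U"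
  obtains m where
    "h * L1_norm \<Gamma> (\<lambda>e x. cell_average N (\<l> e) (u e) (cell_index N (\<l> e) x) - m) \<le> K"
proof -
  let ?C = "cells N"
  define w where "w = (\<lambda>(e, i). cell_average N (\<l> e) (u e) i)"
  define a where "a = (\<lambda>(e, i :: nat). \<l> e / N)"
  have finC: "finite ?C" by simp
  have len_a: "cells_length N U = sum a U" for U by (simp add: cells_length_def a_def)
  obtain c g B and \<delta> :: "'e \<times> nat \<Rightarrow> real" where field: "kirchhoff_field \<Gamma> c g"
    and B: "\<And>e x. e \<in> E \<Longrightarrow> x \<in> {0<..<\<l> e} \<Longrightarrow> \<bar>g e x\<bar> \<le> B"
    and pairing: "\<And>u. (\<And>e. e \<in> E \<Longrightarrow> integrable (leb (\<l> e)) (u e)) \<Longrightarrow> graph_integral \<Gamma> (\<lambda>e x. u e x * g e x) =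
       (\<Sum>(e, i)\<in>cells N. cell_average N (\<l> e) (u e) i * \<delta> (e, i))"
    and \<delta>_cut: "\<And>U. U \<subseteq> cells N \<Longrightarrow> (\<And>x y. x \<in> U \<Longrightarrow> y \<in> cells N \<Longrightarrow> w x \<le> w y \<Longrightarrow> y \<in> U) \<Longrightarrow> sum \<delta> U = cell_cut N U"
    using calibrating_field[OF N, of w] by blast
  have "?C \<noteq> {}" using E_nonempty N by auto
  moreover have "0 \<le> a x" if "x \<in> ?C" for x using that len_pos by (auto simp: a_def less_imp_le)
  ultimately obtain m where m: "sum a {x \<in> ?C. m < w x} \<le> sum a ?C / 2" "sum a {x \<in> ?C. w x < m} \<le> sum a ?C / 2"
    using weighted_median_exists[OF finC, of a w] by blast
  have total: "sum a ?C = total_length" using cells_length_all[OF N] len_a by simp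
  have "sum \<delta> ?C = 0" using \<delta>_cut[of ?C] cell_cut_all by simp
  have up: "0 \<le> (\<Sum>x\<in>?C. max 0 (w x - m) * (\<delta> x - h * a x))"
  proof (rule layer_cake_nonneg[OF finC])
    fix t :: real assume "0 \<le> t"
    let ?U = "{x \<in> ?C. t < w x - m}"
    have "cells_length N ?U \<le> cells_length N {x \<in> ?C. m < w x}"
      by (rule cells_length_mono) (use \<open>0 \<le> t\<close> in auto)
    then have "h * cells_length N ?U \<le> cell_cut N ?U"
      using m(1) total by (intro h) (auto simp: len_a)
    moreover have "sum \<delta> ?U = cell_cut N ?U" by (rule \<delta>_cut) auto
    ultimately show "0 \<le> (\<Sum>x\<in>?U. \<delta> x - h * a x)"
      by (simp add: sum_subtractf len_a sum_distrib_left)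
  qed
  have down: "0 \<le> (\<Sum>x\<in>?C. max 0 (m - w x) * (- \<delta> x - h * a x))"
  proof (rule layer_cake_nonneg[OF finC])
    fix t :: real assume "0 \<le> t"
    let ?U = "{x \<in> ?C. t < m - w x}"
    have "cells_length N ?U \<le> cells_length N {x \<in> ?C. w x < m}"
      by (rule cells_length_mono) (use \<open>0 \<le> t\<close> in auto)
    then have "h * cells_length N ?U \<le> cell_cut N ?U"
      using m(2) total by (intro h) (auto simp: len_a)
    moreover have "sum \<delta> (?C - ?U) = cell_cut N (?C - ?U)" by (rule \<delta>_cut) auto
    \<comment> \<open>The calibration covers upper sets only. A set below the median is reached
      through its complement, which has the same cut and, as the total flux is 0, the opposite
      flux.\<close>
    moreover have "sum \<delta> (?C - ?U) + sum \<delta> ?U = 0"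
      using \<open>sum \<delta> ?C = 0\<close> sum.subset_diff[of ?U ?C \<delta>] finC by auto
    ultimately show "0 \<le> (\<Sum>x\<in>?U. - \<delta> x - h * a x)"
      using cell_cut_compl[of ?U N] by (simp add: sum_subtractf sum_negf len_a sum_distrib_left)
  qed
  \<comment> \<open>Splits \<open>w x\<close> into \<open>m\<close> and the positive and negative
    parts of \<open>w x - m\<close>. The \<open>h\<close> terms are added and subtracted to fit
    \<open>layer_cake_nonneg\<close>, and the last term sums to 0.\<close>
  have split: "w x * \<delta> x = max 0 (w x - m) * (\<delta> x - h * a x) + max 0 (m - w x) * (- \<delta> x - h * a x) +
      h * (\<bar>w x - m\<bar> * a x) + m * \<delta> x" for x
    by (auto simp: max_def abs_if algebra_simps)
  have "(\<Sum>x\<in>?C. w x * \<delta> x) = (\<Sum>x\<in>?C. max 0 (w x - m) * (\<delta> x - h * a x)) +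
      (\<Sum>x\<in>?C. max 0 (m - w x) * (- \<delta> x - h * a x)) + h * (\<Sum>x\<in>?C. \<bar>w x - m\<bar> * a x) + m * sum \<delta> ?C"
    by (subst split) (simp only: sum.distrib sum_distrib_left)
  then have "h * (\<Sum>x\<in>?C. \<bar>w x - m\<bar> * a x) \<le> (\<Sum>x\<in>?C. w x * \<delta> x)"
    using up down \<open>sum \<delta> ?C = 0\<close> by simp
  also have "\<dots> = graph_integral \<Gamma> (\<lambda>e x. u e x * g e x)"
    by (subst pairing, rule u, assumption) (rule sum.cong, auto simp: w_def)
  also have "\<dots> \<le> K"
  proof -
    have "ereal \<bar>graph_integral \<Gamma> (\<lambda>e x. u e x * g e x)\<bar> \<le> ereal K"
      using TV_ge[OF field B] TV by (rule order.trans)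
    then show ?thesis by simp
  qed
  also have "(\<Sum>x\<in>?C. \<bar>w x - m\<bar> * a x) =
      L1_norm \<Gamma> (\<lambda>e x. cell_average N (\<l> e) (u e) (cell_index N (\<l> e) x) - m)"
  proof -
    have "(\<Sum>x\<in>?C. \<bar>w x - m\<bar> * a x) = (\<Sum>(e, i)\<in>?C. \<bar>cell_average N (\<l> e) (u e) i - m\<bar> * (\<l> e / N))"
      by (rule sum.cong) (auto simp: w_def a_def)
    also have "\<dots> = L1_norm \<Gamma> (\<lambda>e x. cell_average N (\<l> e) (u e) (cell_index N (\<l> e) x) - m)"
      unfolding sum_cells L1_norm_def graph_integral_def
      by (rule sum.cong[OF refl], rule integral_step[symmetric, where w = "\<lambda>i. \<bar>cell_average N _ (u _) i - m\<bar>"])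
        (use len_pos N in auto)
    finally show ?thesis .
  qed
  finally show ?thesis by (rule that)
qed

section \<open>Medians, the L^1 norm and the mesh error\<close>

lemma graph_length_eq: "graph_length \<Gamma> S = (\<Sum>e\<in>E. \<integral>x. indicator {x. (e, x) \<in> S} x \<partial>leb (\<l> e))"
  unfolding graph_length_def graph_integral_def chi_def
  by (intro sum.cong Bochner_Integration.integral_cong refl) (auto simp: indicator_def)

lemma integral_leb_const: "0 \<le> l \<Longrightarrow> (\<integral>x. c \<partial>leb l) = c * l"
  by (simp add: measure_leb)

lemma graph_length_points: "graph_length \<Gamma> (points \<Gamma>) = total_length"
  unfolding graph_length_def graph_integral_def total_length_def
proof (rule sum.cong[OF refl])
  fix e assume e: "e \<in> E"
  have "(\<integral>x. chi (points \<Gamma>) e x \<partial>leb (\<l> e)) = (\<integral>x. 1 \<partial>leb (\<l> e))"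
    by (rule Bochner_Integration.integral_cong) (use e in \<open>auto simp: chi_def points_def\<close>)
  then show "(\<integral>x. chi (points \<Gamma>) e x \<partial>leb (\<l> e)) = \<l> e"
    using integral_leb_const[of "\<l> e" 1] len_pos[OF e] by simp
qed

text \<open>A median minimizes the L^1 distance to constants. Moving from 0 to \<open>m\<close>
  costs at most |m| on the set \<open>P\<close> where \<open>u\<close> lies strictly on the side of
  \<open>m\<close>, and gains |m| elsewhere; \<open>P\<close> has at most half the length.\<close>

lemma L1_norm_median:
  assumes u: "\<And>e. e \<in> E \<Longrightarrow> integrable (leb (\<l> e)) (u e)" and med: "0 \<in> medians \<Gamma> u"
  shows "L1_norm \<Gamma> u \<le> L1_norm \<Gamma> (\<lambda>e x. u e x - m)"
proof -
  define P where "P e = (if 0 \<le> m then {x. 0 < u e x} else {x. u e x < 0})" for e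
  let ?I = "\<lambda>e. indicator (P e) :: real \<Rightarrow> real"
  have "(\<Sum>e\<in>E. \<integral>x. ?I e x \<partial>leb (\<l> e)) = graph_length \<Gamma> (if 0 \<le> m then {(e, x) \<in> points \<Gamma>. u e x > 0} else {(e, x) \<in> points \<Gamma>. u e x < 0})"
    unfolding graph_length_eq
    by (intro sum.cong Bochner_Integration.integral_cong refl) (auto simp: P_def points_def indicator_def)
  also have "\<dots> \<le> total_length / 2"
    using med graph_length_points by (simp add: medians_def)
  finally have half: "(\<Sum>e\<in>E. \<integral>x. ?I e x \<partial>leb (\<l> e)) \<le> total_length / 2" .
  have I_int: "integrable (leb (\<l> e)) (?I e)" if e: "e \<in> E" for e
  proof (rule integrable_leb_bounded)
    have [measurable]: "u e \<in> borel_measurable (leb (\<l> e))" using u[OF e] by simp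
    have "(\<lambda>x. if 0 \<le> m then indicator {0<..} (u e x) else indicator {..<0} (u e x) :: real) \<in> borel_measurable (leb (\<l> e))"
      by measurable
    moreover have "?I e = (\<lambda>x. if 0 \<le> m then indicator {0<..} (u e x) else indicator {..<0} (u e x))"
      by (auto simp: P_def fun_eq_iff indicator_def)
    ultimately show "?I e \<in> borel_measurable (leb (\<l> e))" by simp
    show "\<bar>?I e x\<bar> \<le> 1" for x by (auto split: split_indicator)
  qed
  have one: "integrable (leb l) (\<lambda>_. 1 :: real)" for l by (rule integrable_leb_bounded[where B=1]) auto
  have const: "integrable (leb l) (\<lambda>_. c :: real)" for l c by (rule integrable_leb_bounded[where B="\<bar>c\<bar>"]) auto
  have "(\<integral>x. \<bar>u e x\<bar> \<partial>leb (\<l> e)) + \<bar>m\<bar> * (\<l> e - 2 * (\<integral>x. ?I e x \<partial>leb (\<l> e))) \<le> (\<integral>x. \<bar>u e x - m\<bar> \<partial>leb (\<l> e))"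
    if e: "e \<in> E" for e
  proof -
    have int: "integrable (leb (\<l> e)) (\<lambda>x. \<bar>u e x\<bar>)" "integrable (leb (\<l> e)) (\<lambda>x. \<bar>m\<bar> * (1 - 2 * ?I e x))"
      using u[OF e] I_int[OF e] one by auto
    have eq: "(\<integral>x. \<bar>m\<bar> * (1 - 2 * ?I e x) \<partial>leb (\<l> e)) = \<bar>m\<bar> * ((\<integral>x. 1 \<partial>leb (\<l> e)) - 2 * (\<integral>x. ?I e x \<partial>leb (\<l> e)))"
      unfolding integral_mult_right_zero
        Bochner_Integration.integral_diff[OF one integrable_mult_right[OF I_int[OF e], of 2]] by simp
    have one_len: "(\<integral>x. 1 \<partial>leb (\<l> e)) = \<l> e" using integral_leb_const[of "\<l> e" 1] len_pos[OF e] by simp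
    have "(\<integral>x. \<bar>u e x\<bar> \<partial>leb (\<l> e)) + \<bar>m\<bar> * (\<l> e - 2 * (\<integral>x. ?I e x \<partial>leb (\<l> e))) =
        (\<integral>x. \<bar>u e x\<bar> + \<bar>m\<bar> * (1 - 2 * ?I e x) \<partial>leb (\<l> e))"
      unfolding Bochner_Integration.integral_add[OF int] eq one_len ..
    also have "\<dots> \<le> (\<integral>x. \<bar>u e x - m\<bar> \<partial>leb (\<l> e))"
    proof (rule integral_mono)
      show "integrable (leb (\<l> e)) (\<lambda>x. \<bar>u e x\<bar> + \<bar>m\<bar> * (1 - 2 * ?I e x))" using int by (rule Bochner_Integration.integrable_add)
      show "integrable (leb (\<l> e)) (\<lambda>x. \<bar>u e x - m\<bar>)" using u[OF e] const by (intro integrable_abs Bochner_Integration.integrable_diff)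
    qed (auto simp: P_def abs_if indicator_def)
    finally show ?thesis .
  qed
  then have "(\<Sum>e\<in>E. (\<integral>x. \<bar>u e x\<bar> \<partial>leb (\<l> e)) + \<bar>m\<bar> * (\<l> e - 2 * (\<integral>x. ?I e x \<partial>leb (\<l> e)))) \<le> L1_norm \<Gamma> (\<lambda>e x. u e x - m)"
    unfolding L1_norm_def graph_integral_def by (rule sum_mono)
  moreover have "(\<Sum>e\<in>E. (\<integral>x. \<bar>u e x\<bar> \<partial>leb (\<l> e)) + \<bar>m\<bar> * (\<l> e - 2 * (\<integral>x. ?I e x \<partial>leb (\<l> e)))) =
      L1_norm \<Gamma> u + \<bar>m\<bar> * (total_length - 2 * (\<Sum>e\<in>E. \<integral>x. ?I e x \<partial>leb (\<l> e)))"
    by (simp only: sum.distrib sum_subtractf sum_distrib_left[symmetric] total_length_def L1_norm_def graph_integral_def)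
  moreover have "0 \<le> \<bar>m\<bar> * (total_length - 2 * (\<Sum>e\<in>E. \<integral>x. ?I e x \<partial>leb (\<l> e)))"
    using half by (intro mult_nonneg_nonneg) auto
  ultimately show ?thesis by linarith
qed

lemma L1_norm_triangle:
  assumes "\<And>e. e \<in> E \<Longrightarrow> integrable (leb (\<l> e)) (u e)" "\<And>e. e \<in> E \<Longrightarrow> integrable (leb (\<l> e)) (v e)"
  shows "L1_norm \<Gamma> (\<lambda>e x. u e x + v e x) \<le> L1_norm \<Gamma> u + L1_norm \<Gamma> v"
  unfolding L1_norm_def graph_integral_def sum.distrib[symmetric]
proof (rule sum_mono)
  fix e assume e: "e \<in> E"
  have "(\<integral>x. \<bar>u e x + v e x\<bar> \<partial>leb (\<l> e)) \<le> (\<integral>x. \<bar>u e x\<bar> + \<bar>v e x\<bar> \<partial>leb (\<l> e))"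
    using assms[OF e] by (intro integral_mono integrable_abs Bochner_Integration.integrable_add) auto
  then show "(\<integral>x. \<bar>u e x + v e x\<bar> \<partial>leb (\<l> e)) \<le> (\<integral>x. \<bar>u e x\<bar> \<partial>leb (\<l> e)) + (\<integral>x. \<bar>v e x\<bar> \<partial>leb (\<l> e))"
    using assms[OF e] by simp
qed

text \<open>\<open>L1_norm_median\<close> is applied to \<open>u\<close> itself, which trades its
  median 0 for the unknown median \<open>m\<close> of the averages; the triangle inequality then
  leaves only the averaging error.\<close>

lemma Cheeger_inequality_up_to_mesh:
  assumes N: "0 < N" and u: "\<And>e. e \<in> E \<Longrightarrow> integrable (leb (\<l> e)) (u e)" and TV: "TV \<Gamma> u \<le> ereal K"
    and med: "0 \<in> medians \<Gamma> u" and h0: "0 \<le> h"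
    and h: "\<And>U. U \<subseteq> cells N \<Longrightarrow> cells_length N U \<le> total_length / 2 \<Longrightarrow> h * cells_length N U \<le> cell_cut N U"
  shows "h * (L1_norm \<Gamma> u - 2 * total_length / N * K) \<le> K"
proof -
  let ?w = "\<lambda>e x. cell_average N (\<l> e) (u e) (cell_index N (\<l> e) x)"
  obtain m where m: "h * L1_norm \<Gamma> (\<lambda>e x. ?w e x - m) \<le> K"
    using discrete_Cheeger_inequality[OF N u TV h] by blast
  have const: "integrable (leb l) (\<lambda>_. c :: real)" for l c by (rule integrable_leb_bounded[where B="\<bar>c\<bar>"]) auto
  have w_int: "integrable (leb (\<l> e)) (?w e)" if "e \<in> E" for e
    using len_pos[OF that] N by (rule integrable_step_function)
  have "L1_norm \<Gamma> u \<le> L1_norm \<Gamma> (\<lambda>e x. u e x - m)" using u med by (rule L1_norm_median)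
  also have "\<dots> = L1_norm \<Gamma> (\<lambda>e x. (u e x - ?w e x) + (?w e x - m))" by simp
  also have "\<dots> \<le> L1_norm \<Gamma> (\<lambda>e x. u e x - ?w e x) + L1_norm \<Gamma> (\<lambda>e x. ?w e x - m)"
    by (rule L1_norm_triangle) (use u w_int const in auto)
  also have "\<dots> \<le> 2 * total_length / N * K + L1_norm \<Gamma> (\<lambda>e x. ?w e x - m)"
    using L1_dist_step_le[OF N u TV] by simp
  finally have "h * (L1_norm \<Gamma> u - 2 * total_length / N * K) \<le> h * L1_norm \<Gamma> (\<lambda>e x. ?w e x - m)"
    using h0 by (intro mult_left_mono) auto
  with m show ?thesis by linarith
qed

section \<open>Discrete Cheeger cuts and their limits\<close>

text \<open>Along a path of the symmetrized skeleton, the invariant is that all edges at the current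
  vertex satisfy \<open>P\<close>.\<close>

lemma connected_induct:
  assumes e: "e \<in> E" "P e" and e': "e' \<in> E"
    and step: "\<And>e e' v. e \<in> incident_edges \<Gamma> v \<Longrightarrow> e' \<in> incident_edges \<Gamma> v \<Longrightarrow> P e \<Longrightarrow> P e'"
  shows "P e'"
proof -
  have "Digraph_Component.connected (skeleton \<Gamma>)"
    using ccmg by (simp add: connected_compact_metric_graph_def)
  then have "init_vertex \<Gamma> e \<rightarrow>\<^sup>*\<^bsub>with_proj (mk_symmetric (skeleton \<Gamma>))\<^esub> init_vertex \<Gamma> e'"
    using init_in[OF e(1)] init_in[OF e']
    by (simp add: Digraph_Component.connected_def strongly_connected_def mk_symmetric_def)
  then have "(init_vertex \<Gamma> e, init_vertex \<Gamma> e') \<in> (\<Union>e\<in>E. {(init_vertex \<Gamma> e, term_vertex \<Gamma> e), (term_vertex \<Gamma> e, init_vertex \<Gamma> e)})\<^sup>*"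
    by (auto dest!: reachable_rtranclI simp: mk_symmetric_def)
  then have "\<forall>f\<in>incident_edges \<Gamma> (init_vertex \<Gamma> e'). P f"
  proof (induction rule: rtrancl_induct)
    case base
    have "e \<in> incident_edges \<Gamma> (init_vertex \<Gamma> e)" using e by (simp add: incident_edges_def)
    then show ?case using step e(2) by blast
  next
    case (step v w)
    then obtain f where "f \<in> E" "(v, w) = (init_vertex \<Gamma> f, term_vertex \<Gamma> f) \<or> (v, w) = (term_vertex \<Gamma> f, init_vertex \<Gamma> f)"
      by blast
    then have "f \<in> incident_edges \<Gamma> v" "f \<in> incident_edges \<Gamma> w" by (auto simp: incident_edges_def)
    then show ?case using step.IH assms(4) by blast
  qed
  moreover have "e' \<in> incident_edges \<Gamma> (init_vertex \<Gamma> e')" using e' by (simp add: incident_edges_def)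
  ultimately show ?thesis by blast
qed

text \<open>If the cut were below 1, no node would see both \<open>U\<close> and its complement.
  Membership in \<open>U\<close> would then spread along each edge and across each vertex, and
  connectedness would make \<open>U\<close> empty or everything.\<close>

lemma cell_cut_ge_1:
  assumes N: "0 < N" and U: "U \<subseteq> cells N" "U \<noteq> {}" "U \<noteq> cells N"
  shows "1 \<le> cell_cut N U"
proof (rule ccontr)
  assume "\<not> 1 \<le> cell_cut N U"
  then have same: "fst h' \<in> U"
    if "h \<in> half_cells N" "h' \<in> half_cells N" "end_node N h = end_node N h'" "fst h \<in> U" for h h'
    using cut_ge_1[OF finite_half_cells that(1,2,3), of "U \<times> UNIV"] that(4)
    by (cases h, cases h') (auto simp: cell_cut_def)
  have along: "(e, i) \<in> U \<longleftrightarrow> (e, 0) \<in> U" if "e \<in> E" "i < N" for e i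
    using that(2)
  proof (induction i)
    case (Suc i)
    have "(e, i) \<in> U \<longleftrightarrow> (e, Suc i) \<in> U"
      using same[of "((e, i), True)" "((e, Suc i), False)"] same[of "((e, Suc i), False)" "((e, i), True)"]
        Suc.prems that(1) by auto
    then show ?case using Suc by simp
  qed simp
  have next_edge: "(e', 0) \<in> U"
    if inc: "e \<in> incident_edges \<Gamma> v" "e' \<in> incident_edges \<Gamma> v" and eU: "(e, 0) \<in> U" for e e' v
  proof -
    \<comment> \<open>The half of \<open>e\<close> attached to \<open>v\<close>. By
      \<open>along\<close>, its cell lies in \<open>U\<close> exactly when the first cell of
      \<open>e\<close> does.\<close>
    define f where "f e = (if v = term_vertex \<Gamma> e then ((e, N - 1), True) else ((e, 0), False))" for e
    have f: "f e \<in> half_cells N" "end_node N (f e) = Inl v" "fst (f e) \<in> U \<longleftrightarrow> (e, 0) \<in> U"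
      if "e \<in> incident_edges \<Gamma> v" for e
      using that N along[of e "N - 1"] by (auto simp: f_def incident_edges_def)
    show ?thesis using same[of "f e" "f e'"] f[OF inc(1)] f[OF inc(2)] eU by simp
  qed
  obtain e i where ei: "e \<in> E" "i < N" "(e, i) \<in> U" using U by fastforce
  then have "(e, 0) \<in> U" using along by blast
  then have "(e', 0) \<in> U" if "e' \<in> E" for e'
    using connected_induct[where P = "\<lambda>e. (e, 0) \<in> U" and e = e and e' = e'] ei(1) that next_edge by blast
  then have "cells N \<subseteq> U" using along by blast
  then show False using U by blast
qed

text \<open>A finite family of competitors has a best ratio. With at least two cells per edge, a
  single cell has at most half the total length, so the family is nonempty even on a graph with one
  edge.\<close>

lemma discrete_Cheeger_minimizer:
  assumes N: "2 \<le> N"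
  obtains U h where "U \<subseteq> cells N" "cells_length N U \<le> total_length / 2" "0 \<le> h"
    "cell_cut N U = h * cells_length N U" "1 \<le> h * cells_length N U"
    "\<And>W. W \<subseteq> cells N \<Longrightarrow> cells_length N W \<le> total_length / 2 \<Longrightarrow> h * cells_length N W \<le> cell_cut N W"
proof -
  have N0: "0 < N" using N by simp
  have pos: "0 < cells_length N W" if W: "W \<subseteq> cells N" "W \<noteq> {}" for W
  proof -
    have "finite W" using W(1) by (rule finite_subset) simp
    then show ?thesis unfolding cells_length_def
      by (rule sum_pos) (use W len_pos N0 in \<open>auto intro!: divide_pos_pos\<close>)
  qed
  let ?A = "{W. W \<subseteq> cells N \<and> W \<noteq> {} \<and> cells_length N W \<le> total_length / 2}"
  let ?r = "\<lambda>W. cell_cut N W / cells_length N W"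
  have "?A \<subseteq> Pow (cells N)" by auto
  then have finA: "finite ?A" by (rule finite_subset) simp
  obtain e where e: "e \<in> E" using E_nonempty by blast
  have "cells_length N {(e, 0)} = \<l> e / N" by (simp add: cells_length_def)
  also have "\<dots> \<le> \<l> e / 2" using N len_pos[OF e] by (intro divide_left_mono) auto
  also have "\<dots> \<le> total_length / 2" using len_le_total[OF e] by simp
  finally have "{(e, 0)} \<in> ?A" using e N0 by auto
  then have "?r ` ?A \<noteq> {}" by blast
  then have "Min (?r ` ?A) \<in> ?r ` ?A" using finA by (intro Min_in) auto
  then obtain U where U: "U \<in> ?A" "Min (?r ` ?A) = ?r U" by (rule imageE)
  have min: "?r U \<le> ?r W" if "W \<in> ?A" for W
    unfolding U(2)[symmetric] using finA that by (intro Min_le) auto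
  have U': "U \<subseteq> cells N" "U \<noteq> {}" "cells_length N U \<le> total_length / 2" using U by auto
  have "U \<noteq> cells N" using U'(3) cells_length_all[OF N0] total_length_pos by auto
  then have "1 \<le> cell_cut N U" using cell_cut_ge_1[OF N0 U'(1,2)] by simp
  moreover have eq: "cell_cut N U = ?r U * cells_length N U" using pos[OF U'(1,2)] by simp
  moreover have "?r U * cells_length N W \<le> cell_cut N W"
    if W: "W \<subseteq> cells N" "cells_length N W \<le> total_length / 2" for W
  proof (cases "W = {}")
    case True
    then show ?thesis by (simp add: cell_cut_def cells_length_def)
  next
    case False
    then show ?thesis using min[of W] W pos[OF W(1) False] by (simp add: pos_le_divide_eq)
  qed
  moreover have "0 \<le> ?r U" using pos[OF U'(1,2)] by (simp add: cell_cut_def cut_nonneg)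
  ultimately show ?thesis using U' by (intro that[of U "?r U"]) auto
qed

lemma graph_integral_cells_char:
  assumes "0 < N" "U \<subseteq> cells N"
  shows "graph_integral \<Gamma> (cells_char N U) = cells_length N U"
proof -
  have "graph_integral \<Gamma> (cells_char N U) = (\<Sum>e\<in>E. \<Sum>i<N. indicator U (e, i) * (\<l> e / N))"
    unfolding graph_integral_def cells_char_def
    by (rule sum.cong[OF refl], rule integral_step[where w = "\<lambda>i. indicator U (_, i)"]) (use len_pos assms in auto)
  also have "\<dots> = (\<Sum>h\<in>cells N. if h \<in> U then (case h of (e, i) \<Rightarrow> \<l> e / N) else 0)"
    unfolding sum_cells[symmetric] by (rule sum.cong) auto
  also have "\<dots> = cells_length N U"
    using assms by (simp add: sum.If_cases Int_absorb1 cells_length_def)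
  finally show ?thesis .
qed

lemma integrable_cells_char: "0 < N \<Longrightarrow> e \<in> E \<Longrightarrow> integrable (leb (\<l> e)) (cells_char N U e)"
  unfolding cells_char_def[abs_def]
  by (rule integrable_step_function[where w = "\<lambda>i. indicator U (e, i)"]) (use len_pos in auto)

lemma L1_norm_cells_char:
  assumes "0 < N" "U \<subseteq> cells N"
  shows "L1_norm \<Gamma> (cells_char N U) = cells_length N U"
proof -
  have "(\<lambda>e x. \<bar>cells_char N U e x\<bar>) = cells_char N U" by (simp add: cells_char_def fun_eq_iff)
  then show ?thesis using graph_integral_cells_char[OF assms] by (simp only: L1_norm_def)
qed

lemma median_cells_char:
  assumes "0 < N" "U \<subseteq> cells N" "cells_length N U \<le> total_length / 2"
  shows "0 \<in> medians \<Gamma> (cells_char N U)"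
proof -
  have neg: "{(e, x) \<in> points \<Gamma>. cells_char N U e x < 0} = {}"
    by (auto simp: cells_char_def indicator_def)
  have "graph_length \<Gamma> {(e, x) \<in> points \<Gamma>. cells_char N U e x > 0} = graph_integral \<Gamma> (cells_char N U)"
    unfolding graph_length_eq graph_integral_def
    by (intro sum.cong Bochner_Integration.integral_cong refl)
      (auto simp: cells_char_def points_def indicator_def)
  moreover have "graph_length \<Gamma> {} = 0" by (simp add: graph_length_eq)
  ultimately show ?thesis
    unfolding medians_def mem_Collect_eq neg graph_length_points
    using graph_integral_cells_char[OF assms(1,2)] assms(3) total_length_pos by simp
qed

text \<open>A fixed union of cells of the grid with two cells per edge bounds \<open>h\<close> on
  all fine grids. It need not be a union of cells there, as midpoints are not nodes for odd
  \<open>N\<close>, so it is compared through the inequality with mesh error.\<close>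

lemma discrete_Cheeger_bounded:
  obtains B N0 where "0 < B" "2 \<le> N0"
    "\<And>N h. N0 \<le> N \<Longrightarrow> 0 \<le> h \<Longrightarrow> (\<And>U. U \<subseteq> cells N \<Longrightarrow> cells_length N U \<le> total_length / 2 \<Longrightarrow> h * cells_length N U \<le> cell_cut N U) \<Longrightarrow> h \<le> B"
proof -
  obtain U k where U: "U \<subseteq> cells 2" "cells_length 2 U \<le> total_length / 2"
    "cell_cut 2 U = k * cells_length 2 U" "1 \<le> k * cells_length 2 U"
    by (rule discrete_Cheeger_minimizer[OF order.refl]) blast
  define a where "a = cells_length 2 U"
  define K where "K = cell_cut 2 U"
  have "1 \<le> K" using U by (simp add: K_def)
  have "0 \<le> a" unfolding a_def L1_norm_cells_char[OF _ U(1), symmetric, simplified]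
    by (simp add: L1_norm_def graph_integral_def sum_nonneg)
  moreover have "a \<noteq> 0" using U(3) \<open>1 \<le> K\<close> by (auto simp: K_def a_def)
  ultimately have "0 < a" by simp
  \<comment> \<open>From here on the mesh error is at most half of the length \<open>a\<close> of
    the comparison set, which gives the bound 2 \<open>K\<close> / \<open>a\<close>.\<close>
  define N0 where "N0 = nat \<lceil>4 * total_length * K / a\<rceil> + 2"
  show ?thesis
  proof (rule that[of "2 * K / a" N0])
    show "0 < 2 * K / a" using \<open>0 < a\<close> \<open>1 \<le> K\<close> by simp
    show "2 \<le> N0" by (simp add: N0_def)
    fix N h assume N: "N0 \<le> N" and h0: "0 \<le> h"
      and h: "\<And>U. U \<subseteq> cells N \<Longrightarrow> cells_length N U \<le> total_length / 2 \<Longrightarrow> h * cells_length N U \<le> cell_cut N U"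
    have "0 < N" using N by (simp add: N0_def)
    have "4 * total_length * K / a \<le> real N" using N unfolding N0_def by linarith
    then have small: "2 * total_length / N * K \<le> a / 2" using \<open>0 < a\<close> \<open>0 < N\<close> by (simp add: field_simps)
    have "h * (L1_norm \<Gamma> (cells_char 2 U) - 2 * total_length / N * K) \<le> K"
      by (rule Cheeger_inequality_up_to_mesh[OF \<open>0 < N\<close> _ _ median_cells_char[OF _ U(1,2)] h0 h])
        (use TV_cells_char_le[OF _ U(1)] in \<open>auto simp: K_def intro: integrable_cells_char\<close>)
    then have "h * (a - 2 * total_length / N * K) \<le> K"
      using L1_norm_cells_char[OF _ U(1)] by (simp add: a_def)
    moreover have "h * (a / 2) \<le> h * (a - 2 * total_length / N * K)"
      using small h0 by (intro mult_left_mono) auto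
    ultimately have "h * (a / 2) \<le> K" by (rule order.trans[rotated])
    then have "h * a \<le> 2 * K" by simp
    then show "h \<le> 2 * K / a" using \<open>0 < a\<close> by (simp add: pos_le_divide_eq)
  qed
qed

section \<open>Compactness of characteristic functions\<close>

lemma L1_norm_cong:
  "(\<And>e x. e \<in> E \<Longrightarrow> x \<in> {0<..<\<l> e} \<Longrightarrow> \<bar>u e x\<bar> = \<bar>v e x\<bar>) \<Longrightarrow> L1_norm \<Gamma> u = L1_norm \<Gamma> v"
  unfolding L1_norm_def graph_integral_def
  by (intro sum.cong Bochner_Integration.integral_cong refl) auto

text \<open>Up to a small L^1 error, uniform in the sequence by the bound on TV, every function is
  determined by finitely many rounded cell averages; the pigeonhole principle does the rest.\<close>

lemma totally_bounded_subseq: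
  fixes \<psi> :: "nat \<Rightarrow> 'e \<Rightarrow> real \<Rightarrow> real"
  assumes int: "\<And>n e. e \<in> E \<Longrightarrow> integrable (leb (\<l> e)) (\<psi> n e)"
    and range: "\<And>n e x. \<psi> n e x \<in> {0..1}" and TV: "\<And>n. TV \<Gamma> (\<psi> n) \<le> ereal K" and \<epsilon>: "0 < \<epsilon>"
  obtains r where "strict_mono (r :: nat \<Rightarrow> nat)" "\<And>i j. L1_norm \<Gamma> (\<lambda>e x. \<psi> (r i) e x - \<psi> (r j) e x) < \<epsilon>"
proof -
  \<comment> \<open>\<open>M\<close> makes the averaging error at most \<epsilon>/4, and
    \<open>Q\<close> does the same for the rounding error. Two averaging errors and one rounding
    error stay below \<epsilon>. The absolute value covers a \<open>K\<close> of either
    sign.\<close>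
  define M where "M = nat \<lceil>8 * total_length * \<bar>K\<bar> / \<epsilon>\<rceil> + 1"
  define Q where "Q = nat \<lceil>4 * total_length / \<epsilon>\<rceil> + 1"
  have M: "0 < M" and Q: "0 < Q" by (auto simp: M_def Q_def)
  have "8 * total_length * \<bar>K\<bar> / \<epsilon> \<le> real M" unfolding M_def by linarith
  then have M_small: "2 * total_length / M * \<bar>K\<bar> \<le> \<epsilon> / 4" using \<epsilon> M by (simp add: field_simps)
  have "4 * total_length / \<epsilon> \<le> real Q" unfolding Q_def by linarith
  then have Q_small: "total_length / Q \<le> \<epsilon> / 4" using \<epsilon> Q by (simp add: field_simps)
  define w where "w n e i = cell_average M (\<l> e) (\<psi> n e) i" for n e i
  define p where "p n e x = w n e (cell_index M (\<l> e) x)" for n e x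
  \<comment> \<open>Averages in units of 1/\<open>Q\<close>, rounded down. The restriction to
    \<open>cells M\<close> places all codes in one finite function space.\<close>
  define code where "code n = (\<lambda>(e, i)\<in>cells M. \<lfloor>Q * w n e i\<rfloor>)" for n
  have w_range: "w n e i \<in> {0..1}" if "e \<in> E" "i < M" for n e i
    unfolding w_def using len_pos int that range by (intro cell_average_bounds) auto
  have "code n \<in> cells M \<rightarrow>\<^sub>E {0..int Q}" for n
  proof -
    have "\<lfloor>Q * w n e i\<rfloor> \<in> {0..int Q}" if "e \<in> E" "i < M" for e i
    proof -
      have "0 \<le> Q * w n e i" "Q * w n e i \<le> Q * 1"
        using w_range[OF that, of n] mult_left_mono[of "w n e i" 1 "real Q"] by auto
      then show ?thesis by (simp add: floor_le_iff)
    qed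
    then show ?thesis by (auto simp: code_def)
  qed
  then have "range code \<subseteq> cells M \<rightarrow>\<^sub>E {0..int Q}" by blast
  then have "finite (range code)" by (rule finite_subset) (auto intro!: finite_PiE)
  then obtain n0 where "infinite {n \<in> UNIV. code n = code n0}"
    using pigeonhole_infinite[of UNIV code] by auto
  then obtain r :: "nat \<Rightarrow> nat" where r: "strict_mono r" "\<And>n. code (r n) = code n0"
    using infinite_enumerate[of "{n. code n = code n0}"] by auto
  have p_int: "integrable (leb (\<l> e)) (p n e)" if "e \<in> E" for n e
    unfolding p_def[abs_def] using len_pos[OF that] M by (rule integrable_step_function)
  have osc: "L1_norm \<Gamma> (\<lambda>e x. \<psi> n e x - p n e x) \<le> \<epsilon> / 4" for n
  proof -
    have "TV \<Gamma> (\<psi> n) \<le> ereal \<bar>K\<bar>" using TV[of n] by (rule order.trans) simp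
    from L1_dist_step_le[OF M int this] show ?thesis
      using M_small by (simp add: p_def w_def)
  qed
  have close: "L1_norm \<Gamma> (\<lambda>e x. p (r i) e x - p (r j) e x) \<le> \<epsilon> / 4" for i j
  proof -
    have diff: "\<bar>p (r i) e x - p (r j) e x\<bar> \<le> 1 / Q" if e: "e \<in> E" and x: "x \<in> {0<..<\<l> e}" for e x
    proof -
      let ?k = "cell_index M (\<l> e) x"
      have "?k < M" by (rule cell_index_less) (use len_pos[OF e] M x in auto)
      then have "\<lfloor>Q * w (r i) e ?k\<rfloor> = \<lfloor>Q * w (r j) e ?k\<rfloor>"
        using fun_cong[OF trans[OF r(2)[of i] r(2)[of j, symmetric]], of "(e, ?k)"] e by (simp add: code_def)
      then have "\<bar>Q * w (r i) e ?k - Q * w (r j) e ?k\<bar> \<le> 1" by linarith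
      then have "Q * \<bar>w (r i) e ?k - w (r j) e ?k\<bar> \<le> 1"
        by (simp add: right_diff_distrib[symmetric] abs_mult)
      then show ?thesis using Q by (simp add: p_def field_simps)
    qed
    have "L1_norm \<Gamma> (\<lambda>e x. p (r i) e x - p (r j) e x) \<le> (\<Sum>e\<in>E. 1 / Q * \<l> e)"
      unfolding L1_norm_def graph_integral_def
    proof (rule sum_mono)
      fix e assume e: "e \<in> E"
      have const: "integrable (leb (\<l> e)) (\<lambda>_. 1 / Q :: real)"
        by (rule integrable_leb_bounded[where B="1 / Q"]) auto
      have "(\<integral>x. \<bar>p (r i) e x - p (r j) e x\<bar> \<partial>leb (\<l> e)) \<le> (\<integral>x. 1 / Q \<partial>leb (\<l> e))"
        by (rule integral_mono) (use p_int[OF e] const diff[OF e] in auto)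
      also have "\<dots> = 1 / Q * \<l> e" using len_pos[OF e] by (intro integral_leb_const) simp
      finally show "(\<integral>x. \<bar>p (r i) e x - p (r j) e x\<bar> \<partial>leb (\<l> e)) \<le> 1 / Q * \<l> e" .
    qed
    also have "\<dots> = total_length / Q" by (simp add: total_length_def sum_divide_distrib)
    also note Q_small
    finally show ?thesis .
  qed
  have "L1_norm \<Gamma> (\<lambda>e x. \<psi> (r i) e x - \<psi> (r j) e x) < \<epsilon>" for i j
  proof -
    have "L1_norm \<Gamma> (\<lambda>e x. \<psi> (r i) e x - \<psi> (r j) e x) =
        L1_norm \<Gamma> (\<lambda>e x. (\<psi> (r i) e x - p (r i) e x) + ((p (r i) e x - p (r j) e x) + (p (r j) e x - \<psi> (r j) e x)))"
      by simp
    also have "\<dots> \<le> L1_norm \<Gamma> (\<lambda>e x. \<psi> (r i) e x - p (r i) e x) +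
        L1_norm \<Gamma> (\<lambda>e x. (p (r i) e x - p (r j) e x) + (p (r j) e x - \<psi> (r j) e x))"
      by (rule L1_norm_triangle) (use int p_int in auto)
    also have "L1_norm \<Gamma> (\<lambda>e x. (p (r i) e x - p (r j) e x) + (p (r j) e x - \<psi> (r j) e x)) \<le>
        L1_norm \<Gamma> (\<lambda>e x. p (r i) e x - p (r j) e x) + L1_norm \<Gamma> (\<lambda>e x. p (r j) e x - \<psi> (r j) e x)"
      by (rule L1_norm_triangle) (use int p_int in auto)
    also have "L1_norm \<Gamma> (\<lambda>e x. p (r j) e x - \<psi> (r j) e x) = L1_norm \<Gamma> (\<lambda>e x. \<psi> (r j) e x - p (r j) e x)"
      by (rule L1_norm_cong) (rule abs_minus_commute)
    finally show ?thesis using osc[of "r i"] osc[of "r j"] close[of i j] \<epsilon> by linarith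
  qed
  with r(1) show ?thesis by (rule that)
qed

text \<open>A diagonal subsequence has consecutive distances below 2^-n. For functions with values 0
  and 1, this distance is the length of the set where two consecutive terms differ, so by
  Borel-Cantelli almost every point sees an eventually constant sequence. The limit is therefore
  again the indicator of a set.\<close>

lemma compactness:
  fixes \<psi> :: "nat \<Rightarrow> 'e \<Rightarrow> real \<Rightarrow> real"
  assumes int: "\<And>n e. e \<in> E \<Longrightarrow> integrable (leb (\<l> e)) (\<psi> n e)"
    and range: "\<And>n e x. \<psi> n e x \<in> {0, 1}" and TV: "\<And>n. TV \<Gamma> (\<psi> n) \<le> ereal K"
  obtains r D where "strict_mono (r :: nat \<Rightarrow> nat)" "graph_measurable \<Gamma> D"
    "\<And>e. e \<in> E \<Longrightarrow> AE x in leb (\<l> e). (\<lambda>k. \<psi> (r k) e x) \<longlonglongrightarrow> chi D e x"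
proof -
  have range': "\<psi> n e x \<in> {0..1}" for n e x using range[of n e x] by auto
  interpret subseqs "\<lambda>k s. \<forall>i j. L1_norm \<Gamma> (\<lambda>e x. \<psi> (s i) e x - \<psi> (s j) e x) < (1 / 2) ^ k"
  proof
    fix k and s :: "nat \<Rightarrow> nat"
    show "\<exists>r :: nat \<Rightarrow> nat. strict_mono r \<and> (\<forall>i j. L1_norm \<Gamma> (\<lambda>e x. \<psi> ((s \<circ> r) i) e x - \<psi> ((s \<circ> r) j) e x) < (1 / 2) ^ k)"
    proof (rule totally_bounded_subseq[of "\<lambda>n. \<psi> (s n)" K "(1 / 2) ^ k"])
      fix r :: "nat \<Rightarrow> nat"
      assume "strict_mono r" and close: "\<And>i j. L1_norm \<Gamma> (\<lambda>e x. \<psi> (s (r i)) e x - \<psi> (s (r j)) e x) < (1 / 2) ^ k"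
      show ?thesis
        by (intro exI[of _ r] conjI allI \<open>strict_mono r\<close>) (simp add: close)
    qed (use int range' TV in auto)
  qed
  \<comment> \<open>\<open>diagseq_holds\<close> controls property \<open>n\<close> only on the
    diagonal sequence from index \<open>Suc n\<close> on; the shift makes \<open>r n\<close> and
    \<open>r (Suc n)\<close> the first two terms of that tail.\<close>
  define r where "r n = diagseq (Suc n)" for n
  have r: "strict_mono r" using subseq_diagseq by (simp add: r_def strict_mono_def)
  have fast: "L1_norm \<Gamma> (\<lambda>e x. \<psi> (r n) e x - \<psi> (r (Suc n)) e x) < (1 / 2) ^ n" for n
  proof -
    have "\<forall>i j. L1_norm \<Gamma> (\<lambda>e x. \<psi> ((diagseq \<circ> (+) (Suc n)) i) e x - \<psi> ((diagseq \<circ> (+) (Suc n)) j) e x) < (1 / 2) ^ n"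
      by (rule diagseq_holds) auto
    from this[rule_format, of 0 1] show ?thesis by (simp add: r_def)
  qed
  define D where "D = {(e, x) \<in> points \<Gamma>. \<forall>\<^sub>F k in sequentially. \<psi> (r k) e x = 1}"
  have meas: "\<psi> n e \<in> borel_measurable (leb (\<l> e))" if "e \<in> E" for n e using int[OF that] by simp
  have "graph_measurable \<Gamma> D"
    unfolding graph_measurable_def
  proof (intro conjI ballI)
    show "D \<subseteq> points \<Gamma>" by (auto simp: D_def)
    fix e assume e: "e \<in> E"
    have [measurable]: "\<psi> n e \<in> borel_measurable (leb (\<l> e))" for n by (rule meas[OF e])
    have "{x \<in> space (leb (\<l> e)). \<forall>\<^sub>F k in sequentially. \<psi> (r k) e x = 1} \<in> sets (leb (\<l> e))"
      by (rule sets_Collect_eventually_sequentially) measurable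
    moreover have "{x \<in> space (leb (\<l> e)). \<forall>\<^sub>F k in sequentially. \<psi> (r k) e x = 1} = Pair e -` D"
      using e by (auto simp: D_def points_def)
    ultimately show "Pair e -` D \<in> sets lebesgue"
      by (simp add: sets_restrict_space_iff)
  qed
  moreover have "AE x in leb (\<l> e). (\<lambda>k. \<psi> (r k) e x) \<longlonglongrightarrow> chi D e x" if e: "e \<in> E" for e
  proof -
    define A where "A n = {x \<in> space (leb (\<l> e)). \<psi> (r n) e x \<noteq> \<psi> (r (Suc n)) e x}" for n
    have [measurable]: "\<psi> n e \<in> borel_measurable (leb (\<l> e))" for n by (rule meas[OF e])
    have A_sets: "A n \<in> sets (leb (\<l> e))" for n unfolding A_def by measurable
    have "measure (leb (\<l> e)) (A n) \<le> (1 / 2) ^ n" for n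
    proof -
      have "measure (leb (\<l> e)) (A n) = (\<integral>x. indicator (A n) x \<partial>leb (\<l> e))"
        using sets.sets_into_space[OF A_sets[of n]] by (simp add: Int_absorb2)
      also have "\<dots> = (\<integral>x. \<bar>\<psi> (r n) e x - \<psi> (r (Suc n)) e x\<bar> \<partial>leb (\<l> e))"
      proof (rule Bochner_Integration.integral_cong[OF refl])
        fix x assume "x \<in> space (leb (\<l> e))"
        then show "indicator (A n) x = \<bar>\<psi> (r n) e x - \<psi> (r (Suc n)) e x\<bar>"
          using range[of "r n" e x] range[of "r (Suc n)" e x] by (auto simp: A_def)
      qed
      also have "\<dots> \<le> L1_norm \<Gamma> (\<lambda>e x. \<psi> (r n) e x - \<psi> (r (Suc n)) e x)"
        unfolding L1_norm_def graph_integral_def using e by (intro member_le_sum) auto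
      also have "\<dots> \<le> (1 / 2) ^ n" using fast[of n] by simp
      finally show ?thesis .
    qed
    then have "summable (\<lambda>n. measure (leb (\<l> e)) (A n))"
      by (intro summable_comparison_test'[OF summable_geometric[of "1 / 2 :: real"]]) auto
    then have "AE x in leb (\<l> e). \<forall>\<^sub>F n in sequentially. x \<in> space (leb (\<l> e)) - A n"
      using A_sets finite_measure.emeasure_finite[OF finite_measure_leb, of "\<l> e"]
      by (intro borel_cantelli_AE1) (auto simp: less_top)
    then show ?thesis
    proof (rule AE_mp, intro AE_I2 impI)
      fix x assume x: "x \<in> space (leb (\<l> e))" and "\<forall>\<^sub>F n in sequentially. x \<in> space (leb (\<l> e)) - A n"
      then obtain n0 where n0_A: "\<And>n. n0 \<le> n \<Longrightarrow> x \<in> space (leb (\<l> e)) - A n"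
        unfolding eventually_sequentially by blast
      have n0: "\<psi> (r (Suc n)) e x = \<psi> (r n) e x" if "n0 \<le> n" for n
        using n0_A[OF that] x by (simp add: A_def)
      have const: "\<psi> (r n) e x = \<psi> (r n0) e x" if "n0 \<le> n" for n
        using that by (induction rule: dec_induct) (simp_all add: n0)
      have ev: "\<forall>\<^sub>F k in sequentially. \<psi> (r k) e x = \<psi> (r n0) e x"
        by (rule eventually_sequentiallyI[of n0]) (rule const)
      have "chi D e x = \<psi> (r n0) e x"
      proof (cases "\<psi> (r n0) e x = 1")
        case True
        have "\<forall>\<^sub>F k in sequentially. \<psi> (r k) e x = 1"
          using ev by (rule eventually_mono) (simp only: True)
        then show ?thesis using True e x by (simp add: chi_def D_def points_def)
      next
        case False
        have "\<not> (\<forall>\<^sub>F k in sequentially. \<psi> (r k) e x = 1)"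
        proof
          assume "\<forall>\<^sub>F k in sequentially. \<psi> (r k) e x = 1"
          with ev have "\<forall>\<^sub>F k in sequentially. \<psi> (r n0) e x = 1" by (rule eventually_elim2) simp
          then show False using False by simp
        qed
        moreover have "\<psi> (r n0) e x = 0" using False range[of "r n0" e x] by simp
        ultimately show ?thesis by (simp add: chi_def D_def)
      qed
      then show "(\<lambda>k. \<psi> (r k) e x) \<longlonglongrightarrow> chi D e x" using ev by (simp add: tendsto_eventually)
    qed
  qed
  ultimately show ?thesis by (rule that[OF r])
qed

section \<open>Indicators as competitors, scaling and limits of pairings\<close>

lemma chi_integrable:
  assumes "graph_measurable \<Gamma> D" "e \<in> E"
  shows "integrable (leb (\<l> e)) (chi D e)"
proof -
  have "indicator (Pair e -` D) \<in> borel_measurable (leb (\<l> e))"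
    using assms by (intro indicator_leb_measurable) (simp add: graph_measurable_def)
  moreover have "chi D e = indicator (Pair e -` D)"
    by (auto simp: chi_def fun_eq_iff indicator_def)
  ultimately show ?thesis
    by (intro integrable_leb_bounded[where B=1]) (auto split: split_indicator)
qed

lemma TV_mult_le:
  assumes "0 < c"
  shows "TV \<Gamma> (\<lambda>e x. c * u e x) \<le> ereal c * TV \<Gamma> u"
proof -
  have eq: "graph_integral \<Gamma> (\<lambda>e x. c * u e x * g e x) = c * graph_integral \<Gamma> (\<lambda>e x. u e x * g e x)" for g
    by (simp add: graph_integral_def sum_distrib_left mult.assoc)
  show ?thesis
    unfolding TV_def[of _ "\<lambda>e x. c * u e x"]
  proof (rule SUP_least)
    fix p assume p: "p \<in> {(z, z'). z \<in> X_K \<Gamma> \<and> graph_weak_derivative \<Gamma> z z' \<and> Linf_norm \<Gamma> z \<le> 1}"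
    have "(case p of (z, z') \<Rightarrow> ereal \<bar>graph_integral \<Gamma> (\<lambda>e x. u e x * z' e x)\<bar>) \<le> TV \<Gamma> u"
      unfolding TV_def using p by (rule SUP_upper)
    then have "ereal c * (case p of (z, z') \<Rightarrow> ereal \<bar>graph_integral \<Gamma> (\<lambda>e x. u e x * z' e x)\<bar>) \<le> ereal c * TV \<Gamma> u"
      using assms by (intro ereal_mult_left_mono) auto
    then show "(case p of (z, z') \<Rightarrow> ereal \<bar>graph_integral \<Gamma> (\<lambda>e x. c * u e x * z' e x)\<bar>) \<le> ereal c * TV \<Gamma> u"
      using assms by (cases p) (simp only: prod.case eq abs_mult abs_of_pos times_ereal.simps(1))
  qed
qed

lemma TV_mult:
  assumes "0 < c"
  shows "TV \<Gamma> (\<lambda>e x. c * u e x) = ereal c * TV \<Gamma> u"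
proof (rule antisym[OF TV_mult_le[OF assms]])
  have "TV \<Gamma> u \<le> ereal (1 / c) * TV \<Gamma> (\<lambda>e x. c * u e x)"
    using TV_mult_le[of "1 / c" "\<lambda>e x. c * u e x"] assms by simp
  then have "ereal c * TV \<Gamma> u \<le> ereal c * (ereal (1 / c) * TV \<Gamma> (\<lambda>e x. c * u e x))"
    using assms by (intro ereal_mult_left_mono) auto
  also have "\<dots> = TV \<Gamma> (\<lambda>e x. c * u e x)"
    using assms by (simp add: mult.assoc[symmetric] one_ereal_def[symmetric])
  finally show "ereal c * TV \<Gamma> u \<le> TV \<Gamma> (\<lambda>e x. c * u e x)" .
qed

lemma TV_nonneg: "0 \<le> TV \<Gamma> u"
proof -
  have "primitive l (\<lambda>_. 0) x = 0" for l x by (simp add: primitive_def)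
  then have "kirchhoff_field \<Gamma> (\<lambda>_. 0) (\<lambda>_ _. 0)"
    by (auto simp: kirchhoff_field_def intro!: sum.neutral)
  from TV_ge[OF this, of 0 u] show ?thesis by (simp add: graph_integral_def zero_ereal_def)
qed

lemma primitive_deriv_test_function:
  assumes \<phi>: "\<phi> \<in> test_functions l" and l: "0 < l" and x: "x \<in> {0..l}"
  shows "integrable (leb l) (deriv \<phi>)" "primitive l (deriv \<phi>) x = \<phi> x"
proof -
  obtain C where C: "\<And>x. \<bar>deriv \<phi> x\<bar> \<le> C"
    using vanishing_outside_bounded[OF test_function_deriv(2)[OF \<phi>] test_function_support(2)[OF \<phi>]] by blast
  have meas [measurable]: "deriv \<phi> \<in> borel_measurable borel"
    using test_function_deriv(2)[OF \<phi>] by (intro borel_measurable_continuous_onI)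
  show int: "integrable (leb l) (deriv \<phi>)"
    using C by (intro integrable_leb_bounded borel_measurable_leb meas)
  have tail: "primitive l (deriv \<phi>) l - primitive l (deriv \<phi>) x = - \<phi> x" if x: "x \<in> {0..l}" for x
  proof -
    have "primitive l (deriv \<phi>) l - primitive l (deriv \<phi>) x = (\<integral>s. indicator {x..l} s * deriv \<phi> s \<partial>leb l)"
      using x by (intro integral_leb_Icc[OF int, symmetric]) auto
    also have "\<dots> = (\<integral>s. indicator {x..} s * deriv \<phi> s \<partial>leb l)"
      by (rule Bochner_Integration.integral_cong) (auto split: split_indicator)
    also have "\<dots> = (\<integral>s. indicator {x..} s * deriv \<phi> s \<partial>lborel)"
      by (rule integral_leb_eq_lborel) (use test_function_support(2)[OF \<phi>] in auto)
    also have "\<dots> = - \<phi> x" by (rule test_function_integral_Ici[OF \<phi>])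
    finally show ?thesis .
  qed
  show "primitive l (deriv \<phi>) x = \<phi> x"
    using tail[OF x] tail[of 0] test_function_support(1)[OF \<phi>, of 0] l by simp
qed

text \<open>A test function on one edge, extended by 0 to the other edges, vanishes at all vertices
  and is a valid field. Finite TV therefore gives membership in BV.\<close>

lemma variation_le_TV:
  assumes e: "e \<in> E"
  shows "variation_interval (\<l> e) (u e) \<le> TV \<Gamma> u"
  unfolding variation_interval_def
proof (rule SUP_least)
  fix \<phi> assume "\<phi> \<in> {\<phi> \<in> test_functions (\<l> e). \<forall>x. \<bar>\<phi> x\<bar> \<le> 1}"
  then have \<phi>: "\<phi> \<in> test_functions (\<l> e)" and bound: "\<bar>\<phi> x\<bar> \<le> 1" for x by auto
  define g where "g e' = (if e' = e then deriv \<phi> else (\<lambda>_. 0))" for e'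
  have prim_0: "primitive l (\<lambda>_. 0) x = 0" for l x by (simp add: primitive_def)
  have prim: "primitive (\<l> e') (g e') x = (if e' = e then \<phi> x else 0)" if "e' \<in> E" "x \<in> {0..\<l> e'}" for e' x
    using primitive_deriv_test_function(2)[OF \<phi> len_pos[OF e]] that by (auto simp: g_def prim_0)
  have "kirchhoff_field \<Gamma> (\<lambda>_. 0) g"
    unfolding kirchhoff_field_def
  proof (intro conjI ballI)
    fix e' assume e': "e' \<in> E"
    show "integrable (leb (\<l> e')) (g e')"
      using primitive_deriv_test_function(1)[OF \<phi> len_pos[OF e], of 0] len_pos[OF e] by (auto simp: g_def)
    show "\<bar>0 + primitive (\<l> e') (g e') x\<bar> \<le> 1" if "x \<in> {0..\<l> e'}" for x
      using prim[OF e' that] bound by simp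
  next
    fix v
    show "(\<Sum>e'\<in>incident_edges \<Gamma> v. if v = term_vertex \<Gamma> e' then 0 + primitive (\<l> e') (g e') (\<l> e') else - 0) = 0"
    proof (rule sum.neutral, rule ballI)
      fix e' assume "e' \<in> incident_edges \<Gamma> v"
      then have e': "e' \<in> E" by (simp add: incident_edges_def)
      have "\<phi> (\<l> e) = 0" by (rule test_function_support(1)[OF \<phi>]) simp
      then show "(if v = term_vertex \<Gamma> e' then 0 + primitive (\<l> e') (g e') (\<l> e') else - 0) = 0"
        using prim[OF e', of "\<l> e'"] len_pos[OF e'] by auto
    qed
  qed
  moreover obtain C where "\<And>x. \<bar>deriv \<phi> x\<bar> \<le> C" "0 \<le> C"
    using vanishing_outside_bounded[OF test_function_deriv(2)[OF \<phi>] test_function_support(2)[OF \<phi>]] by blast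
  then have "\<bar>g e' x\<bar> \<le> C" for e' x by (simp add: g_def)
  ultimately have "ereal \<bar>graph_integral \<Gamma> (\<lambda>e x. u e x * g e x)\<bar> \<le> TV \<Gamma> u" by (rule TV_ge)
  moreover have "graph_integral \<Gamma> (\<lambda>e x. u e x * g e x) = (\<integral>x. u e x * deriv \<phi> x \<partial>leb (\<l> e))"
  proof -
    have "graph_integral \<Gamma> (\<lambda>e x. u e x * g e x) =
        (\<Sum>e'\<in>E. if e' = e then \<integral>x. u e x * deriv \<phi> x \<partial>leb (\<l> e) else 0)"
      unfolding graph_integral_def by (rule sum.cong) (auto simp: g_def)
    then show ?thesis using e by simp
  qed
  ultimately have "ereal \<bar>\<integral>x. u e x * deriv \<phi> x \<partial>leb (\<l> e)\<bar> \<le> TV \<Gamma> u" by simp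
  then show "ereal (\<integral>x. u e x * deriv \<phi> x \<partial>leb (\<l> e)) \<le> TV \<Gamma> u"
    by (rule order.trans[rotated]) simp
qed

text \<open>Turns sets into functions with the same quotient. It is used twice: for the optimal cut,
  to obtain the minimizer, and for arbitrary competing sets, to bound the Cheeger constant from
  below.\<close>

lemma normalized_indicator:
  assumes D: "cheeger_admissible \<Gamma> D"
  defines "u \<equiv> \<lambda>e x. 1 / graph_length \<Gamma> D * chi D e x"
  shows "TV \<Gamma> u = Per \<Gamma> D / ereal (graph_length \<Gamma> D)"
    and "Per \<Gamma> D < \<infinity> \<Longrightarrow> u \<in> Pi_set \<Gamma>"
    and "superlevel \<Gamma> u 0 = D"
proof -
  have D_meas: "graph_measurable \<Gamma> D" and pos: "0 < graph_length \<Gamma> D"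
    and half: "graph_length \<Gamma> D \<le> total_length / 2" and sub: "D \<subseteq> points \<Gamma>"
    using D by (auto simp: cheeger_admissible_def graph_measurable_def graph_length_points)
  show TV: "TV \<Gamma> u = Per \<Gamma> D / ereal (graph_length \<Gamma> D)"
    unfolding u_def Per_def using TV_mult[of "1 / graph_length \<Gamma> D" "chi D"] pos
    by (simp add: divide_ereal_def mult.commute inverse_eq_divide)
  have u_pos: "u e x > 0 \<longleftrightarrow> (e, x) \<in> D" and u_nonneg: "0 \<le> u e x" for e x
    using pos by (auto simp: u_def chi_def indicator_def)
  show super: "superlevel \<Gamma> u 0 = D"
    using sub u_pos by (auto simp: superlevel_def)
  show "u \<in> Pi_set \<Gamma>" if fin: "Per \<Gamma> D < \<infinity>"
  proof -
    have "u e \<in> BV_interval (\<l> e)" if e: "e \<in> E" for e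
    proof -
      have "integrable (leb (\<l> e)) (u e)"
        unfolding u_def using chi_integrable[OF D_meas e] by (rule integrable_mult_right)
      moreover have "variation_interval (\<l> e) (u e) < \<infinity>"
        using variation_le_TV[OF e, of u] fin pos unfolding TV
        by (cases "Per \<Gamma> D") (auto simp: Per_def TV_nonneg)
      ultimately show ?thesis by (simp add: BV_interval_def Lp_interval_1_iff)
    qed
    moreover have "L1_norm \<Gamma> u = 1"
    proof -
      have "(\<lambda>e x. \<bar>u e x\<bar>) = u" using u_nonneg by (simp add: fun_eq_iff)
      then have "L1_norm \<Gamma> u = graph_integral \<Gamma> u" by (simp only: L1_norm_def)
      moreover have "graph_integral \<Gamma> (\<lambda>e x. k * chi D e x) = k * graph_length \<Gamma> D" for k
        by (simp add: graph_length_def graph_integral_def sum_distrib_left)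
      ultimately have "L1_norm \<Gamma> u = 1 / graph_length \<Gamma> D * graph_length \<Gamma> D"
        by (simp only: u_def)
      then show ?thesis using pos by simp
    qed
    moreover have "0 \<in> medians \<Gamma> u"
    proof -
      have neg: "{(e, x) \<in> points \<Gamma>. u e x < 0} = {}" using u_nonneg by (auto simp: not_less)
      have sup: "{(e, x) \<in> points \<Gamma>. u e x > 0} = D" using super by (simp add: superlevel_def)
      have "graph_length \<Gamma> {} = 0" by (simp add: graph_length_eq)
      then show ?thesis
        unfolding medians_def mem_Collect_eq neg sup graph_length_points
        using half total_length_pos by simp
    qed
    ultimately show ?thesis by (simp add: Pi_set_def BV_def)
  qed
qed

text \<open>Dominated convergence with majorant |g|. Integrability of \<open>g\<close> suffices, so
  bounds on perimeters pass to the limit one field at a time.\<close>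

lemma pairing_tendsto:
  assumes int: "\<And>n e. e \<in> E \<Longrightarrow> integrable (leb (\<l> e)) (\<psi> n e)"
    and range: "\<And>n e x. \<bar>\<psi> n e x\<bar> \<le> (1 :: real)" and g: "\<And>e. e \<in> E \<Longrightarrow> integrable (leb (\<l> e)) (g e)"
    and D: "graph_measurable \<Gamma> D"
    and AE: "\<And>e. e \<in> E \<Longrightarrow> AE x in leb (\<l> e). (\<lambda>k. \<psi> k e x) \<longlonglongrightarrow> chi D e x"
  shows "(\<lambda>k. graph_integral \<Gamma> (\<lambda>e x. \<psi> k e x * g e x)) \<longlonglongrightarrow> graph_integral \<Gamma> (\<lambda>e x. chi D e x * g e x)"
  unfolding graph_integral_def
proof (rule tendsto_sum)
  fix e assume e: "e \<in> E"
  have [measurable]: "g e \<in> borel_measurable (leb (\<l> e))" "chi D e \<in> borel_measurable (leb (\<l> e))"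
    "\<And>n. \<psi> n e \<in> borel_measurable (leb (\<l> e))"
    using g[OF e] chi_integrable[OF D e] int[OF e] by auto
  show "(\<lambda>k. \<integral>x. \<psi> k e x * g e x \<partial>leb (\<l> e)) \<longlonglongrightarrow> (\<integral>x. chi D e x * g e x \<partial>leb (\<l> e))"
  proof (rule integral_dominated_convergence[where w = "\<lambda>x. \<bar>g e x\<bar>"])
    show "integrable (leb (\<l> e)) (\<lambda>x. \<bar>g e x\<bar>)" using g[OF e] by simp
    show "AE x in leb (\<l> e). (\<lambda>k. \<psi> k e x * g e x) \<longlonglongrightarrow> chi D e x * g e x"
      using AE[OF e] by (rule eventually_mono) (intro tendsto_mult tendsto_const)
    show "AE x in leb (\<l> e). norm (\<psi> k e x * g e x) \<le> \<bar>g e x\<bar>" for k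
      using range by (intro AE_I2) (simp add: abs_mult mult_left_le_one_le)
  qed measurable
qed

section \<open>The optimal cut and the theorem\<close>

lemma Pi_setD:
  assumes "u \<in> Pi_set \<Gamma>"
  shows "e \<in> E \<Longrightarrow> integrable (leb (\<l> e)) (u e)" "L1_norm \<Gamma> u = 1" "0 \<in> medians \<Gamma> u"
  using assms by (auto simp: Pi_set_def BV_def BV_interval_def Lp_interval_1_iff)

text \<open>For a fixed field and a fixed competitor \<open>u\<close>, the pairing with a discrete
  minimizer is at most its cut \<open>h * len\<close>, and \<open>h\<close> is bounded by TV
  \<open>u\<close> up to the mesh error. Both bounds pass to the limit together, so \<open>D\<close>
  beats every \<open>u\<close> without identifying the limit of \<open>h\<close>.\<close>

lemma optimal_cut_exists:
  obtains D where "cheeger_admissible \<Gamma> D" "Per \<Gamma> D < \<infinity>"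
    "\<And>u. u \<in> Pi_set \<Gamma> \<Longrightarrow> Per \<Gamma> D / ereal (graph_length \<Gamma> D) \<le> TV \<Gamma> u"
proof -
  obtain B N0 where B: "0 < B" and N0: "2 \<le> N0" and h_bound:
    "\<And>N h. N0 \<le> N \<Longrightarrow> 0 \<le> h \<Longrightarrow> (\<And>U. U \<subseteq> cells N \<Longrightarrow> cells_length N U \<le> total_length / 2 \<Longrightarrow> h * cells_length N U \<le> cell_cut N U) \<Longrightarrow> h \<le> B"
    by (rule discrete_Cheeger_bounded) blast
  have "\<forall>n. \<exists>U h. U \<subseteq> cells (n + N0) \<and> cells_length (n + N0) U \<le> total_length / 2 \<and> 0 \<le> h \<and>
      cell_cut (n + N0) U = h * cells_length (n + N0) U \<and> 1 \<le> h * cells_length (n + N0) U \<and>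
      (\<forall>W. W \<subseteq> cells (n + N0) \<longrightarrow> cells_length (n + N0) W \<le> total_length / 2 \<longrightarrow>
        h * cells_length (n + N0) W \<le> cell_cut (n + N0) W)"
  proof
    fix n
    have "2 \<le> n + N0" using N0 by simp
    then show "\<exists>U h. U \<subseteq> cells (n + N0) \<and> cells_length (n + N0) U \<le> total_length / 2 \<and> 0 \<le> h \<and>
      cell_cut (n + N0) U = h * cells_length (n + N0) U \<and> 1 \<le> h * cells_length (n + N0) U \<and>
      (\<forall>W. W \<subseteq> cells (n + N0) \<longrightarrow> cells_length (n + N0) W \<le> total_length / 2 \<longrightarrow>
        h * cells_length (n + N0) W \<le> cell_cut (n + N0) W)"
      by (rule discrete_Cheeger_minimizer) blast
  qed
  then obtain U h where Uh: "\<forall>n. U n \<subseteq> cells (n + N0) \<and> cells_length (n + N0) (U n) \<le> total_length / 2 \<and> 0 \<le> h n \<and>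
      cell_cut (n + N0) (U n) = h n * cells_length (n + N0) (U n) \<and> 1 \<le> h n * cells_length (n + N0) (U n) \<and>
      (\<forall>W. W \<subseteq> cells (n + N0) \<longrightarrow> cells_length (n + N0) W \<le> total_length / 2 \<longrightarrow>
        h n * cells_length (n + N0) W \<le> cell_cut (n + N0) W)"
    unfolding choice_iff by blast
  have U: "U n \<subseteq> cells (n + N0)" "cells_length (n + N0) (U n) \<le> total_length / 2" and h0: "0 \<le> h n"
    and cut: "cell_cut (n + N0) (U n) = h n * cells_length (n + N0) (U n)"
    and ge1: "1 \<le> h n * cells_length (n + N0) (U n)"
    and min: "W \<subseteq> cells (n + N0) \<Longrightarrow> cells_length (n + N0) W \<le> total_length / 2 \<Longrightarrow>
        h n * cells_length (n + N0) W \<le> cell_cut (n + N0) W" for n W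
    using Uh by blast+
  have NN: "0 < n + N0" for n using N0 by simp
  define len where "len n = cells_length (n + N0) (U n)" for n
  have hB: "h n \<le> B" for n by (rule h_bound[OF _ h0 min]) auto
  have len_nonneg: "0 \<le> len n" for n
    unfolding len_def L1_norm_cells_char[OF NN U(1), symmetric] L1_norm_def graph_integral_def
    by (intro sum_nonneg) auto
  \<comment> \<open>The cut is at least 1 and equals \<open>h n * len n\<close> with
    \<open>h n\<close> at most \<open>B\<close>. This bound survives the limit and gives
    \<open>D\<close> positive length.\<close>
  have len_ge: "1 / B \<le> len n" for n
  proof -
    have "1 \<le> h n * len n" using ge1 by (simp add: len_def)
    also have "\<dots> \<le> B * len n" using hB len_nonneg by (rule mult_right_mono)
    finally show ?thesis using B by (simp add: field_simps)
  qed
  define \<psi> where "\<psi> n = cells_char (n + N0) (U n)" for n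
  define K where "K = B * (total_length / 2)"
  have cut_le: "cell_cut (n + N0) (U n) \<le> K" for n
    unfolding cut K_def using hB h0 U(2) len_nonneg B by (intro mult_mono) (auto simp: len_def)
  have \<psi>_int: "integrable (leb (\<l> e)) (\<psi> n e)" if "e \<in> E" for n e
    unfolding \<psi>_def using NN that by (rule integrable_cells_char)
  have \<psi>_range: "\<psi> n e x \<in> {0, 1}" for n e x by (simp add: \<psi>_def cells_char_def indicator_def)
  have \<psi>_abs: "\<bar>\<psi> n e x\<bar> \<le> 1" for n e x using \<psi>_range[of n e x] by auto
  have \<psi>_TV: "TV \<Gamma> (\<psi> n) \<le> ereal K" for n
    unfolding \<psi>_def using TV_cells_char_le[OF NN U(1)] by (rule order.trans) (simp add: cut_le)
  obtain r D where r: "strict_mono (r :: nat \<Rightarrow> nat)" and D: "graph_measurable \<Gamma> D"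
    and AE: "\<And>e. e \<in> E \<Longrightarrow> AE x in leb (\<l> e). (\<lambda>k. \<psi> (r k) e x) \<longlonglongrightarrow> chi D e x"
    by (rule compactness[where \<psi> = \<psi>, OF \<psi>_int \<psi>_range \<psi>_TV]) blast+
  have lim: "(\<lambda>k. graph_integral \<Gamma> (\<lambda>e x. \<psi> (r k) e x * g e x)) \<longlonglongrightarrow> graph_integral \<Gamma> (\<lambda>e x. chi D e x * g e x)"
    if "\<And>e. e \<in> E \<Longrightarrow> integrable (leb (\<l> e)) (g e)" for g
    by (rule pairing_tendsto[OF \<psi>_int \<psi>_abs that D AE])
  have one: "integrable (leb l) (\<lambda>_. 1 :: real)" for l by (rule integrable_leb_bounded[where B=1]) auto
  have len_lim: "(\<lambda>k. len (r k)) \<longlonglongrightarrow> graph_length \<Gamma> D"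
    using lim[of "\<lambda>_ _. 1", OF one] graph_integral_cells_char[OF NN U(1)]
    by (simp add: len_def \<psi>_def graph_length_def)
  have len_D: "1 / B \<le> graph_length \<Gamma> D" "graph_length \<Gamma> D \<le> total_length / 2"
    using LIMSEQ_le_const[OF len_lim, of "1 / B"] LIMSEQ_le_const2[OF len_lim, of "total_length / 2"] len_ge U(2)
    by (auto simp: len_def)
  then have pos: "0 < graph_length \<Gamma> D" using B by (meson divide_pos_pos less_le_trans zero_less_one)
  have adm: "cheeger_admissible \<Gamma> D"
    using D pos len_D by (simp add: cheeger_admissible_def graph_length_points)
  have "Per \<Gamma> D \<le> ereal K"
    unfolding Per_def
  proof (rule TV_leI)
    fix c g assume field: "kirchhoff_field \<Gamma> c g"
    then have g: "integrable (leb (\<l> e)) (g e)" if "e \<in> E" for e using that by (simp add: kirchhoff_field_def)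
    have "\<bar>graph_integral \<Gamma> (\<lambda>e x. \<psi> (r k) e x * g e x)\<bar> \<le> K" for k
      unfolding \<psi>_def using cells_char_pairing_le[OF NN U(1) field] cut_le by (rule order.trans)
    then have "\<bar>graph_integral \<Gamma> (\<lambda>e x. chi D e x * g e x)\<bar> \<le> K"
      by (intro LIMSEQ_le_const2[OF tendsto_rabs[OF lim[OF g]]]) auto
    then show "ereal \<bar>graph_integral \<Gamma> (\<lambda>e x. chi D e x * g e x)\<bar> \<le> ereal K" by simp
  qed
  then have fin: "Per \<Gamma> D < \<infinity>" by (rule le_less_trans) simp
  have "Per \<Gamma> D / ereal (graph_length \<Gamma> D) \<le> TV \<Gamma> u" if u: "u \<in> Pi_set \<Gamma>" for u
  proof (cases "TV \<Gamma> u")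
    case (real T)
    then have "0 \<le> T" using TV_nonneg[of u] by simp
    have "Per \<Gamma> D \<le> ereal (T * graph_length \<Gamma> D)"
      unfolding Per_def
    proof (rule TV_leI)
      fix c g assume field: "kirchhoff_field \<Gamma> c g"
      then have g: "integrable (leb (\<l> e)) (g e)" if "e \<in> E" for e using that by (simp add: kirchhoff_field_def)
      \<comment> \<open>The normalization of \<open>u\<close> minus the mesh error. It tends to 1
        but may be negative on coarse grids, where the estimate below holds because its left side is
        nonpositive.\<close>
      define m where "m k = 1 - 2 * total_length / real (r k + N0) * T" for k
      have "\<bar>graph_integral \<Gamma> (\<lambda>e x. \<psi> (r k) e x * g e x)\<bar> * m k \<le> T * len (r k)" for k
      proof (cases "0 \<le> m k")
        case True
        have "\<bar>graph_integral \<Gamma> (\<lambda>e x. \<psi> (r k) e x * g e x)\<bar> * m k \<le> (h (r k) * len (r k)) * m k"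
          unfolding \<psi>_def len_def cut[symmetric]
          by (rule mult_right_mono[OF cells_char_pairing_le[OF NN U(1) field] True])
        also have "\<dots> = (h (r k) * m k) * len (r k)" by simp
        also have "h (r k) * m k \<le> T"
          unfolding m_def Pi_setD(2)[OF u, symmetric]
          by (rule Cheeger_inequality_up_to_mesh[OF NN Pi_setD(1)[OF u] _ Pi_setD(3)[OF u] h0 min]) (auto simp: real)
        finally show ?thesis using len_nonneg by (simp add: mult_right_mono)
      next
        case False
        then have "\<bar>graph_integral \<Gamma> (\<lambda>e x. \<psi> (r k) e x * g e x)\<bar> * m k \<le> 0" by (simp add: mult_nonneg_nonpos)
        also have "0 \<le> T * len (r k)" using \<open>0 \<le> T\<close> len_nonneg by simp
        finally show ?thesis .
      qed
      moreover have "m \<longlonglongrightarrow> 1 - 0 * T"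
        unfolding m_def[abs_def]
      proof (intro tendsto_diff tendsto_mult tendsto_const)
        have "filterlim (\<lambda>k. real (r k + N0)) at_top sequentially"
          using filterlim_compose[OF filterlim_real_sequentially filterlim_compose[OF filterlim_add_const_nat_at_top filterlim_subseq[OF r]]] .
        then show "(\<lambda>k. 2 * total_length / real (r k + N0)) \<longlonglongrightarrow> 0"
          by (rule real_tendsto_divide_at_top[OF tendsto_const])
      qed
      then have "(\<lambda>k. \<bar>graph_integral \<Gamma> (\<lambda>e x. \<psi> (r k) e x * g e x)\<bar> * m k) \<longlonglongrightarrow> \<bar>graph_integral \<Gamma> (\<lambda>e x. chi D e x * g e x)\<bar> * (1 - 0 * T)"
        by (intro tendsto_mult tendsto_rabs lim g)
      moreover have "(\<lambda>k. T * len (r k)) \<longlonglongrightarrow> T * graph_length \<Gamma> D"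
        by (intro tendsto_mult tendsto_const len_lim)
      ultimately have "\<bar>graph_integral \<Gamma> (\<lambda>e x. chi D e x * g e x)\<bar> * (1 - 0 * T) \<le> T * graph_length \<Gamma> D"
        by (intro LIMSEQ_le) auto
      then show "ereal \<bar>graph_integral \<Gamma> (\<lambda>e x. chi D e x * g e x)\<bar> \<le> ereal (T * graph_length \<Gamma> D)" by simp
    qed
    then show ?thesis using pos real by (cases "Per \<Gamma> D") (auto simp: field_simps)
  qed (use TV_nonneg[of u] in auto)
  with adm fin show ?thesis by (rule that)
qed

text \<open>The quotient of \<open>D\<close> is minimal among all of \<open>Pi_set \<Gamma>\<close>
  and is attained by its normalized indicator; comparing with normalized indicators of other sets
  shows that it is the Cheeger constant too. The level 0 recovers \<open>D\<close>.\<close>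

lemma Cheeger_eq_lambda1:
  "cheeger_constant \<Gamma> = lambda1 \<Gamma> \<and>
    (\<exists>u\<in>Pi_set \<Gamma>. TV \<Gamma> u = lambda1 \<Gamma> \<and> (\<exists>t\<ge>0. cheeger_cut \<Gamma> (superlevel \<Gamma> u t)))"
proof -
  obtain D where D: "cheeger_admissible \<Gamma> D" "Per \<Gamma> D < \<infinity>"
    and opt: "\<And>u. u \<in> Pi_set \<Gamma> \<Longrightarrow> Per \<Gamma> D / ereal (graph_length \<Gamma> D) \<le> TV \<Gamma> u"
    by (rule optimal_cut_exists) blast
  define u where "u e x = 1 / graph_length \<Gamma> D * chi D e x" for e x
  have u_eq: "u = (\<lambda>e x. 1 / graph_length \<Gamma> D * chi D e x)" by (simp add: u_def fun_eq_iff)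
  have u: "u \<in> Pi_set \<Gamma>" "TV \<Gamma> u = Per \<Gamma> D / ereal (graph_length \<Gamma> D)" "superlevel \<Gamma> u 0 = D"
    unfolding u_eq using normalized_indicator[OF D(1)] D(2) by auto
  have lambda: "lambda1 \<Gamma> = TV \<Gamma> u"
    unfolding lambda1_def
    by (rule antisym[OF INF_lower[OF u(1)] INF_greatest]) (simp add: u(2) opt)
  have cheeger: "cheeger_constant \<Gamma> = TV \<Gamma> u"
    unfolding cheeger_constant_def
  proof (rule antisym)
    show "(INF D\<in>{D. cheeger_admissible \<Gamma> D}. Per \<Gamma> D / ereal (graph_length \<Gamma> D)) \<le> TV \<Gamma> u"
      unfolding u(2) by (rule INF_lower) (simp add: D(1))
    show "TV \<Gamma> u \<le> (INF D\<in>{D. cheeger_admissible \<Gamma> D}. Per \<Gamma> D / ereal (graph_length \<Gamma> D))"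
    proof (rule INF_greatest)
      fix D' assume "D' \<in> {D. cheeger_admissible \<Gamma> D}"
      then have D': "cheeger_admissible \<Gamma> D'" by simp
      show "TV \<Gamma> u \<le> Per \<Gamma> D' / ereal (graph_length \<Gamma> D')"
      proof (cases "Per \<Gamma> D' < \<infinity>")
        case True
        then show ?thesis
          using opt[OF normalized_indicator(2)[OF D' True]] normalized_indicator(1)[OF D'] u(2) by simp
      next
        \<comment> \<open>A set of infinite perimeter has no normalized indicator in
          \<open>Pi_set \<Gamma>\<close>, but its quotient is infinite because its length is finite
          and positive.\<close>
        case False
        then show ?thesis using D' by (simp add: cheeger_admissible_def)
      qed
    qed
  qed
  have "cheeger_cut \<Gamma> (superlevel \<Gamma> u 0)"
    unfolding u(3) cheeger_cut_def using D(1) cheeger u(2) by simp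
  then show ?thesis using cheeger lambda u(1) by (auto intro!: bexI[of _ u])
qed

end

theorem theorem5p1:
  fixes \<Gamma> :: "('v, 'e) metric_graph"
  assumes "connected_compact_metric_graph \<Gamma>"
  shows "cheeger_constant \<Gamma> = lambda1 \<Gamma> \<and>
    (\<exists>u\<in>Pi_set \<Gamma>. TV \<Gamma> u = lambda1 \<Gamma> \<and> (\<exists>t\<ge>0. cheeger_cut \<Gamma> (superlevel \<Gamma> u t)))"
  by (rule connected_metric_graph.Cheeger_eq_lambda1[OF connected_metric_graph.intro[OF assms]])

end
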